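(* Let $\mu$ be a Borel probability measure on $\mathbb{C}$ with compact, infinite support, and let $D=(d_{i,j})_{i,j=1}^{\infty}$ be the Hessenberg matrix associated with $\mu$. Assume that: (1) $\mu$ is regular, and its support $\Gamma=\operatorname{supp}(\mu)$ is a Jordan arc or a finite union of Jordan arcs such that $\mathbb{C}_\infty\setminus\Gamma$ is a simply connected subset of the Riemann sphere $\mathbb{C}_\infty$; (2) the operator $D$ on $\ell^2$ is uniformly asymptotically Toeplitz, and the corresponding limit matrix $T$ has a continuous symbol. Let $\phi:\mathbb{C}_\infty\setminus\overline{\mathbb{D}}\to\mathbb{C}_\infty\setminus\Gamma$ be the Riemann mapping function. Then the sequence of functions $$h_n(z)=d_{n+1,n}z+d_{n,n}+\frac{d_{n-1,n}}{z}+\frac{d_{n-2,n}}{z^2}+\cdots+\frac{d_{1,n}}{z^{n-1}}$$ converges uniformly to $\phi(z)$ on every compact set $K\subset\mathbb{C}\setminus\overline{\mathbb{D}}$.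
   Context: $\mathbb{D}$ is the open unit disk, $\mathbb{T}$ the unit circle, $\mathbb{C}_\infty$ the Riemann sphere. A Jordan arc is a subset of $\mathbb{C}$ homeomorphic to $[0,1]$. Simply connected open sets are understood to be connected. Orthonormal polynomials and Hessenberg matrix: $\{P_n\}_{n\ge 0}$ is the sequence of orthonormal polynomials for $\langle Q,R\rangle_\mu=\int Q\overline{R}\,d\mu$, with $\deg P_n=n$, positive leading coefficient $\gamma_n$, and $P_0=1$. The Hessenberg matrix $D=(d_{i,j})_{i,j\ge1}$ associated with $\mu$ is the infinite upper Hessenberg matrix defined by $zP_n(z)=\sum_{k=0}^{n+1}d_{k+1,n+1}P_k(z)$, $n\ge 0$ (with $d_{i,j}=0$ for $i>j+1$). It is the matrix, in the basis $\{P_n\}$, of multiplication by $z$ on the closure of the polynomials in $L^2(\mu)$, and it is regarded as an operator on $\ell^2$. Regular measure: $\mu$ is regular if $\lim_{n\to\infty}\gamma_n^{-1/n}=\operatorname{cap}(\operatorname{supp}(\mu))$, the logarithmic capacity. Uniformly asymptotically Toeplitz: a bounded operator $A$ on $\ell^2$ is uniformly asymptotically Toeplitz if there is a bounded operator $T$ on $\ell^2$ with $\lim_{n\to\infty}\|S^{*n}AS^n-T\|=0$, where $S$ is the forward (unilateral) shift on $\ell^2$. The limit $T$ is called the limit matrix; it is a Toeplitz matrix, $T=(a_{i-j})_{i,j\ge1}$. Symbol: the symbol of a Toeplitz matrix $T=(a_{i-j})_{i,j\ge1}$ is the function on $\mathbb{T}$ given by the Laurent (Fourier) series $\sum_{k\in\mathbb{Z}}a_kz^k$.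 For $T$ the limit of a Hessenberg matrix, $a_k=0$ for $k\ge 2$, so, writing $d_k=a_k$, the symbol is $f_T(z)=\sum_{k=-1}^\infty d_{-k}z^{-k}$, where $d_k=\lim_{n\to\infty}d_{n+k,n}$. For a bounded $T$ the symbol is the element of $L^\infty(\mathbb{T})$ with these Fourier coefficients; "continuous symbol" means that it has a continuous representative, which is then called the symbol. Riemann mapping function: for a compact $\Gamma\subset\mathbb{C}$, not a point, with $\mathbb{C}_\infty\setminus\Gamma$ simply connected, $\phi$ is the unique conformal (bijective) map $\mathbb{C}_\infty\setminus\overline{\mathbb{D}}\to\mathbb{C}_\infty\setminus\Gamma$ with $\phi(\infty)=\infty$ and $\phi'(\infty)>0$, i.e. with expansion $\phi(z)=c_1z+c_0+c_{-1}z^{-1}+\cdots$ for $|z|>1$ and $c_1>0$ (then $c_1=\operatorname{cap}(\Gamma)$). *)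

theory Defs
  imports "HOL-Probability.Probability"
begin

section \<open>The Hilbert space of square-summable complex sequences\<close>

definition square_summable :: "(nat \<Rightarrow> complex) \<Rightarrow> bool" where
  "square_summable x \<longleftrightarrow> summable (\<lambda>n. (cmod (x n))\<^sup>2)"

lemma square_summable_0: "square_summable (\<lambda>n. 0)"
  by (simp add: square_summable_def)

lemma square_summable_scale:
  assumes "square_summable x" shows "square_summable (\<lambda>n. c * x n)"
  using assms unfolding square_summable_def
  by (auto simp: norm_mult power_mult_distrib intro: summable_mult)

lemma square_summable_add:
  assumes "square_summable x" "square_summable y"
  shows "square_summable (\<lambda>n. x n + y n)"
  unfolding square_summable_def
proof (rule summable_comparison_test)
  have "(cmod (a + b))\<^sup>2 \<le> 2 * (cmod a)\<^sup>2 + 2 * (cmod b)\<^sup>2" for a b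
  proof -
    have "(cmod (a + b))\<^sup>2 \<le> (cmod a + cmod b)\<^sup>2"
      by (intro power_mono norm_triangle_ineq) auto
    also have "\<dots> \<le> 2 * (cmod a)\<^sup>2 + 2 * (cmod b)\<^sup>2"
      using sum_squares_bound[of "cmod a" "cmod b"] by (simp add: power2_sum)
    finally show ?thesis .
  qed
  then show "\<exists>N. \<forall>n\<ge>N. norm ((cmod (x n + y n))\<^sup>2) \<le> 2 * (cmod (x n))\<^sup>2 + 2 * (cmod (y n))\<^sup>2"
    by simp
  show "summable (\<lambda>n. 2 * (cmod (x n))\<^sup>2 + 2 * (cmod (y n))\<^sup>2)"
    using assms unfolding square_summable_def by (intro summable_add summable_mult)
qed

lemma square_summable_diff:
  assumes "square_summable x" "square_summable y"
  shows "square_summable (\<lambda>n. x n - y n)"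
  using square_summable_add[OF assms(1) square_summable_scale[OF assms(2), of "-1"]] by simp

lemma square_summable_norm_mult:
  assumes "square_summable x" "square_summable y"
  shows "summable (\<lambda>n. cmod (x n) * cmod (y n))"
proof (rule summable_comparison_test)
  show "\<exists>N. \<forall>n\<ge>N. norm (cmod (x n) * cmod (y n)) \<le> (cmod (x n))\<^sup>2 + (cmod (y n))\<^sup>2"
  proof (intro exI allI impI)
    fix n
    have "0 \<le> cmod (x n) * cmod (y n)" by simp
    then show "norm (cmod (x n) * cmod (y n)) \<le> (cmod (x n))\<^sup>2 + (cmod (y n))\<^sup>2"
      using sum_squares_bound[of "cmod (x n)" "cmod (y n)"] by (simp only: real_norm_def)
  qed
  show "summable (\<lambda>n. (cmod (x n))\<^sup>2 + (cmod (y n))\<^sup>2)"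
    using assms unfolding square_summable_def by (intro summable_add)
qed

lemma square_summable_inner:
  assumes "square_summable x" "square_summable y"
  shows "summable (\<lambda>n. inner (x n) (y n))"
  by (rule summable_comparison_test[OF _ square_summable_norm_mult[OF assms]])
     (use Cauchy_Schwarz_ineq2 in auto)

typedef ell2 = "{x. square_summable x}"
  morphisms ell2_coord Abs_ell2
  using square_summable_0 by blast

setup_lifting type_definition_ell2

lemma ell2_eqI: "(\<And>n. ell2_coord x n = ell2_coord y n) \<Longrightarrow> x = y"
  by (simp add: ell2_coord_inject[symmetric] fun_eq_iff)

lemma square_summable_coord: "square_summable (ell2_coord x)"
  using ell2_coord by blast

instantiation ell2 :: real_inner
begin

lift_definition zero_ell2 :: ell2 is "\<lambda>n. 0"
  by (rule square_summable_0)
lift_definition plus_ell2 :: "ell2 \<Rightarrow> ell2 \<Rightarrow> ell2" is "\<lambda>x y n. x n + y n"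
  by (rule square_summable_add)
lift_definition uminus_ell2 :: "ell2 \<Rightarrow> ell2" is "\<lambda>x n. - x n"
  by (simp add: square_summable_def)
lift_definition minus_ell2 :: "ell2 \<Rightarrow> ell2 \<Rightarrow> ell2" is "\<lambda>x y n. x n - y n"
  by (rule square_summable_diff)
lift_definition scaleR_ell2 :: "real \<Rightarrow> ell2 \<Rightarrow> ell2" is "\<lambda>r x n. complex_of_real r * x n"
  by (rule square_summable_scale)

(* The real part of the complex inner product; it induces the usual l2 norm. *)
definition inner_ell2 :: "ell2 \<Rightarrow> ell2 \<Rightarrow> real" where
  "inner_ell2 x y = (\<Sum>n. inner (ell2_coord x n) (ell2_coord y n))"
definition norm_ell2 :: "ell2 \<Rightarrow> real" where
  "norm_ell2 x = sqrt (\<Sum>n. (cmod (ell2_coord x n))\<^sup>2)"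
definition dist_ell2 :: "ell2 \<Rightarrow> ell2 \<Rightarrow> real" where
  "dist_ell2 x y = norm (x - y)"
definition sgn_ell2 :: "ell2 \<Rightarrow> ell2" where
  "sgn_ell2 x = inverse (norm x) *\<^sub>R x"
definition uniformity_ell2 :: "(ell2 \<times> ell2) filter" where
  "uniformity_ell2 = (INF e\<in>{0<..}. principal {(x, y). dist x y < e})"
definition open_ell2 :: "ell2 set \<Rightarrow> bool" where
  "open_ell2 U \<longleftrightarrow> (\<forall>x\<in>U. \<forall>\<^sub>F (x', y) in uniformity. x' = x \<longrightarrow> y \<in> U)"

instance
proof
  fix x y z :: ell2 and r s :: real
  show "x + y + z = x + (y + z)" "x + y = y + x" "0 + x = x" "- x + x = 0" "x - y = x + - y"
    "r *\<^sub>R (x + y) = r *\<^sub>R x + r *\<^sub>R y" "(r + s) *\<^sub>R x = r *\<^sub>R x + s *\<^sub>R x"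
    "r *\<^sub>R s *\<^sub>R x = (r * s) *\<^sub>R x" "1 *\<^sub>R x = x"
    by (simp_all add: ell2_coord_inject[symmetric] fun_eq_iff zero_ell2.rep_eq plus_ell2.rep_eq
          uminus_ell2.rep_eq minus_ell2.rep_eq scaleR_ell2.rep_eq distrib_left distrib_right)
  show "sgn x = inverse (norm x) *\<^sub>R x" by (rule sgn_ell2_def)
  show "dist x y = norm (x - y)" by (rule dist_ell2_def)
  show "inner x y = inner y x" by (simp add: inner_ell2_def inner_commute)
  show "inner (x + y) z = inner x z + inner y z"
    unfolding inner_ell2_def plus_ell2.rep_eq inner_add_left
    by (intro suminf_add[symmetric] square_summable_inner square_summable_coord)
  have "inner (complex_of_real r * a) b = r * inner a b" for a b
    by (simp add: inner_complex_def distrib_left mult.assoc)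
  then show "inner (r *\<^sub>R x) y = r * inner x y"
    unfolding inner_ell2_def scaleR_ell2.rep_eq
    by (simp only: suminf_mult[OF square_summable_inner[OF square_summable_coord square_summable_coord]])
  have sm: "summable (\<lambda>n. inner (ell2_coord x n) (ell2_coord x n))"
    by (intro square_summable_inner square_summable_coord)
  show "0 \<le> inner x x" unfolding inner_ell2_def by (intro suminf_nonneg sm) simp
  have "inner x x = 0 \<longleftrightarrow> (\<forall>n. ell2_coord x n = 0)"
    unfolding inner_ell2_def by (subst suminf_eq_zero_iff[OF sm]) auto
  also have "\<dots> \<longleftrightarrow> x = 0"
    by (auto simp: zero_ell2.rep_eq intro: ell2_eqI)
  finally show "inner x x = 0 \<longleftrightarrow> x = 0" .
  show "norm x = sqrt (inner x x)"
    by (simp add: norm_ell2_def inner_ell2_def power2_norm_eq_inner)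
next
  show "(uniformity :: (ell2 \<times> ell2) filter) = (INF e\<in>{0<..}. principal {(x, y). dist x y < e})"
    by (rule uniformity_ell2_def)
next
  fix U :: "ell2 set"
  show "open U \<longleftrightarrow> (\<forall>x\<in>U. \<forall>\<^sub>F (x', y) in uniformity. x' = x \<longrightarrow> y \<in> U)"
    by (rule open_ell2_def)
qed

end

lift_definition ell2_scaleC :: "complex \<Rightarrow> ell2 \<Rightarrow> ell2" is "\<lambda>c x n. c * x n"
  by (rule square_summable_scale)

lift_definition ell2_unit :: "nat \<Rightarrow> ell2" is "\<lambda>j n. if n = j then 1 else 0"
  unfolding square_summable_def
proof -
  fix j :: nat
  show "summable (\<lambda>n. (cmod (if n = j then 1 else 0))\<^sup>2)"
    by (rule summable_finite[of "{j}"]) auto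
qed

lift_definition ell2_shift :: "ell2 \<Rightarrow> ell2"
  is "\<lambda>x n. if n = 0 then 0 else x (n - 1)"
  unfolding square_summable_def
proof -
  fix x :: "nat \<Rightarrow> complex"
  assume "summable (\<lambda>n. (cmod (x n))\<^sup>2)"
  then show "summable (\<lambda>n. (cmod (if n = 0 then 0 else x (n - 1)))\<^sup>2)"
    using summable_Suc_iff[of "\<lambda>n. (cmod (if n = 0 then 0 else x (n - 1)))\<^sup>2"] by simp
qed

lift_definition ell2_unshift :: "ell2 \<Rightarrow> ell2" is "\<lambda>x n. x (Suc n)"
  unfolding square_summable_def
proof -
  fix x :: "nat \<Rightarrow> complex"
  assume "summable (\<lambda>n. (cmod (x n))\<^sup>2)"
  then show "summable (\<lambda>n. (cmod (x (Suc n)))\<^sup>2)"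
    using summable_Suc_iff[of "\<lambda>n. (cmod (x n))\<^sup>2"] by simp
qed

(* The backward shift is the Hilbert space adjoint of the forward shift. *)
lemma ell2_shift_adjoint:
  "(\<Sum>n. ell2_coord (ell2_shift x) n * cnj (ell2_coord y n)) =
   (\<Sum>n. ell2_coord x n * cnj (ell2_coord (ell2_unshift y) n))"
proof -
  have "summable (\<lambda>n. ell2_coord (ell2_shift x) n * cnj (ell2_coord y n))"
    using square_summable_norm_mult[OF square_summable_coord square_summable_coord,
        of "ell2_shift x" y]
    by (simp add: summable_norm_cancel norm_mult)
  from suminf_split_head[OF this] show ?thesis
    by (simp add: ell2_shift.rep_eq ell2_unshift.rep_eq)
qed

definition bounded_operator :: "(ell2 \<Rightarrow> ell2) \<Rightarrow> bool" where
  "bounded_operator A \<longleftrightarrow>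
     bounded_linear A \<and> (\<forall>c x. A (ell2_scaleC c x) = ell2_scaleC c (A x))"

(* Matrix entries of an operator are indexed from 0 here. *)
definition matrix_entry :: "(ell2 \<Rightarrow> ell2) \<Rightarrow> nat \<Rightarrow> nat \<Rightarrow> complex" where
  "matrix_entry A i j = ell2_coord (A (ell2_unit j)) i"

definition uniform_toeplitz_limit :: "(ell2 \<Rightarrow> ell2) \<Rightarrow> (ell2 \<Rightarrow> ell2) \<Rightarrow> bool" where
  "uniform_toeplitz_limit A T \<longleftrightarrow>
     bounded_operator A \<and> bounded_operator T \<and>
     (\<lambda>n. onorm (\<lambda>x. (ell2_unshift ^^ n) (A ((ell2_shift ^^ n) x)) - T x)) \<longlonglongrightarrow> 0"

definition fourier_coeff :: "(complex \<Rightarrow> complex) \<Rightarrow> int \<Rightarrow> complex" where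
  "fourier_coeff f k =
     (LBINT t:{0..2 * pi}. f (cis t) * cis (- (of_int k * t))) / (2 * pi)"

(* f represents the element of L^\<infinity>(circle) whose k-th Fourier coefficient is the
   constant value of T on the diagonal i - j = k; only the values on the circle matter. *)
definition is_symbol :: "(ell2 \<Rightarrow> ell2) \<Rightarrow> (complex \<Rightarrow> complex) \<Rightarrow> bool" where
  "is_symbol T f \<longleftrightarrow>
     set_borel_measurable lborel {0..2 * pi} (\<lambda>t. f (cis t)) \<and>
     (\<exists>C. AE t in lborel. t \<in> {0..2 * pi} \<longrightarrow> cmod (f (cis t)) \<le> C) \<and>
     (\<forall>i j. matrix_entry T i j = fourier_coeff f (int i - int j))"

section \<open>Orthonormal polynomials and the Hessenberg matrix\<close>

definition measure_support :: "complex measure \<Rightarrow> complex set" where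
  "measure_support \<mu> = {z. \<forall>U. open U \<and> z \<in> U \<longrightarrow> emeasure \<mu> U > 0}"

definition orthonormal_polys :: "complex measure \<Rightarrow> (nat \<Rightarrow> complex poly) \<Rightarrow> bool" where
  "orthonormal_polys \<mu> P \<longleftrightarrow>
     (\<forall>n. degree (P n) = n \<and> lead_coeff (P n) \<in> \<real> \<and> 0 < Re (lead_coeff (P n))) \<and>
     (\<forall>m n. (LINT z|\<mu>. poly (P m) z * cnj (poly (P n) z)) = (if m = n then 1 else 0))"

(* Indices of d start at 1; entries with an index 0 carry no meaning. *)
definition hessenberg_matrix :: "(nat \<Rightarrow> complex poly) \<Rightarrow> (nat \<Rightarrow> nat \<Rightarrow> complex) \<Rightarrow> bool" where
  "hessenberg_matrix P d \<longleftrightarrow>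
     (\<forall>n. [:0, 1:] * P n = (\<Sum>k=0..n + 1. smult (d (k + 1) (n + 1)) (P k))) \<and>
     (\<forall>i j. 1 \<le> i \<and> 1 \<le> j \<and> j + 1 < i \<longrightarrow> d i j = 0)"

definition operator_of_matrix :: "(nat \<Rightarrow> nat \<Rightarrow> complex) \<Rightarrow> (ell2 \<Rightarrow> ell2) \<Rightarrow> bool" where
  "operator_of_matrix d A \<longleftrightarrow>
     bounded_operator A \<and> (\<forall>i j. matrix_entry A i j = d (i + 1) (j + 1))"

definition hessenberg_fun :: "(nat \<Rightarrow> nat \<Rightarrow> complex) \<Rightarrow> nat \<Rightarrow> complex \<Rightarrow> complex" where
  "hessenberg_fun d n z = d (n + 1) n * z + (\<Sum>k<n. d (n - k) n / z ^ k)"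

section \<open>Logarithmic capacity and regular measures\<close>

(* The value on the diagonal has to be set explicitly because ln 0 = 0. *)
definition log_kernel :: "complex \<Rightarrow> complex \<Rightarrow> ereal" where
  "log_kernel z w = (if z = w then \<infinity> else ereal (ln (1 / dist z w)))"

(* Positive part minus negative part; the latter is finite for compactly supported
   probability measures, so no \<infinity> - \<infinity> occurs. *)
definition log_energy :: "complex measure \<Rightarrow> ereal" where
  "log_energy \<nu> =
     enn2ereal (\<integral>\<^sup>+p. e2ennreal (log_kernel (fst p) (snd p)) \<partial>(\<nu> \<Otimes>\<^sub>M \<nu>)) -
     enn2ereal (\<integral>\<^sup>+p. e2ennreal (- log_kernel (fst p) (snd p)) \<partial>(\<nu> \<Otimes>\<^sub>M \<nu>))"

definition robin_constant :: "complex set \<Rightarrow> ereal" where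
  "robin_constant K =
     (INF \<nu>\<in>{\<nu>. prob_space \<nu> \<and> sets \<nu> = sets borel \<and> (AE z in \<nu>. z \<in> K)}. log_energy \<nu>)"

(* Meaningful for compact K, where the Robin constant is never -\<infinity>. *)
definition log_capacity :: "complex set \<Rightarrow> real" where
  "log_capacity K =
     (if robin_constant K = \<infinity> then 0 else exp (- real_of_ereal (robin_constant K)))"

definition regular_measure :: "complex measure \<Rightarrow> (nat \<Rightarrow> complex poly) \<Rightarrow> bool" where
  "regular_measure \<mu> P \<longleftrightarrow>
     (\<lambda>n. Re (lead_coeff (P n)) powr (- 1 / real n))
       \<longlonglongrightarrow> log_capacity (measure_support \<mu>)"

section \<open>The Riemann sphere and the exterior Riemann mapping\<close>

definition jordan_arc :: "complex set \<Rightarrow> bool" where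
  "jordan_arc J \<longleftrightarrow> J homeomorphic {0..1::real}"

(* None is the point at infinity. *)
definition riemann_sphere :: "complex option topology" where
  "riemann_sphere = Alexandroff_compactification euclidean"

(* The library notion simply_connected, for abstract topologies. *)
definition simply_connected_space :: "'a topology \<Rightarrow> bool" where
  "simply_connected_space X \<longleftrightarrow>
     (\<forall>p q. pathin X p \<and> p 1 = p 0 \<and> pathin X q \<and> q 1 = q 0 \<longrightarrow>
        homotopic_with (\<lambda>r. r 1 = r 0) (top_of_set {0..1}) X p q)"

lemma simply_connected_space_top_of_set:
  fixes S :: "'a::topological_space set"
  shows "simply_connected_space (top_of_set S) \<longleftrightarrow> simply_connected S"
  unfolding simply_connected_space_def simply_connected_def homotopic_loops_def
    pathfinish_def pathstart_def path_def path_image_def pathin_def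
  by (auto simp: image_subset_iff_funcset)

definition sphere_complement :: "complex set \<Rightarrow> complex option topology" where
  "sphere_complement \<Gamma> =
     subtopology riemann_sphere (- Some ` \<Gamma>)"

(* The map is given on the finite points; the expansion says that it extends by
   \<infinity> \<mapsto> \<infinity> to a conformal map with positive derivative c1 at \<infinity>. *)
definition riemann_mapping :: "(complex \<Rightarrow> complex) \<Rightarrow> complex set \<Rightarrow> bool" where
  "riemann_mapping \<phi> \<Gamma> \<longleftrightarrow>
     \<phi> holomorphic_on {z. 1 < cmod z} \<and>
     bij_betw \<phi> {z. 1 < cmod z} (- \<Gamma>) \<and>
     (\<exists>(c1::real) c. 0 < c1 \<and>
        (\<forall>z. 1 < cmod z \<longrightarrow> (\<lambda>k. c k / z ^ k) sums (\<phi> z - c1 * z)))"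

end

theory Submission
  imports Defs "HOL-Complex_Analysis.Complex_Analysis"
begin

text \<open>
  Let \<open>\<Gamma>\<close> be the support and \<open>f\<close> the continuous symbol. For \<open>w \<notin> \<Gamma>\<close>, orthonormality gives
  \<open>dist(w, \<Gamma>) |x| \<le> |(D - w) x|\<close>. If \<open>w = f \<zeta>\<close>, this fails for the vectors
  \<open>x = (cnj \<zeta>)\<^sup>k\<close>, \<open>m \<le> k < m + N\<close>: far out \<open>D\<close> acts like the Toeplitz matrix, which takes \<open>x\<close>
  to the Fourier coefficients of \<open>f\<close> times a trigonometric polynomial concentrated at \<open>\<zeta>\<close>. So \<open>f\<close>
  maps the circle into \<open>\<Gamma>\<close>. The symbol has no Fourier coefficients of index \<open>\<ge> 2\<close>, and by
  the Poisson formula its extension \<open>F\<close> to the exterior of the disk has boundary values \<open>f\<close>.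

  The subdiagonal entries are the ratios \<open>\<gamma>\<^sub>n / \<gamma>\<^sub>n\<^sub>+\<^sub>1\<close>, so regularity gives \<open>F'(\<infinity>) \<ge> cap(\<Gamma>)\<close>. The
  boundary values of the Riemann map \<open>\<phi>\<close> exist almost everywhere because its coefficients are square
  summable; the image of the uniform measure under them has energy at most \<open>- ln \<phi>'(\<infinity>)\<close>, hence
  \<open>cap(\<Gamma>) \<ge> \<phi>'(\<infinity>)\<close>. By the maximum principle \<open>\<phi>\<inverse>(F z) / z\<close> is bounded by 1 where it is defined,
  and its value at infinity is at least 1, so \<open>F = \<phi>\<close>. Finally, the coefficients of the functions
  \<open>h\<^sub>n\<close> converge to those of \<open>F\<close> and are uniformly bounded.
\<close>

section \<open>Fourier analysis on the circle\<close>

text \<open>The columns of \<open>d\<close> are full above the diagonal, so entrywise convergence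
  would not control the image of a vector placed far out. Operator-norm convergence controls all
  rows from the \<open>n\<close>-th on, with an error independent of the length and position of the
  vector. The finitely many rows before it are handled by moving the vector still further out, since
  each row of a bounded operator tends to 0.

  The comparison of \<open>F\<close> with \<open>\<phi>\<close> works without continuity of
  \<open>\<phi>\<close> at the circle and without injectivity of \<open>F\<close>. A priori
  \<open>F\<close> may meet \<open>\<Gamma>\<close> outside the closed disk, so the inverse of
  \<open>\<phi>\<close> can be applied to it only on an open set, whose additional boundary points
  have to be controlled like those on the circle. Both kinds are covered by one fact: near
  \<open>\<Gamma>\<close> the inverse has modulus close to 1. For the leading coefficient
  \<open>D\<close> of \<open>F\<close> the maximum principle gives \<open>D \<le> c1\<close>.
  Capacity supplies the opposite inequality, through a one-sided estimate on each side: an upper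
  bound for the energy of one measure and a comparison of a root limit with a ratio limit.\<close>

definition circle_measure :: "real measure" where
  "circle_measure = density lborel (\<lambda>t. ennreal (indicator {0..2 * pi} t / (2 * pi)))"

lemma sets_circle_measure [measurable_cong, simp]: "sets circle_measure = sets borel"
  by (simp add: circle_measure_def)

lemma space_circle_measure [simp]: "space circle_measure = UNIV"
  by (simp add: circle_measure_def)

lemma prob_space_circle_measure: "prob_space circle_measure"
proof
  have "emeasure circle_measure (space circle_measure)
      = (\<integral>\<^sup>+t. ennreal (1 / (2 * pi)) * indicator {0..2 * pi} t \<partial>lborel)"
    unfolding circle_measure_def
    by (subst emeasure_density) (auto intro!: nn_integral_cong simp: indicator_def)
  also have "\<dots> = 1"
    by (subst nn_integral_cmult_indicator) (auto simp: ennreal_mult[symmetric])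
  finally show "emeasure circle_measure (space circle_measure) = 1" .
qed

interpretation circ: prob_space circle_measure
  by (rule prob_space_circle_measure)

lemma measure_circle_UNIV [simp]: "measure circle_measure UNIV = 1"
  using circ.prob_space by simp

lemma integral_circle_measure:
  fixes h :: "real \<Rightarrow> complex"
  assumes [measurable]: "h \<in> borel_measurable borel"
  shows "(LINT t|circle_measure. h t) = (LBINT t:{0..2 * pi}. h t) / (2 * pi)"
proof -
  have "(LINT t|circle_measure. h t)
      = (LINT t|lborel. (indicator {0..2 * pi} t / (2 * pi)) *\<^sub>R h t)"
    unfolding circle_measure_def by (rule integral_density) auto
  also have "\<dots> = (LINT t|lborel. (1 / (2 * pi)) *\<^sub>R (indicator {0..2 * pi} t *\<^sub>R h t))"
    by (rule Bochner_Integration.integral_cong) (auto simp: indicator_def)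
  also have "\<dots> = (1 / (2 * pi)) *\<^sub>R (LBINT t:{0..2 * pi}. h t)"
    unfolding set_lebesgue_integral_def by (rule integral_scaleR_right)
  finally show ?thesis by (simp add: scaleR_conv_of_real)
qed

lemma measurable_cis [measurable]: "cis \<in> borel_measurable borel"
  by (intro borel_measurable_continuous_onI continuous_intros)

lemma measurable_cnj [measurable]: "cnj \<in> borel_measurable borel"
  by (intro borel_measurable_continuous_onI continuous_intros)

lemma integrable_circle_bounded:
  fixes h :: "real \<Rightarrow> 'a :: {banach, second_countable_topology}"
  assumes "h \<in> borel_measurable borel" "\<And>t. norm (h t) \<le> B"
  shows "integrable circle_measure h"
  by (rule circ.integrable_const_bound[of _ B]) (use assms in auto)

lemma integral_cis:
  "(LINT t|circle_measure. cis (of_int k * t)) = (if k = 0 then 1 else 0)"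
proof (cases "k = 0")
  case True
  then show ?thesis by simp
next
  case False
  let ?F = "\<lambda>t. cis (of_int k * t) / (\<i> * of_int k)"
  have "(LBINT t:{0..2 * pi}. cis (of_int k * t)) = ?F (2 * pi) - ?F 0"
    unfolding set_lebesgue_integral_def
  proof (rule integral_FTC_Icc)
    fix t :: real
    have "(\<lambda>t. cis (of_int k * t)) = (\<lambda>t. exp (\<i> * of_int k * of_real t))"
      by (auto simp: cis_conv_exp algebra_simps)
    moreover have "((\<lambda>t. exp (\<i> * of_int k * of_real t) / (\<i> * of_int k)) has_vector_derivative
        exp (\<i> * of_int k * of_real t)) (at t within {0..2 * pi})"
      using False by (auto intro!: derivative_eq_intros has_vector_derivative_real_field simp: field_simps)
    ultimately show "(?F has_vector_derivative cis (of_int k * t)) (at t within {0..2 * pi})"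
      by metis
  qed (auto intro!: continuous_intros)
  also have "\<dots> = 0"
    using cis_multiple_2pi[of "of_int k"] by (simp add: mult.commute[of "2 * pi"] mult_ac)
  finally show ?thesis
    using False by (subst integral_circle_measure) auto
qed

text \<open>The summable majorant \<open>cmod (a k) * B\<close> does not depend on \<open>t\<close>.
  The lemma serves Parseval's identity, the Poisson kernel and the logarithmic mean alike.\<close>

lemma integral_circle_suminf:
  fixes a :: "nat \<Rightarrow> complex" and e :: "nat \<Rightarrow> real \<Rightarrow> complex"
  assumes a: "summable (\<lambda>k. cmod (a k))"
    and [measurable]: "\<And>k. e k \<in> borel_measurable borel" and e: "\<And>k t. cmod (e k t) \<le> B"
  shows "(LINT t|circle_measure. (\<Sum>k. a k * e k t)) = (\<Sum>k. a k * (LINT t|circle_measure. e k t))"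
    and "summable (\<lambda>k. a k * (LINT t|circle_measure. e k t))"
proof -
  have i: "integrable circle_measure (\<lambda>t. a k * e k t)" for k
    by (rule integrable_circle_bounded[of _ "cmod (a k) * B"])
       (auto simp: norm_mult intro!: mult_left_mono e)
  have s: "summable (\<lambda>k. norm (a k * e k t))" for t
    by (rule summable_comparison_test'[OF summable_mult2[OF a, of B]])
       (auto simp: norm_mult intro!: mult_left_mono e)
  have s2: "summable (\<lambda>k. LINT t|circle_measure. norm (a k * e k t))"
  proof (rule summable_comparison_test'[OF summable_mult2[OF a, of B]])
    fix k
    have "(LINT t|circle_measure. norm (a k * e k t)) \<le> (LINT t|circle_measure. cmod (a k) * B)"
      by (rule integral_mono[OF integrable_norm[OF i]]) (auto intro!: mult_left_mono e simp: norm_mult)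
    moreover have "0 \<le> (LINT t|circle_measure. norm (a k * e k t))"
      by (rule Bochner_Integration.integral_nonneg) simp
    ultimately show "norm (LINT t|circle_measure. norm (a k * e k t)) \<le> cmod (a k) * B"
      by (simp only: real_norm_def abs_of_nonneg) simp
  qed
  have *: "(LINT t|circle_measure. a k * e k t) = a k * (LINT t|circle_measure. e k t)" for k
    by simp
  show "(LINT t|circle_measure. (\<Sum>k. a k * e k t)) = (\<Sum>k. a k * (LINT t|circle_measure. e k t))"
    by (subst integral_suminf[OF i _ s2]) (use s in \<open>auto simp only: * AE_I2\<close>)
  show "summable (\<lambda>k. a k * (LINT t|circle_measure. e k t))"
    using summable_integral[OF i _ s2] s by (simp only: * AE_I2)
qed

text \<open>\<open>S\<close> is both the inner product of \<open>h\<close> with its partial Fourier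
  sum \<open>s\<close> and the square norm of \<open>s\<close>. Hence the square norm of
  \<open>h - s\<close> is that of \<open>h\<close> minus \<open>S\<close>.\<close>

lemma bessel_circle:
  fixes h :: "real \<Rightarrow> complex"
  assumes [measurable]: "h \<in> borel_measurable borel" and B: "\<And>t. cmod (h t) \<le> B" and "finite I"
  shows "(\<Sum>k\<in>I. (cmod (LINT t|circle_measure. h t * cis (- (of_int k * t))))\<^sup>2)
      \<le> (LINT t|circle_measure. (cmod (h t))\<^sup>2)"
proof -
  define c where "c k = (LINT t|circle_measure. h t * cis (- (of_int k * t)))" for k :: int
  define s where "s t = (\<Sum>k\<in>I. c k * cis (of_int k * t))" for t
  define D where "D = (\<Sum>k\<in>I. cmod (c k))"
  define S where "S = (\<Sum>k\<in>I. (cmod (c k))\<^sup>2)"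
  have [measurable]: "s \<in> borel_measurable borel" unfolding s_def by measurable
  have sB: "cmod (s t) \<le> D" for t
    unfolding s_def D_def by (rule order_trans[OF norm_sum]) (simp add: norm_mult)
  have ii: "integrable circle_measure (\<lambda>t. u t * cnj (v t))"
    if "u \<in> borel_measurable borel" "v \<in> borel_measurable borel" "\<And>t. cmod (u t) \<le> a" "\<And>t. cmod (v t) \<le> b"
    for u v :: "real \<Rightarrow> complex" and a b
  proof (rule integrable_circle_bounded[of _ "a * b"])
    show "(\<lambda>t. u t * cnj (v t)) \<in> borel_measurable borel"
      using that(1,2) by measurable
    fix t show "cmod (u t * cnj (v t)) \<le> a * b"
      using mult_mono[OF that(3)[of t] that(4)[of t]] order_trans[OF norm_ge_zero that(3)[of t]]
      by (simp add: norm_mult)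
  qed
  have hs: "(LINT t|circle_measure. h t * cnj (s t)) = S"
  proof -
    have "(LINT t|circle_measure. h t * cnj (s t))
        = (LINT t|circle_measure. (\<Sum>k\<in>I. cnj (c k) * (h t * cis (- (of_int k * t)))))"
      by (rule Bochner_Integration.integral_cong)
         (auto simp: s_def sum_distrib_left cis_cnj mult_ac)
    also have "\<dots> = (\<Sum>k\<in>I. LINT t|circle_measure. cnj (c k) * (h t * cis (- (of_int k * t))))"
      by (rule Bochner_Integration.integral_sum)
         (auto intro!: integrable_mult_right integrable_circle_bounded[of _ B] simp: norm_mult B)
    also have "\<dots> = (\<Sum>k\<in>I. cnj (c k) * c k)" by (simp add: c_def)
    finally show ?thesis
      by (simp add: S_def complex_norm_square mult.commute del: of_real_power)
  qed
  have ss: "(LINT t|circle_measure. s t * cnj (s t)) = S"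
  proof -
    have "(LINT t|circle_measure. s t * cnj (s t))
        = (LINT t|circle_measure. (\<Sum>k\<in>I. \<Sum>l\<in>I. (c k * cnj (c l)) * cis (of_int (k - l) * t)))"
      by (rule Bochner_Integration.integral_cong)
         (auto simp: s_def sum_product cis_cnj mult_ac cis_mult algebra_simps)
    also have "\<dots> = (\<Sum>k\<in>I. \<Sum>l\<in>I. (c k * cnj (c l)) * (LINT t|circle_measure. cis (of_int (k - l) * t)))"
    proof -
      have i: "integrable circle_measure (\<lambda>t. (c k * cnj (c l)) * cis (of_int (k - l) * t))" for k l
        by (intro integrable_mult_right integrable_circle_bounded[of _ 1]) auto
      show ?thesis
        by (simp only: Bochner_Integration.integral_sum Bochner_Integration.integrable_sum i
              integral_mult_right_zero)
    qed
    also have "\<dots> = (\<Sum>k\<in>I. \<Sum>l\<in>I. if l = k then c k * cnj (c l) else 0)"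
      unfolding integral_cis by (intro sum.cong) auto
    also have "\<dots> = (\<Sum>k\<in>I. c k * cnj (c k))"
      using \<open>finite I\<close> by (intro sum.cong) auto
    finally show ?thesis
      by (simp add: S_def complex_norm_square del: of_real_power)
  qed
  have "0 \<le> (LINT t|circle_measure. (cmod (h t - s t))\<^sup>2)" by simp
  also have "\<dots> = Re (LINT t|circle_measure. complex_of_real ((cmod (h t - s t))\<^sup>2))"
    by (subst integral_complex_of_real) simp
  also have "(LINT t|circle_measure. complex_of_real ((cmod (h t - s t))\<^sup>2))
      = (LINT t|circle_measure. h t * cnj (h t) - h t * cnj (s t) - cnj (h t * cnj (s t)) + s t * cnj (s t))"
    by (rule Bochner_Integration.integral_cong)
       (auto simp: complex_norm_square algebra_simps simp del: of_real_power)
  also have "\<dots> = (LINT t|circle_measure. h t * cnj (h t)) - S - cnj S + S"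
  proof -
    have a: "integrable circle_measure (\<lambda>t. h t * cnj (h t))" by (rule ii[of h h B B]) (use B in auto)
    have b: "integrable circle_measure (\<lambda>t. h t * cnj (s t))" by (rule ii[of h s B D]) (use B sB in auto)
    have c: "integrable circle_measure (\<lambda>t. s t * cnj (s t))" by (rule ii[of s s D D]) (use sB in auto)
    have d: "integrable circle_measure (\<lambda>t. cnj (h t * cnj (s t)))" using b by (simp only: complex_integrable_cnj)
    have e: "(LINT t|circle_measure. cnj (h t * cnj (s t))) = cnj S" using hs Bochner_Integration.integral_cnj by metis
    show ?thesis
      using a b c d e hs ss
      by (simp only: Bochner_Integration.integral_add Bochner_Integration.integral_diff Bochner_Integration.integrable_diff Bochner_Integration.integrable_add)
  qed
  also have "(LINT t|circle_measure. h t * cnj (h t)) = complex_of_real (LINT t|circle_measure. (cmod (h t))\<^sup>2)"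
    by (subst integral_complex_of_real[symmetric]) (simp add: complex_norm_square del: of_real_power)
  finally show ?thesis by (simp add: S_def c_def)
qed

text \<open>Absolute summability allows integrating \<open>g\<close> times its conjugate term by
  term, and the \<open>k\<close>-th integral returns the conjugate of \<open>a k\<close>. The
  frequencies are negative because expansions at infinity run in powers of
  \<open>1 / z\<close>.\<close>

lemma parseval_circle:
  fixes a :: "nat \<Rightarrow> complex"
  assumes a: "summable (\<lambda>k. cmod (a k))"
  shows "(LINT t|circle_measure. (cmod (\<Sum>k. a k * cis (- (real k * t))))\<^sup>2) = (\<Sum>k. (cmod (a k))\<^sup>2)"
    and "summable (\<lambda>k. (cmod (a k))\<^sup>2)"
proof -
  define g where "g t = (\<Sum>k. a k * cis (- (real k * t)))" for t
  define D where "D = (\<Sum>k. cmod (a k))"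
  have sn: "summable (\<lambda>k. norm (a k * cis (- (real k * t))))" for t
    using a by (simp add: norm_mult)
  have gD: "cmod (g t) \<le> D" for t
    unfolding g_def D_def using summable_norm[OF sn] by (simp add: norm_mult)
  have [measurable]: "g \<in> borel_measurable borel" unfolding g_def by measurable
  have gc: "(LINT t|circle_measure. cis (- (real k * t)) * cnj (g t)) = cnj (a k)" for k
  proof -
    have "(LINT t|circle_measure. g t * cis (real k * t))
        = (LINT t|circle_measure. (\<Sum>j. a j * cis (of_int (int k - int j) * t)))"
      unfolding g_def
      by (subst suminf_mult2[OF summable_norm_cancel[OF sn]])
         (simp add: mult.assoc cis_mult algebra_simps)
    also have "\<dots> = (\<Sum>j. a j * (LINT t|circle_measure. cis (of_int (int k - int j) * t)))"
      by (rule integral_circle_suminf[OF a, of _ 1]) auto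
    also have "\<dots> = (\<Sum>j. if j = k then a j else 0)"
      unfolding integral_cis by (intro suminf_cong) auto
    also have "\<dots> = a k" by (subst suminf_finite[of "{k}"]) auto
    finally have "(LINT t|circle_measure. cnj (g t * cis (real k * t))) = cnj (a k)"
      by (simp only: Bochner_Integration.integral_cnj)
    then show ?thesis by (simp add: cis_cnj mult.commute)
  qed
  have 1: "(LINT t|circle_measure. (\<Sum>k. a k * (cis (- (real k * t)) * cnj (g t))))
      = (\<Sum>k. a k * cnj (a k))"
    and 2: "summable (\<lambda>k. a k * cnj (a k))"
    using integral_circle_suminf[OF a, of "\<lambda>k t. cis (- (real k * t)) * cnj (g t)" D] gD
    by (simp_all add: norm_mult gc)
  have "(\<Sum>k. a k * (cis (- (real k * t)) * cnj (g t))) = complex_of_real ((cmod (g t))\<^sup>2)" for t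
  proof -
    have "(\<Sum>k. a k * (cis (- (real k * t)) * cnj (g t))) = g t * cnj (g t)"
      unfolding g_def
      by (subst suminf_mult2[OF summable_norm_cancel[OF sn]]) (simp add: mult.assoc)
    then show ?thesis by (simp add: complex_norm_square del: of_real_power)
  qed
  with 1 have 3: "(LINT t|circle_measure. complex_of_real ((cmod (g t))\<^sup>2)) = (\<Sum>k. complex_of_real ((cmod (a k))\<^sup>2))"
    by (simp add: complex_norm_square del: of_real_power)
  show s: "summable (\<lambda>k. (cmod (a k))\<^sup>2)"
    using 2 by (simp add: complex_norm_square[symmetric] summable_of_real_iff del: of_real_power)
  show "(LINT t|circle_measure. (cmod (\<Sum>k. a k * cis (- (real k * t))))\<^sup>2) = (\<Sum>k. (cmod (a k))\<^sup>2)"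
    using 3 unfolding integral_complex_of_real suminf_of_real[OF s, symmetric] of_real_eq_iff g_def .
qed

section \<open>Operators on the sequence space and the Hessenberg matrix\<close>

lemma summable_ell2: "summable (\<lambda>n. (cmod (ell2_coord x n))\<^sup>2)"
  using square_summable_coord[of x] by (simp add: square_summable_def)

lemma norm_ell2_sq: "(norm x)\<^sup>2 = (\<Sum>n. (cmod (ell2_coord x n))\<^sup>2)"
  by (simp add: norm_ell2_def suminf_nonneg summable_ell2)

lemma cmod_ell2_coord_le: "cmod (ell2_coord x i) \<le> norm x"
proof -
  have "(\<Sum>n\<in>{i}. (cmod (ell2_coord x n))\<^sup>2) \<le> (\<Sum>n. (cmod (ell2_coord x n))\<^sup>2)"
    by (rule sum_le_suminf[OF summable_ell2]) auto
  then have "(cmod (ell2_coord x i))\<^sup>2 \<le> (norm x)\<^sup>2"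
    by (simp add: norm_ell2_sq)
  then show ?thesis by (rule power2_le_imp_le) simp
qed

lemma ell2_coord_sum: "ell2_coord (\<Sum>k\<in>I. x k) i = (\<Sum>k\<in>I. ell2_coord (x k) i)"
  by (induction I rule: infinite_finite_induct) (auto simp: zero_ell2.rep_eq plus_ell2.rep_eq)

lemma ell2_coord_shift_pow:
  "ell2_coord ((ell2_shift ^^ n) x) i = (if i < n then 0 else ell2_coord x (i - n))"
  by (induction n arbitrary: i) (auto simp: ell2_shift.rep_eq)

lemma ell2_coord_unshift_pow: "ell2_coord ((ell2_unshift ^^ n) x) i = ell2_coord x (i + n)"
  by (induction n arbitrary: i) (auto simp: ell2_unshift.rep_eq)

lemma norm_ell2_split:
  "(norm y)\<^sup>2 = (\<Sum>i<n. (cmod (ell2_coord y i))\<^sup>2) + (norm ((ell2_unshift ^^ n) y))\<^sup>2"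
  using suminf_split_initial_segment[OF summable_ell2, of y n]
  by (simp add: norm_ell2_sq ell2_coord_unshift_pow)

lemma norm_ell2_shift_pow: "norm ((ell2_shift ^^ n) x) = norm x"
proof -
  have "(ell2_unshift ^^ n) ((ell2_shift ^^ n) x) = x"
    by (rule ell2_eqI) (simp add: ell2_coord_shift_pow ell2_coord_unshift_pow)
  then have "(norm ((ell2_shift ^^ n) x))\<^sup>2 = (norm x)\<^sup>2"
    by (simp add: norm_ell2_split[of "(ell2_shift ^^ n) x" n] ell2_coord_shift_pow)
  then show ?thesis by simp
qed

lemma norm_ell2_unshift_pow_le: "norm ((ell2_unshift ^^ n) x) \<le> norm x"
  by (rule power2_le_imp_le) (simp_all add: norm_ell2_split[of x n] sum_nonneg)

lemma bounded_linear_shift_pow: "bounded_linear (ell2_shift ^^ n)"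
  by (rule bounded_linear_intro[of _ 1])
     (auto intro!: ell2_eqI simp: ell2_coord_shift_pow plus_ell2.rep_eq scaleR_ell2.rep_eq norm_ell2_shift_pow)

lemma bounded_linear_unshift_pow: "bounded_linear (ell2_unshift ^^ n)"
  by (rule bounded_linear_intro[of _ 1])
     (auto intro!: ell2_eqI simp: ell2_coord_unshift_pow plus_ell2.rep_eq scaleR_ell2.rep_eq norm_ell2_unshift_pow_le)

lemma ell2_shift_pow_unit: "(ell2_shift ^^ n) (ell2_unit j) = ell2_unit (j + n)"
  by (rule ell2_eqI) (auto simp: ell2_coord_shift_pow ell2_unit.rep_eq)

text \<open>For finite \<open>I\<close> these are the coefficient vectors of polynomials in the
  orthonormal basis.\<close>

definition ell2_vec :: "nat set \<Rightarrow> (nat \<Rightarrow> complex) \<Rightarrow> ell2" where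
  "ell2_vec I a = (\<Sum>k\<in>I. ell2_scaleC (a k) (ell2_unit k))"

lemma ell2_coord_vec: "finite I \<Longrightarrow> ell2_coord (ell2_vec I a) i = (if i \<in> I then a i else 0)"
  by (simp add: ell2_vec_def ell2_coord_sum ell2_scaleC.rep_eq ell2_unit.rep_eq if_distrib cong: if_cong)

lemma norm_ell2_vec: "finite I \<Longrightarrow> (norm (ell2_vec I a))\<^sup>2 = (\<Sum>k\<in>I. (cmod (a k))\<^sup>2)"
  by (subst norm_ell2_sq, subst suminf_finite[of I]) (auto simp: ell2_coord_vec)

lemma ell2_coord_operator_vec:
  assumes "bounded_operator A"
  shows "ell2_coord (A (ell2_vec I a)) i = (\<Sum>k\<in>I. a k * matrix_entry A i k)"
proof -
  interpret bounded_linear A using assms by (simp add: bounded_operator_def)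
  show ?thesis
    using assms
    by (simp add: ell2_vec_def sum ell2_coord_sum bounded_operator_def ell2_scaleC.rep_eq matrix_entry_def)
qed

lemma norm_ell2_unit: "norm (ell2_unit j) = 1"
proof -
  have "(norm (ell2_unit j))\<^sup>2 = 1"
    by (subst norm_ell2_sq, subst suminf_finite[of "{j}"]) (auto simp: ell2_unit.rep_eq)
  then show ?thesis using norm_ge_zero[of "ell2_unit j"] by (simp add: power2_eq_1_iff)
qed

lemma cmod_matrix_entry_le:
  assumes "bounded_operator A" shows "cmod (matrix_entry A i j) \<le> onorm A"
  using onorm[of A "ell2_unit j"] cmod_ell2_coord_le[of "A (ell2_unit j)" i] assms
  by (simp add: bounded_operator_def matrix_entry_def norm_ell2_unit)

text \<open>Rows are square summable by duality: if \<open>v\<close> is the conjugate of the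
  truncated row \<open>i\<close>, then coordinate \<open>i\<close> of \<open>A v\<close> is
  \<open>s\<close>, the square norm of \<open>v\<close>. So \<open>s \<le> onorm A * sqrt s\<close>,
  a bound independent of the truncation.\<close>

lemma matrix_row_tendsto_0:
  assumes A: "bounded_operator A"
  shows "(\<lambda>j. matrix_entry A i j) \<longlonglongrightarrow> 0"
proof -
  have bl: "bounded_linear A" using A by (simp add: bounded_operator_def)
  have "(\<Sum>j<n. (cmod (matrix_entry A i j))\<^sup>2) \<le> (onorm A)\<^sup>2" for n
  proof -
    define s where "s = (\<Sum>j<n. (cmod (matrix_entry A i j))\<^sup>2)"
    define v where "v = ell2_vec {..<n} (\<lambda>j. cnj (matrix_entry A i j))"
    have s0: "s \<ge> 0" by (simp add: s_def sum_nonneg)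
    have v2: "(norm v)\<^sup>2 = s" by (simp add: v_def norm_ell2_vec s_def)
    have "ell2_coord (A v) i = of_real s"
      unfolding v_def s_def ell2_coord_operator_vec[OF A]
      by (simp add: complex_norm_square mult.commute del: of_real_power)
    then have "s \<le> norm (A v)" using cmod_ell2_coord_le[of "A v" i] s0 by simp
    also have "\<dots> \<le> onorm A * norm v" by (rule onorm[OF bl])
    finally have "s\<^sup>2 \<le> (onorm A * norm v)\<^sup>2" using s0 by (intro power_mono)
    then have "s * s \<le> (onorm A)\<^sup>2 * s" by (simp add: power_mult_distrib v2 power2_eq_square[of s])
    then show ?thesis
      using s0 by (cases "s = 0") (auto simp: s_def[symmetric])
  qed
  then have "summable (\<lambda>j. (cmod (matrix_entry A i j))\<^sup>2)"
    by (intro summableI_nonneg_bounded) auto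
  from summable_LIMSEQ_zero[OF this] have "(\<lambda>j. sqrt ((cmod (matrix_entry A i j))\<^sup>2)) \<longlonglongrightarrow> sqrt 0"
    by (rule tendsto_real_sqrt)
  then have "(\<lambda>j. cmod (matrix_entry A i j)) \<longlonglongrightarrow> 0" by simp
  then show ?thesis by (rule tendsto_norm_zero_cancel)
qed

lemma toeplitz_limit_norm_le:
  assumes "uniform_toeplitz_limit A T"
  shows "norm ((ell2_unshift ^^ n) (A ((ell2_shift ^^ n) x)) - T x)
    \<le> onorm (\<lambda>x. (ell2_unshift ^^ n) (A ((ell2_shift ^^ n) x)) - T x) * norm x"
proof (rule onorm)
  have A: "bounded_linear A" and T: "bounded_linear T"
    using assms by (auto simp: uniform_toeplitz_limit_def bounded_operator_def)
  show "bounded_linear (\<lambda>x. (ell2_unshift ^^ n) (A ((ell2_shift ^^ n) x)) - T x)"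
    by (intro bounded_linear_sub T bounded_linear_compose[OF bounded_linear_unshift_pow]
          bounded_linear_compose[OF A] bounded_linear_shift_pow)
qed

lemma toeplitz_limit_entry:
  assumes T: "uniform_toeplitz_limit A T"
  shows "(\<lambda>n. matrix_entry A (i + n) (j + n)) \<longlonglongrightarrow> matrix_entry T i j"
proof (rule LIM_zero_cancel, rule Lim_null_comparison)
  let ?B = "\<lambda>n x. (ell2_unshift ^^ n) (A ((ell2_shift ^^ n) x)) - T x"
  show "(\<lambda>n. onorm (?B n)) \<longlonglongrightarrow> 0" using T by (simp add: uniform_toeplitz_limit_def)
  have "cmod (matrix_entry A (i + n) (j + n) - matrix_entry T i j) \<le> onorm (?B n)" for n
    using cmod_ell2_coord_le[of "?B n (ell2_unit j)" i] toeplitz_limit_norm_le[OF T, of n "ell2_unit j"]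
    by (simp add: norm_ell2_unit minus_ell2.rep_eq ell2_coord_unshift_pow ell2_shift_pow_unit matrix_entry_def)
  then show "\<forall>\<^sub>F n in sequentially. norm (matrix_entry A (i + n) (j + n) - matrix_entry T i j) \<le> onorm (?B n)"
    by simp
qed

section \<open>The support of a measure and the norm of polynomials in L2\<close>

text \<open>By second countability the complement of the support is covered by countably many basic
  open null sets.\<close>

lemma AE_in_measure_support:
  assumes "sets \<mu> = sets borel"
  shows "AE z in \<mu>. z \<in> measure_support \<mu>"
proof -
  obtain B :: "complex set set" where B: "countable B" "topological_basis B"
    using ex_countable_basis by blast
  define N where "N = \<Union>{U\<in>B. emeasure \<mu> U = 0}"
  have "N \<in> null_sets \<mu>" unfolding N_def
    by (rule null_sets_UN'[of _ "\<lambda>x. x", simplified])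
       (use B assms in \<open>auto intro!: countable_subset[OF _ B(1)] null_setsI dest: topological_basis_open\<close>)
  then show ?thesis
  proof (rule AE_I')
    show "{z \<in> space \<mu>. z \<notin> measure_support \<mu>} \<subseteq> N"
    proof
      fix z assume "z \<in> {z \<in> space \<mu>. z \<notin> measure_support \<mu>}"
      then obtain U where U: "open U" "z \<in> U" "emeasure \<mu> U = 0"
        by (auto simp: measure_support_def not_gr_zero)
      then obtain V where V: "V \<in> B" "z \<in> V" "V \<subseteq> U"
        using topological_basisE[OF B(2)] by metis
      have "emeasure \<mu> V \<le> emeasure \<mu> U"
        using U V assms by (intro emeasure_mono) auto
      with U V show "z \<in> N" by (auto simp: N_def)
    qed
  qed
qed

lemma integrable_continuous_compact_support:
  fixes h :: "complex \<Rightarrow> 'a :: {banach, second_countable_topology}"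
  assumes "prob_space \<mu>" "sets \<mu> = sets borel" "compact (measure_support \<mu>)" "continuous_on UNIV h"
  shows "integrable \<mu> h"
proof -
  interpret prob_space \<mu> by fact
  have "compact (h ` measure_support \<mu>)"
    using assms by (intro compact_continuous_image continuous_on_subset[OF assms(4)]) auto
  then obtain B where "\<And>z. z \<in> measure_support \<mu> \<Longrightarrow> norm (h z) \<le> B"
    by (metis (no_types) compact_imp_bounded bounded_iff image_eqI)
  then show ?thesis
    using AE_in_measure_support[OF assms(2)] assms(2)
    by (intro integrable_const_bound[of _ B])
       (auto intro: borel_measurable_continuous_onI[OF assms(4)] cong: measurable_cong_sets)
qed

text \<open>This is the isometry from coefficient vectors to polynomials in
  L2(\<open>\<mu>\<close>), under which the Hessenberg matrix becomes multiplication by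
  \<open>z\<close>.\<close>

lemma integral_norm_orthonormal_sum:
  assumes "prob_space \<mu>" "sets \<mu> = sets borel" "compact (measure_support \<mu>)" "orthonormal_polys \<mu> P"
    and "finite I"
  shows "(LINT z|\<mu>. (cmod (\<Sum>k\<in>I. a k * poly (P k) z))\<^sup>2) = (\<Sum>k\<in>I. (cmod (a k))\<^sup>2)"
proof -
  have i: "integrable \<mu> (\<lambda>z. (a k * cnj (a l)) * (poly (P k) z * cnj (poly (P l) z)))" for k l
    by (rule integrable_continuous_compact_support[OF assms(1-3)]) (intro continuous_intros)
  have "complex_of_real (LINT z|\<mu>. (cmod (\<Sum>k\<in>I. a k * poly (P k) z))\<^sup>2)
     = (LINT z|\<mu>. (\<Sum>k\<in>I. \<Sum>l\<in>I. (a k * cnj (a l)) * (poly (P k) z * cnj (poly (P l) z))))"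
    by (subst integral_complex_of_real[symmetric])
       (auto intro!: Bochner_Integration.integral_cong
          simp: complex_norm_square sum_product mult_ac simp del: of_real_power)
  also have "\<dots> = (\<Sum>k\<in>I. \<Sum>l\<in>I. (a k * cnj (a l)) * (LINT z|\<mu>. poly (P k) z * cnj (poly (P l) z)))"
    by (simp only: Bochner_Integration.integral_sum Bochner_Integration.integrable_sum i
          integral_mult_right_zero)
  also have "\<dots> = (\<Sum>k\<in>I. \<Sum>l\<in>I. if l = k then a k * cnj (a l) else 0)"
    using assms(4) by (intro sum.cong) (auto simp: orthonormal_polys_def)
  also have "\<dots> = (\<Sum>k\<in>I. a k * cnj (a k))"
    using \<open>finite I\<close> by (intro sum.cong) auto
  also have "\<dots> = complex_of_real (\<Sum>k\<in>I. (cmod (a k))\<^sup>2)"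
    by (simp add: complex_norm_square del: of_real_power)
  finally show ?thesis by (simp only: of_real_eq_iff)
qed

text \<open>If the vector corresponds to the polynomial \<open>q\<close>, its image on the right
  corresponds to \<open>(z - w) * q z\<close>, and \<open>cmod (z - w)\<close> is at least
  \<open>\<delta>\<close> almost everywhere because almost every point lies in the support.\<close>

lemma hessenberg_bounded_below:
  assumes \<mu>: "prob_space \<mu>" "sets \<mu> = sets borel" "compact (measure_support \<mu>)"
    and P: "orthonormal_polys \<mu> P" and d: "hessenberg_matrix P d" and A: "operator_of_matrix d A"
    and \<delta>: "\<And>z. z \<in> measure_support \<mu> \<Longrightarrow> \<delta> \<le> cmod (z - w)" "0 \<le> \<delta>" and I: "finite I"
  shows "\<delta> * norm (ell2_vec I a) \<le> norm (A (ell2_vec I a) - ell2_scaleC w (ell2_vec I a))"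
proof -
  interpret prob_space \<mu> by fact
  have bA: "bounded_operator A" and entry: "\<And>i j. matrix_entry A i j = d (i + 1) (j + 1)"
    using A by (auto simp: operator_of_matrix_def)
  define y where "y = A (ell2_vec I a) - ell2_scaleC w (ell2_vec I a)"
  \<comment> \<open>Multiplication by \<open>z\<close> raises the degree by one, so \<open>N\<close>
    has to dominate \<open>k + 1\<close> and not merely \<open>k\<close>. All coordinates of
    \<open>y\<close> beyond \<open>N\<close> then vanish.\<close>
  obtain N where N: "\<And>k. k \<in> I \<Longrightarrow> k + 1 \<le> N"
    using finite_nat_bounded[OF I] by (auto simp: Suc_le_eq)
  define q where "q z = (\<Sum>k\<in>I. a k * poly (P k) z)" for z
  have y: "ell2_coord y i = (\<Sum>k\<in>I. a k * (d (i + 1) (k + 1) - (if k = i then w else 0)))" for i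
  proof -
    have "(\<Sum>k\<in>I. a k * (if k = i then w else 0)) = (\<Sum>k\<in>I. if k = i then w * a k else 0)"
      by (rule sum.cong) auto
    then show ?thesis
      using I
      by (simp add: y_def minus_ell2.rep_eq ell2_scaleC.rep_eq ell2_coord_operator_vec[OF bA] entry
            ell2_coord_vec right_diff_distrib sum_subtractf)
  qed
  have y0: "ell2_coord y i = 0" if "i > N" for i
    unfolding y using that d
    by (intro sum.neutral) (auto simp: hessenberg_matrix_def dest!: N)
  have zP: "z * poly (P k) z = (\<Sum>i\<le>N. d (i + 1) (k + 1) * poly (P i) z)" if "k \<in> I" for k z
  proof -
    have "z * poly (P k) z = poly ([:0, 1:] * P k) z" by simp
    also have "\<dots> = poly (\<Sum>i=0..k + 1. smult (d (i + 1) (k + 1)) (P i)) z"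
      using d by (simp only: hessenberg_matrix_def)
    also have "\<dots> = (\<Sum>i=0..k + 1. d (i + 1) (k + 1) * poly (P i) z)"
      by (simp add: poly_sum)
    also have "\<dots> = (\<Sum>i\<le>N. d (i + 1) (k + 1) * poly (P i) z)"
      using d N[OF that] by (intro sum.mono_neutral_left) (auto simp: hessenberg_matrix_def)
    finally show ?thesis .
  qed
  have q: "(z - w) * q z = (\<Sum>i\<le>N. ell2_coord y i * poly (P i) z)" for z
  proof -
    have "(z - w) * q z = (\<Sum>k\<in>I. a k * (z * poly (P k) z - w * poly (P k) z))"
      by (simp add: q_def sum_distrib_left algebra_simps sum_subtractf)
    also have "\<dots> = (\<Sum>k\<in>I. a k * (\<Sum>i\<le>N. (d (i + 1) (k + 1) - (if k = i then w else 0)) * poly (P i) z))"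
    proof (intro sum.cong refl arg_cong2[of _ _ _ _ "(*)"])
      fix k assume k: "k \<in> I"
      have "(\<Sum>i\<le>N. (if k = i then w else 0) * poly (P i) z) = w * poly (P k) z"
        using N[OF k] by (subst sum.mono_neutral_right[of _ "{k}"]) auto
      then show "z * poly (P k) z - w * poly (P k) z
          = (\<Sum>i\<le>N. (d (i + 1) (k + 1) - (if k = i then w else 0)) * poly (P i) z)"
        by (simp add: zP[OF k] left_diff_distrib sum_subtractf)
    qed
    also have "\<dots> = (\<Sum>i\<le>N. ell2_coord y i * poly (P i) z)"
      unfolding y sum_distrib_left sum_distrib_right
      by (subst sum.swap) (simp add: mult.assoc)
    finally show ?thesis .
  qed
  have cq: "continuous_on UNIV q" unfolding q_def by (intro continuous_intros)
  have "(\<delta> * norm (ell2_vec I a))\<^sup>2 = (LINT z|\<mu>. \<delta>\<^sup>2 * (cmod (q z))\<^sup>2)"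
    unfolding q_def
    by (simp add: power_mult_distrib norm_ell2_vec[OF I] integral_norm_orthonormal_sum[OF \<mu> P I])
  also have "\<dots> \<le> (LINT z|\<mu>. (cmod ((z - w) * q z))\<^sup>2)"
  proof (rule integral_mono_AE)
    show "integrable \<mu> (\<lambda>z. \<delta>\<^sup>2 * (cmod (q z))\<^sup>2)" "integrable \<mu> (\<lambda>z. (cmod ((z - w) * q z))\<^sup>2)"
      by (intro integrable_continuous_compact_support[OF \<mu>] continuous_intros cq)+
    show "AE z in \<mu>. \<delta>\<^sup>2 * (cmod (q z))\<^sup>2 \<le> (cmod ((z - w) * q z))\<^sup>2"
      using AE_in_measure_support[OF \<mu>(2)]
      by eventually_elim (auto simp: norm_mult power_mult_distrib intro!: mult_right_mono power_mono \<delta>)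
  qed
  also have "\<dots> = (\<Sum>i\<le>N. (cmod (ell2_coord y i))\<^sup>2)"
    unfolding q by (rule integral_norm_orthonormal_sum[OF \<mu> P]) simp
  also have "\<dots> = (norm y)\<^sup>2"
    unfolding norm_ell2_sq by (rule suminf_finite[symmetric]) (auto simp: y0)
  finally show ?thesis
    unfolding y_def[symmetric] by (rule power2_le_imp_le) simp
qed

section \<open>The symbol takes values in the support\<close>

lemma continuous_on_circle_param:
  assumes "continuous_on (sphere 0 1) f"
  shows "continuous_on UNIV (\<lambda>t. f (cis t) :: complex)"
  by (rule continuous_on_compose2[OF assms]) (auto intro!: continuous_intros)

lemma measurable_circle_param [measurable]:
  assumes "continuous_on (sphere 0 1) f"
  shows "(\<lambda>t. f (cis t) :: complex) \<in> borel_measurable borel"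
  by (rule borel_measurable_continuous_onI[OF continuous_on_circle_param[OF assms]])

lemma circle_bound:
  assumes "continuous_on (sphere 0 1) (f :: complex \<Rightarrow> complex)"
  obtains B where "0 < B" "\<And>\<zeta>. cmod \<zeta> = 1 \<Longrightarrow> cmod (f \<zeta>) \<le> B"
proof -
  have "compact (f ` sphere 0 1)" by (intro compact_continuous_image assms) simp
  then obtain B where "0 < B" "\<And>y. y \<in> f ` sphere 0 1 \<Longrightarrow> cmod y \<le> B"
    by (meson bounded_pos compact_imp_bounded)
  then show ?thesis by (intro that[of B]) auto
qed

lemma fourier_coeff_eq:
  assumes "continuous_on (sphere 0 1) f"
  shows "fourier_coeff f k = (LINT t|circle_measure. f (cis t) * cis (- (of_int k * t)))"
  unfolding fourier_coeff_def
  by (subst integral_circle_measure) (use measurable_circle_param[OF assms] in auto)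

text \<open>For close points uniform continuity gives \<open>e\<close>. For points at distance at
  least \<open>d\<close> the trivial bound \<open>2 * B\<close> is absorbed by the quadratic term.
  The square is chosen to cancel the denominator of the Fejer and Poisson type kernels against which
  \<open>f\<close> is integrated later.\<close>

lemma continuous_quadratic_modulus:
  assumes f: "continuous_on (sphere 0 1) (f :: complex \<Rightarrow> complex)" and e: "0 < e"
  obtains C where "0 \<le> C"
    "\<And>x y. cmod x = 1 \<Longrightarrow> cmod y = 1 \<Longrightarrow> cmod (f x - f y) \<le> e + C * (cmod (x - y))\<^sup>2"
proof -
  obtain B where B: "0 < B" "\<And>\<zeta>. cmod \<zeta> = 1 \<Longrightarrow> cmod (f \<zeta>) \<le> B" using circle_bound[OF f] by blast
  have "uniformly_continuous_on (sphere 0 1) f"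
    by (rule compact_uniformly_continuous[OF f]) simp
  then obtain d where d: "d > 0"
    "\<And>x y. cmod x = 1 \<Longrightarrow> cmod y = 1 \<Longrightarrow> dist y x < d \<Longrightarrow> dist (f y) (f x) < e"
    unfolding uniformly_continuous_on_def using e by (metis mem_sphere_0)
  show ?thesis
  proof
    show "0 \<le> 2 * B / d\<^sup>2" using B by simp
    fix x y :: complex assume xy: "cmod x = 1" "cmod y = 1"
    show "cmod (f x - f y) \<le> e + 2 * B / d\<^sup>2 * (cmod (x - y))\<^sup>2"
    proof (cases "cmod (x - y) < d")
      case True
      then have "cmod (f x - f y) \<le> e" using d(2)[of y x] xy by (simp add: dist_norm)
      then show ?thesis using B by (smt (verit) divide_nonneg_nonneg mult_nonneg_nonneg zero_le_power2)
    next
      case False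
      then have "1 \<le> (cmod (x - y))\<^sup>2 / d\<^sup>2" using d(1) by (simp add: power_mono)
      then have "2 * B * 1 \<le> 2 * B * ((cmod (x - y))\<^sup>2 / d\<^sup>2)" using B by (intro mult_left_mono) auto
      moreover have "cmod (f x - f y) \<le> 2 * B"
        using norm_triangle_ineq4[of "f x" "f y"] B(2)[OF xy(1)] B(2)[OF xy(2)] by linarith
      ultimately show ?thesis using e by simp
    qed
  qed
qed

lemma integral_norm_trig_polynomial:
  assumes "finite I"
  shows "(LINT t|circle_measure. (cmod (\<Sum>k\<in>I. a k * cis (real k * t)))\<^sup>2) = (\<Sum>k\<in>I. (cmod (a k))\<^sup>2)"
proof -
  \<comment> \<open>Conjugation turns the positive frequencies into the negative ones for which
    Parseval's identity is stated.\<close>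
  define b where "b k = (if k \<in> I then cnj (a k) else 0)" for k
  have s: "(\<Sum>k. b k * cis (- (real k * t))) = cnj (\<Sum>k\<in>I. a k * cis (real k * t))" for t
    by (subst suminf_finite[OF assms]) (auto simp: b_def cis_cnj)
  have "summable (\<lambda>k. cmod (b k))"
    by (rule summable_finite[OF assms]) (auto simp: b_def)
  then have "(LINT t|circle_measure. (cmod (\<Sum>k. b k * cis (- (real k * t))))\<^sup>2) = (\<Sum>k. (cmod (b k))\<^sup>2)"
    by (rule parseval_circle(1))
  also have "\<dots> = (\<Sum>k\<in>I. (cmod (a k))\<^sup>2)"
    by (subst suminf_finite[OF assms]) (auto simp: b_def)
  finally show ?thesis unfolding s complex_mod_cnj .
qed

text \<open>The coordinates of the vector on the left are the Fourier coefficients of index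
  \<open>\<ge> 0\<close> of the function \<open>h\<close>, that is \<open>f - w\<close> times the
  trigonometric polynomial. Bessel's inequality discards the negative indices.\<close>

lemma norm_toeplitz_vec_le:
  assumes T: "bounded_operator T" and sym: "is_symbol T f" and f: "continuous_on (sphere 0 1) f"
    and I: "finite I"
  shows "(norm (T (ell2_vec I a) - ell2_scaleC w (ell2_vec I a)))\<^sup>2
    \<le> (LINT t|circle_measure. (cmod (f (cis t) - w))\<^sup>2 * (cmod (\<Sum>k\<in>I. a k * cis (real k * t)))\<^sup>2)"
proof -
  define y where "y = T (ell2_vec I a) - ell2_scaleC w (ell2_vec I a)"
  define x where "x t = (\<Sum>k\<in>I. a k * cis (real k * t))" for t
  define h where "h t = (f (cis t) - w) * x t" for t
  note [measurable] = measurable_circle_param[OF f]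
  have [measurable]: "x \<in> borel_measurable borel" unfolding x_def by measurable
  have [measurable]: "h \<in> borel_measurable borel" unfolding h_def by measurable
  obtain B where B: "0 < B" "\<And>\<zeta>. cmod \<zeta> = 1 \<Longrightarrow> cmod (f \<zeta>) \<le> B" using circle_bound[OF f] by blast
  define D where "D = (\<Sum>k\<in>I. cmod (a k))"
  have xD: "cmod (x t) \<le> D" for t
    unfolding x_def D_def by (rule order_trans[OF norm_sum]) (simp add: norm_mult)
  have fB: "cmod (f (cis t) - w) \<le> B + cmod w" for t
    using norm_triangle_ineq4[of "f (cis t)" w] B(2)[of "cis t"] by simp
  have hB: "cmod (h t) \<le> (B + cmod w) * D" for t
    unfolding h_def norm_mult by (rule mult_mono[OF fB xD]) (use B in auto)
  have y: "ell2_coord y i = (LINT t|circle_measure. h t * cis (- (of_int (int i) * t)))" for i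
  proof -
    have i1: "integrable circle_measure (\<lambda>t. f (cis t) * cis (- (of_int (int i - int k) * t)))" for k
      by (rule integrable_circle_bounded[of _ B]) (auto simp: norm_mult B)
    have i2: "integrable circle_measure (\<lambda>t. cis (of_int (int k - int i) * t))" for k
      by (rule integrable_circle_bounded[of _ 1]) auto
    have i3: "integrable circle_measure (\<lambda>t. a k * (f (cis t) * cis (- (of_int (int i - int k) * t))
            - w * cis (of_int (int k - int i) * t)))" for k
      by (intro integrable_mult_right Bochner_Integration.integrable_diff i1 i2)
    have "(LINT t|circle_measure. h t * cis (- (of_int (int i) * t)))
        = (LINT t|circle_measure. (\<Sum>k\<in>I. a k * (f (cis t) * cis (- (of_int (int i - int k) * t))
            - w * cis (of_int (int k - int i) * t))))"
    proof (rule Bochner_Integration.integral_cong[OF refl])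
      fix t
      have "cis (- (of_int (int i - int k) * t)) = cis (real k * t) * cis (- (of_int (int i) * t))"
        "cis (of_int (int k - int i) * t) = cis (real k * t) * cis (- (of_int (int i) * t))" for k
        by (simp_all add: cis_mult algebra_simps)
      then show "h t * cis (- (of_int (int i) * t))
        = (\<Sum>k\<in>I. a k * (f (cis t) * cis (- (of_int (int i - int k) * t))
            - w * cis (of_int (int k - int i) * t)))"
        by (simp only: h_def x_def sum_distrib_left sum_distrib_right)
           (intro sum.cong refl, simp add: algebra_simps)
    qed
    also have "\<dots> = (\<Sum>k\<in>I. a k * (fourier_coeff f (int i - int k) - w * (if int k - int i = 0 then 1 else 0)))"
      by (subst Bochner_Integration.integral_sum[OF i3], subst integral_mult_right_zero,
          subst Bochner_Integration.integral_diff[OF i1 integrable_mult_right[OF i2]],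
          subst integral_mult_right_zero, subst integral_cis)
         (simp only: fourier_coeff_eq[OF f])
    also have "\<dots> = (\<Sum>k\<in>I. a k * matrix_entry T i k) - (\<Sum>k\<in>I. if k = i then w * a k else 0)"
      unfolding sum_subtractf[symmetric]
      by (rule sum.cong) (use sym in \<open>auto simp: is_symbol_def algebra_simps\<close>)
    also have "\<dots> = ell2_coord y i"
      using I by (simp add: y_def minus_ell2.rep_eq ell2_scaleC.rep_eq ell2_coord_operator_vec[OF T] ell2_coord_vec)
    finally show ?thesis by simp
  qed
  have "(norm y)\<^sup>2 \<le> (LINT t|circle_measure. (cmod (h t))\<^sup>2)"
    unfolding norm_ell2_sq
  proof (rule suminf_le_const[OF summable_ell2])
    fix n
    show "(\<Sum>i<n. (cmod (ell2_coord y i))\<^sup>2) \<le> (LINT t|circle_measure. (cmod (h t))\<^sup>2)"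
      using bessel_circle[where h = h and I = "int ` {..<n}", OF _ hB] unfolding y
      by (simp add: sum.reindex)
  qed
  then show ?thesis
    by (simp add: y_def h_def norm_mult power_mult_distrib x_def)
qed

lemma symbol_in_support:
  assumes \<mu>: "prob_space \<mu>" "sets \<mu> = sets borel" "compact (measure_support \<mu>)" "measure_support \<mu> \<noteq> {}"
    and P: "orthonormal_polys \<mu> P" and d: "hessenberg_matrix P d" and A: "operator_of_matrix d A"
    and T: "uniform_toeplitz_limit A T" and sym: "is_symbol T f" and f: "continuous_on (sphere 0 1) f"
    and z0: "cmod \<zeta> = 1"
  shows "f \<zeta> \<in> measure_support \<mu>"
proof (rule ccontr)
  let ?\<Gamma> = "measure_support \<mu>"
  define w where "w = f \<zeta>"
  define \<delta> where "\<delta> = infdist w ?\<Gamma>"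
  assume "f \<zeta> \<notin> ?\<Gamma>"
  then have \<delta>0: "\<delta> > 0"
    using \<mu>(3,4) unfolding \<delta>_def w_def
    by (metis compact_imp_closed in_closed_iff_infdist_zero infdist_nonneg less_eq_real_def)
  have \<delta>: "\<delta> \<le> cmod (z - w)" if "z \<in> ?\<Gamma>" for z
    using infdist_le[OF that, of w] by (simp add: \<delta>_def dist_norm norm_minus_commute)
  have bA: "bounded_operator A" and bT: "bounded_operator T"
    using T by (auto simp: uniform_toeplitz_limit_def)
  define \<epsilon> where "\<epsilon> n = onorm (\<lambda>x. (ell2_unshift ^^ n) (A ((ell2_shift ^^ n) x)) - T x)" for n
  have "\<epsilon> \<longlonglongrightarrow> 0" using T unfolding \<epsilon>_def uniform_toeplitz_limit_def by blast
  then have "\<forall>\<^sub>F n in sequentially. \<epsilon> n < \<delta> / 4" using \<delta>0 by (intro order_tendstoD) auto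
  \<comment> \<open>\<open>n\<close> is fixed first: the bound holds for every vector, so the length
    \<open>N\<close> and the position \<open>m\<close> may be chosen afterwards.\<close>
  then obtain n where n: "\<epsilon> n < \<delta> / 4" by (auto simp: eventually_sequentially)
  obtain B where B: "0 < B" "\<And>\<zeta>. cmod \<zeta> = 1 \<Longrightarrow> cmod (f \<zeta>) \<le> B" using circle_bound[OF f] by blast
  \<comment> \<open>The tolerance is multiplied below by \<open>2 * B\<close>, a bound for
    \<open>cmod (f x - w)\<close>, and so becomes \<open>\<delta>\<^sup>2 / 32\<close>.\<close>
  obtain C where C: "0 \<le> C"
    "\<And>x y. cmod x = 1 \<Longrightarrow> cmod y = 1 \<Longrightarrow> cmod (f x - f y) \<le> \<delta>\<^sup>2 / (64 * B) + C * (cmod (x - y))\<^sup>2"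
    using continuous_quadratic_modulus[OF f, of "\<delta>\<^sup>2 / (64 * B)"] B \<delta>0 by auto
  have fsq: "(cmod (f x - w))\<^sup>2 \<le> \<delta>\<^sup>2 / 32 + 2 * B * C * (cmod (x - \<zeta>))\<^sup>2" if "cmod x = 1" for x
  proof -
    have "(cmod (f x - w))\<^sup>2 \<le> (2 * B) * (\<delta>\<^sup>2 / (64 * B) + C * (cmod (x - \<zeta>))\<^sup>2)"
      unfolding power2_eq_square[of "cmod (f x - w)"]
    proof (rule mult_mono)
      show "cmod (f x - w) \<le> 2 * B"
        using norm_triangle_ineq4[of "f x" w] B(2)[OF that] B(2)[OF z0] by (simp add: w_def)
      show "cmod (f x - w) \<le> \<delta>\<^sup>2 / (64 * B) + C * (cmod (x - \<zeta>))\<^sup>2"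
        using C(2)[OF that z0] by (simp add: w_def)
    qed (use B in auto)
    then show ?thesis using B by (simp add: algebra_simps)
  qed
  \<comment> \<open>The part of the integral away from \<open>\<zeta>\<close> stays below
    \<open>8 * B * C\<close> for every length, whereas the square norm of the test vector is
    \<open>N\<close>. With this \<open>N\<close> the total is at most
    \<open>2 * (\<delta>\<^sup>2 / 32 * N)\<close>, which is the square of
    \<open>\<delta> / 4 * sqrt N\<close>.\<close>
  obtain N :: nat where N: "256 * (B * C) / \<delta>\<^sup>2 < real N" using reals_Archimedean2 by blast
  have "0 \<le> 256 * (B * C) / \<delta>\<^sup>2" using B C by simp
  with N have "0 < real N" by linarith
  then have N0: "N > 0" by simp
  have N2: "8 * B * C \<le> \<delta>\<^sup>2 / 32 * N" using N \<delta>0 by (simp add: field_simps)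
  define a where "a k = cnj \<zeta> ^ k" for k
  have a1: "cmod (a k) = 1" for k by (simp add: a_def norm_power z0)
  \<comment> \<open>The first \<open>n\<close> rows are cut off by \<open>ell2_unshift ^^ n\<close>
    and escape the norm estimate. Their entries tend to 0 along each row, so for fixed
    \<open>n\<close> and \<open>N\<close> a large \<open>m\<close> makes their contribution
    small.\<close>
  have "(\<lambda>m. (\<Sum>i<n. (cmod (\<Sum>k<N. a (k + (n + m)) * matrix_entry A i (k + (n + m))))\<^sup>2)) \<longlonglongrightarrow> (\<Sum>i<n. (cmod (\<Sum>k<N. 0))\<^sup>2)"
  proof (intro tendsto_sum tendsto_power tendsto_norm)
    fix i k
    show "(\<lambda>m. a (k + (n + m)) * matrix_entry A i (k + (n + m))) \<longlonglongrightarrow> 0"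
    proof (rule tendsto_norm_zero_cancel)
      have "(\<lambda>m. matrix_entry A i (m + (k + n))) \<longlonglongrightarrow> 0"
        by (rule LIMSEQ_ignore_initial_segment[OF matrix_row_tendsto_0[OF bA]])
      then have "(\<lambda>m. cmod (matrix_entry A i (m + (k + n)))) \<longlonglongrightarrow> 0" by (rule tendsto_norm_zero)
      then show "(\<lambda>m. cmod (a (k + (n + m)) * matrix_entry A i (k + (n + m)))) \<longlonglongrightarrow> 0"
        by (simp add: norm_mult a1 ac_simps)
    qed
  qed
  then have "\<forall>\<^sub>F m in sequentially. (\<Sum>i<n. (cmod (\<Sum>k<N. a (k + (n + m)) * matrix_entry A i (k + (n + m))))\<^sup>2) < \<delta>\<^sup>2 / 4"
    using \<delta>0 by (intro order_tendstoD) auto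
  then obtain m where m: "(\<Sum>i<n. (cmod (\<Sum>k<N. a (k + (n + m)) * matrix_entry A i (k + (n + m))))\<^sup>2) < \<delta>\<^sup>2 / 4"
    by (auto simp: eventually_sequentially)
  define u where "u = ell2_vec {n + m..<n + m + N} a"
  define v where "v = ell2_vec {m..<m + N} (\<lambda>k. a (k + n))"
  have uv: "u = (ell2_shift ^^ n) v" and vu: "v = (ell2_unshift ^^ n) u"
    by (rule ell2_eqI; auto simp: u_def v_def ell2_coord_vec ell2_coord_shift_pow ell2_coord_unshift_pow)+
  have nv: "norm v = sqrt N" "norm u = sqrt N"
    using norm_ell2_vec[of "{n + m..<n + m + N}" a] norm_ell2_vec[of "{m..<m + N}" "\<lambda>k. a (k + n)"]
    by (simp_all add: u_def[symmetric] v_def[symmetric] a1 real_sqrt_unique[symmetric])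
  define y where "y = A u - ell2_scaleC w u"
  have "\<delta> * sqrt N \<le> norm y"
    using hessenberg_bounded_below[OF \<mu>(1-3) P d A \<delta>, of "{n + m..<n + m + N}" a] \<delta>0
    by (simp add: y_def u_def[symmetric] nv)
  then have "(\<delta> * sqrt N)\<^sup>2 \<le> (norm y)\<^sup>2" using \<delta>0 by (intro power_mono) auto
  then have 1: "\<delta>\<^sup>2 * N \<le> (\<Sum>i<n. (cmod (ell2_coord y i))\<^sup>2) + (norm ((ell2_unshift ^^ n) y))\<^sup>2"
    by (simp add: power_mult_distrib norm_ell2_split[of y n])
  have "(\<Sum>i<n. (cmod (ell2_coord y i))\<^sup>2)
      = (\<Sum>i<n. (cmod (\<Sum>k<N. a (k + (n + m)) * matrix_entry A i (k + (n + m))))\<^sup>2)"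
  proof (intro sum.cong refl)
    fix i assume i: "i \<in> {..<n}"
    have "ell2_coord y i = (\<Sum>k\<in>{n + m..<n + m + N}. a k * matrix_entry A i k)"
      using i by (simp add: y_def u_def minus_ell2.rep_eq ell2_scaleC.rep_eq ell2_coord_operator_vec[OF bA] ell2_coord_vec)
    also have "\<dots> = (\<Sum>k<N. a (k + (n + m)) * matrix_entry A i (k + (n + m)))"
      by (rule sum.reindex_bij_witness[of _ "\<lambda>k. k + (n + m)" "\<lambda>k. k - (n + m)"]) auto
    finally show "(cmod (ell2_coord y i))\<^sup>2 = (cmod (\<Sum>k<N. a (k + (n + m)) * matrix_entry A i (k + (n + m))))\<^sup>2"
      by simp
  qed
  with m have 2: "(\<Sum>i<n. (cmod (ell2_coord y i))\<^sup>2) < \<delta>\<^sup>2 / 4" by simp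
  define x where "x t = (\<Sum>k\<in>{m..<m + N}. a (k + n) * cis (real k * t))" for t
  \<comment> \<open>A geometric sum: up to a unimodular factor \<open>x t\<close> is the sum of
    \<open>\<omega> ^ k\<close>, and multiplying by \<open>1 - \<omega>\<close> telescopes to
    \<open>1 - \<omega> ^ N\<close>, of modulus at most 2.\<close>
  have x: "(cmod (cis t - \<zeta>))\<^sup>2 * (cmod (x t))\<^sup>2 \<le> 4" for t
  proof -
    define \<omega> where "\<omega> = cnj \<zeta> * cis t"
    have \<zeta>: "cnj \<zeta> * \<zeta> = 1" using z0 complex_norm_square[of \<zeta>] by (simp add: mult.commute)
    have o1: "cmod \<omega> = 1" by (simp add: \<omega>_def norm_mult z0)
    have "x t = (\<Sum>k<N. a (k + m + n) * cis (real (k + m) * t))"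
      unfolding x_def by (rule sum.reindex_bij_witness[of _ "\<lambda>k. k + m" "\<lambda>k. k - m"]) auto
    also have "\<dots> = (\<Sum>k<N. (cnj \<zeta> ^ (m + n) * cis t ^ m) * \<omega> ^ k)"
      by (rule sum.cong) (auto simp: a_def \<omega>_def power_add power_mult_distrib Complex.DeMoivre algebra_simps simp flip: cis_mult)
    also have "\<dots> = (cnj \<zeta> ^ (m + n) * cis t ^ m) * (\<Sum>k<N. \<omega> ^ k)"
      by (simp add: sum_distrib_left)
    finally have xt: "cmod (x t) = cmod (\<Sum>k<N. \<omega> ^ k)"
      by (simp add: norm_mult norm_power z0)
    have "cmod (cis t - \<zeta>) = cmod (cnj \<zeta> * (cis t - \<zeta>))" by (simp add: norm_mult z0)
    also have "\<dots> = cmod (1 - \<omega>)" by (simp add: \<omega>_def right_diff_distrib \<zeta> norm_minus_commute)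
    finally have "cmod (cis t - \<zeta>) * cmod (x t) = cmod ((1 - \<omega>) * (\<Sum>k<N. \<omega> ^ k))"
      by (simp add: xt norm_mult)
    also have "\<dots> = cmod (1 - \<omega> ^ N)" by (simp only: one_diff_power_eq)
    also have "\<dots> \<le> 2" using norm_triangle_ineq4[of 1 "\<omega> ^ N"] by (simp add: norm_power o1)
    finally have "(cmod (cis t - \<zeta>) * cmod (x t))\<^sup>2 \<le> 2\<^sup>2" by (intro power_mono) auto
    then show ?thesis by (simp add: power_mult_distrib)
  qed
  have xN: "cmod (x t) \<le> N" for t
    unfolding x_def by (rule order_trans[OF norm_sum]) (simp add: norm_mult a1)
  note [measurable] = measurable_circle_param[OF f]
  have [measurable]: "x \<in> borel_measurable borel" unfolding x_def by measurable
  have "(norm (T v - ell2_scaleC w v))\<^sup>2 \<le> (LINT t|circle_measure. (cmod (f (cis t) - w))\<^sup>2 * (cmod (x t))\<^sup>2)"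
    unfolding v_def x_def by (rule norm_toeplitz_vec_le[OF bT sym f]) simp
  also have "\<dots> \<le> (LINT t|circle_measure. \<delta>\<^sup>2 / 32 * (cmod (x t))\<^sup>2 + 8 * B * C)"
  proof (rule Bochner_Integration.integral_mono)
    have f2: "cmod (f (cis t) - w) \<le> 2 * B" for t
      using norm_triangle_ineq4[of "f (cis t)" w] B(2)[of "cis t"] B(2)[OF z0] by (simp add: w_def)
    show "integrable circle_measure (\<lambda>t. (cmod (f (cis t) - w))\<^sup>2 * (cmod (x t))\<^sup>2)"
    proof (rule integrable_circle_bounded[of _ "(2 * B)\<^sup>2 * (real N)\<^sup>2"])
      fix t
      have "(cmod (f (cis t) - w))\<^sup>2 \<le> (2 * B)\<^sup>2" "(cmod (x t))\<^sup>2 \<le> (real N)\<^sup>2"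
        by (rule power_mono[OF f2 norm_ge_zero], rule power_mono[OF xN norm_ge_zero])
      then show "norm ((cmod (f (cis t) - w))\<^sup>2 * (cmod (x t))\<^sup>2) \<le> (2 * B)\<^sup>2 * (real N)\<^sup>2"
        by (simp add: mult_mono)
    qed measurable
    show "integrable circle_measure (\<lambda>t. \<delta>\<^sup>2 / 32 * (cmod (x t))\<^sup>2 + 8 * B * C)"
    proof (rule integrable_circle_bounded[of _ "\<delta>\<^sup>2 / 32 * (real N)\<^sup>2 + 8 * B * C"])
      fix t
      have "(cmod (x t))\<^sup>2 \<le> (real N)\<^sup>2" using xN[of t] by (auto intro: power_mono)
      then have "\<delta>\<^sup>2 / 32 * (cmod (x t))\<^sup>2 \<le> \<delta>\<^sup>2 / 32 * (real N)\<^sup>2" by (rule mult_left_mono) simp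
      moreover have "0 \<le> \<delta>\<^sup>2 / 32 * (cmod (x t))\<^sup>2" "0 \<le> 8 * B * C" using B C by auto
      ultimately show "norm (\<delta>\<^sup>2 / 32 * (cmod (x t))\<^sup>2 + 8 * B * C) \<le> \<delta>\<^sup>2 / 32 * (real N)\<^sup>2 + 8 * B * C"
        unfolding real_norm_def by linarith
    qed measurable
    fix t
    have "(cmod (f (cis t) - w))\<^sup>2 * (cmod (x t))\<^sup>2
      \<le> (\<delta>\<^sup>2 / 32 + 2 * B * C * (cmod (cis t - \<zeta>))\<^sup>2) * (cmod (x t))\<^sup>2"
      by (intro mult_right_mono fsq) auto
    also have "\<dots> = \<delta>\<^sup>2 / 32 * (cmod (x t))\<^sup>2 + 2 * B * C * ((cmod (cis t - \<zeta>))\<^sup>2 * (cmod (x t))\<^sup>2)"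
      by (simp add: algebra_simps)
    also have "\<dots> \<le> \<delta>\<^sup>2 / 32 * (cmod (x t))\<^sup>2 + 2 * B * C * 4"
      using B C by (intro add_left_mono mult_left_mono x) auto
    finally show "(cmod (f (cis t) - w))\<^sup>2 * (cmod (x t))\<^sup>2 \<le> \<delta>\<^sup>2 / 32 * (cmod (x t))\<^sup>2 + 8 * B * C" by simp
  qed
  also have "\<dots> = \<delta>\<^sup>2 / 32 * (LINT t|circle_measure. (cmod (x t))\<^sup>2) + 8 * B * C"
  proof -
    have "integrable circle_measure (\<lambda>t. (cmod (x t))\<^sup>2)"
      by (rule integrable_circle_bounded[of _ "N\<^sup>2"]) (use xN in \<open>auto intro!: power_mono\<close>)
    then show ?thesis by (subst Bochner_Integration.integral_add) auto
  qed
  also have "(LINT t|circle_measure. (cmod (x t))\<^sup>2) = N"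
    unfolding x_def by (subst integral_norm_trig_polynomial) (auto simp: a1)
  also have "\<delta>\<^sup>2 / 32 * N + 8 * B * C \<le> (\<delta> / 4 * sqrt N)\<^sup>2"
  proof -
    have "(\<delta> / 4 * sqrt N)\<^sup>2 = \<delta>\<^sup>2 / 32 * N + \<delta>\<^sup>2 / 32 * N"
      by (simp add: power_mult_distrib power_divide)
    with N2 show ?thesis by linarith
  qed
  finally have 3: "norm (T v - ell2_scaleC w v) \<le> \<delta> / 4 * sqrt N"
    by (rule power2_le_imp_le) (use \<delta>0 in auto)
  have "(ell2_unshift ^^ n) y = ((ell2_unshift ^^ n) (A ((ell2_shift ^^ n) v)) - T v) + (T v - ell2_scaleC w v)"
    unfolding y_def uv[symmetric]
    by (rule ell2_eqI) (simp add: vu ell2_coord_unshift_pow minus_ell2.rep_eq plus_ell2.rep_eq ell2_scaleC.rep_eq)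
  then have "norm ((ell2_unshift ^^ n) y)
      \<le> norm ((ell2_unshift ^^ n) (A ((ell2_shift ^^ n) v)) - T v) + norm (T v - ell2_scaleC w v)"
    by (metis norm_triangle_ineq)
  also have "\<dots> \<le> \<delta> / 4 * sqrt N + \<delta> / 4 * sqrt N"
  proof (rule add_mono[OF _ 3])
    have "norm ((ell2_unshift ^^ n) (A ((ell2_shift ^^ n) v)) - T v) \<le> \<epsilon> n * norm v"
      unfolding \<epsilon>_def by (rule toeplitz_limit_norm_le[OF T])
    also have "\<dots> \<le> \<delta> / 4 * sqrt N" unfolding nv using n by (intro mult_right_mono) auto
    finally show "norm ((ell2_unshift ^^ n) (A ((ell2_shift ^^ n) v)) - T v) \<le> \<delta> / 4 * sqrt N" .
  qed
  also have "\<dots> = \<delta> / 2 * sqrt N" by simp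
  finally have "(norm ((ell2_unshift ^^ n) y))\<^sup>2 \<le> (\<delta> / 2 * sqrt N)\<^sup>2" by (intro power_mono) auto
  then have "(norm ((ell2_unshift ^^ n) y))\<^sup>2 \<le> \<delta>\<^sup>2 / 4 * N" by (simp add: power_mult_distrib power_divide)
  \<comment> \<open>As \<open>N \<ge> 1\<close>, the right-hand side is at most half of the
    left-hand side.\<close>
  with 1 2 have "\<delta>\<^sup>2 * N < \<delta>\<^sup>2 / 4 + \<delta>\<^sup>2 / 4 * N" by simp
  moreover have "\<delta>\<^sup>2 / 4 * 1 \<le> \<delta>\<^sup>2 / 4 * N" using N0 by (intro mult_left_mono) auto
  moreover have "\<delta>\<^sup>2 * N > 0" using N0 \<delta>0 by simp
  ultimately show False by simp
qed

section \<open>The holomorphic extension of the symbol and its boundary values\<close>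

definition symbol_extension :: "(complex \<Rightarrow> complex) \<Rightarrow> complex \<Rightarrow> complex" where
  "symbol_extension f z = fourier_coeff f 1 * z + (\<Sum>k. fourier_coeff f (- int k) / z ^ k)"

lemma cmod_fourier_coeff_le:
  assumes f: "continuous_on (sphere 0 1) f" and B: "\<And>\<zeta>. cmod \<zeta> = 1 \<Longrightarrow> cmod (f \<zeta>) \<le> B"
  shows "cmod (fourier_coeff f k) \<le> B"
proof -
  note [measurable] = measurable_circle_param[OF f]
  have "cmod (fourier_coeff f k) \<le> (LINT t|circle_measure. B)"
    unfolding fourier_coeff_eq[OF f]
    by (rule Bochner_Integration.integral_norm_bound_integral)
       (auto intro!: integrable_circle_bounded[of _ B] B simp: norm_mult)
  then show ?thesis by simp
qed

text \<open>The Poisson integral \<open>Q\<close> of \<open>f\<close> at the reflected point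
  \<open>1 / cnj z\<close> has the same terms of index \<open>\<le> 0\<close> as the extension. The
  term of index 1 is harmonic in \<open>Q\<close>, with factor \<open>cnj l\<close> instead of
  \<open>z\<close>. The difference has modulus at most \<open>B * (cmod z - 1 / cmod z)\<close>,
  which vanishes on the circle.\<close>

lemma symbol_extension_boundary:
  assumes f: "continuous_on (sphere 0 1) f" and anal: "\<And>k. k \<ge> 2 \<Longrightarrow> fourier_coeff f k = 0" and e: "0 < e"
  obtains r where "r > 1" "\<And>z. 1 < cmod z \<Longrightarrow> cmod z < r \<Longrightarrow> cmod (symbol_extension f z - f (z / cmod z)) < e"
proof -
  note [measurable] = measurable_circle_param[OF f]
  obtain B where B: "0 < B" "\<And>\<zeta>. cmod \<zeta> = 1 \<Longrightarrow> cmod (f \<zeta>) \<le> B" using circle_bound[OF f] by blast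
  obtain C where C: "0 \<le> C"
    "\<And>x y. cmod x = 1 \<Longrightarrow> cmod y = 1 \<Longrightarrow> cmod (f x - f y) \<le> e / 4 + C * (cmod (x - y))\<^sup>2"
    using continuous_quadratic_modulus[OF f, of "e / 4"] e by auto
  have main: "cmod (symbol_extension f z - f (z / cmod z)) \<le> B * (cmod z - 1 / cmod z) + e / 4 + 4 * C * ((cmod z)\<^sup>2 - 1)"
    if z: "1 < cmod z" for z
  proof -
    define l where "l = 1 / z"
    define \<zeta> where "\<zeta> = z / cmod z"
    have z0: "z \<noteq> 0" using z by auto
    have l1: "cmod l < 1" "cmod l > 0" using z by (auto simp: l_def norm_divide divide_less_eq)
    have \<zeta>1: "cmod \<zeta> = 1" using z0 by (simp add: \<zeta>_def norm_divide)
    \<comment> \<open>the Poisson kernel of the point \<open>1 / cnj z\<close>\<close>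
    define P where "P t = (1 - (cmod l)\<^sup>2) / (cmod (1 - l * cis t))\<^sup>2" for t
    have ne: "1 - l * cis t \<noteq> 0" for t
      using l1 by (metis norm_mult norm_cis mult.right_neutral norm_one eq_iff_diff_eq_0 less_irrefl)
    have P0: "0 \<le> P t" for t
      using l1 by (simp add: P_def power_le_one)
    have [measurable]: "P \<in> borel_measurable borel" unfolding P_def by measurable
    have den: "1 - cmod l \<le> cmod (1 - l * cis t)" for t
      using norm_triangle_ineq2[of 1 "l * cis t"] by (simp add: norm_mult)
    have PB: "norm (P t) \<le> (1 - (cmod l)\<^sup>2) / (1 - cmod l)\<^sup>2" for t
      using P0[of t] l1 den[of t] unfolding P_def real_norm_def
      by (subst abs_of_nonneg) (auto intro!: divide_left_mono power_mono mult_pos_pos simp: power_le_one ne)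
    have sl: "summable (\<lambda>k. cmod (l ^ k))" "summable (\<lambda>k. cmod (cnj l ^ Suc k))"
      using l1 by (auto simp: norm_power norm_mult intro!: summable_geometric summable_mult)
    have Pser: "complex_of_real (P t) = (\<Sum>k. l ^ k * cis (real k * t)) + (\<Sum>k. cnj l ^ Suc k * cis (- (real (Suc k) * t)))" for t
    proof -
      define \<omega> where "\<omega> = l * cis t"
      have o1: "cmod \<omega> < 1" using l1 by (simp add: \<omega>_def norm_mult)
      have "(\<Sum>k. l ^ k * cis (real k * t)) = (\<Sum>k. \<omega> ^ k)"
        by (simp add: \<omega>_def power_mult_distrib Complex.DeMoivre)
      also have "\<dots> = 1 / (1 - \<omega>)" by (rule suminf_geometric[OF o1])
      finally have a: "(\<Sum>k. l ^ k * cis (real k * t)) = 1 / (1 - \<omega>)" .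
      have "cnj l ^ Suc k * cis (- (real (Suc k) * t)) = cnj \<omega> * cnj \<omega> ^ k" for k
      proof -
        have "cnj \<omega> ^ Suc k = cnj l ^ Suc k * cis (- (real (Suc k) * t))"
          unfolding \<omega>_def complex_cnj_mult cis_cnj power_mult_distrib Complex.DeMoivre by simp
        then show ?thesis by simp
      qed
      then have "(\<Sum>k. cnj l ^ Suc k * cis (- (real (Suc k) * t))) = (\<Sum>k. cnj \<omega> * cnj \<omega> ^ k)" by simp
      also have "\<dots> = cnj \<omega> * (1 / (1 - cnj \<omega>))"
        using o1 by (subst suminf_mult) (auto intro!: summable_geometric simp: suminf_geometric)
      finally have b: "(\<Sum>k. cnj l ^ Suc k * cis (- (real (Suc k) * t))) = cnj \<omega> / (1 - cnj \<omega>)" by simp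
      have "1 - \<omega> \<noteq> 0" using ne[of t] by (simp add: \<omega>_def)
      moreover from this have "1 - cnj \<omega> \<noteq> 0"
        by (metis complex_cnj_cnj complex_cnj_diff complex_cnj_one complex_cnj_zero_iff)
      ultimately have "1 / (1 - \<omega>) + cnj \<omega> / (1 - cnj \<omega>) = (1 - \<omega> * cnj \<omega>) / ((1 - \<omega>) * cnj (1 - \<omega>))"
        by (simp add: field_simps)
      also have "\<dots> = complex_of_real (P t)"
        unfolding complex_norm_square[symmetric] P_def
        by (simp add: \<omega>_def norm_mult)
      finally show ?thesis using a b by simp
    qed
    have Pint: "(LINT t|circle_measure. g t * P t) =
       (\<Sum>k. l ^ k * (LINT t|circle_measure. g t * cis (real k * t))) +
       (\<Sum>k. cnj l ^ Suc k * (LINT t|circle_measure. g t * cis (- (real (Suc k) * t))))"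
      if [measurable]: "g \<in> borel_measurable borel" and D: "\<And>t. cmod (g t) \<le> D" for g :: "real \<Rightarrow> complex" and D
    proof -
      define g1 where "g1 t = (\<Sum>k. l ^ k * (g t * cis (real k * t)))" for t
      define g2 where "g2 t = (\<Sum>k. cnj l ^ Suc k * (g t * cis (- (real (Suc k) * t))))" for t
      have [measurable]: "g1 \<in> borel_measurable borel" "g2 \<in> borel_measurable borel"
        unfolding g1_def g2_def by measurable
      have sn: "summable (\<lambda>k. cmod (l ^ k * cis (real k * t)))"
          "summable (\<lambda>k. cmod (cnj l ^ Suc k * cis (- (real (Suc k) * t))))" for t
        using sl by (simp_all only: norm_mult norm_cis mult_1_right)
      note sm = sn[THEN summable_norm_cancel]
      have g1: "g1 t = g t * (\<Sum>k. l ^ k * cis (real k * t))" for t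
        unfolding g1_def suminf_mult[OF sm(1), symmetric] by (simp add: mult_ac)
      have g2: "g2 t = g t * (\<Sum>k. cnj l ^ Suc k * cis (- (real (Suc k) * t)))" for t
        unfolding g2_def suminf_mult[OF sm(2), symmetric] by (simp add: mult_ac)
      have D0: "D \<ge> 0" using order_trans[OF norm_ge_zero D] .
      have b1: "cmod (g1 t) \<le> D * (\<Sum>k. cmod (l ^ k))" for t
        unfolding g1 norm_mult
        by (rule mult_mono[OF D _ D0 norm_ge_zero])
           (use summable_norm[OF sn(1)[of t]] in \<open>simp only: norm_mult norm_cis mult_1_right\<close>)
      have b2: "cmod (g2 t) \<le> D * (\<Sum>k. cmod (cnj l ^ Suc k))" for t
        unfolding g2 norm_mult
        by (rule mult_mono[OF D _ D0 norm_ge_zero])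
           (use summable_norm[OF sn(2)[of t]] in \<open>simp only: norm_mult norm_cis mult_1_right\<close>)
      have "(LINT t|circle_measure. g t * P t) = (LINT t|circle_measure. g1 t + g2 t)"
        unfolding Pser g1 g2 by (simp only: distrib_left)
      also have "\<dots> = (LINT t|circle_measure. g1 t) + (LINT t|circle_measure. g2 t)"
        by (intro Bochner_Integration.integral_add integrable_circle_bounded[OF _ b1] integrable_circle_bounded[OF _ b2]) measurable
      also have "(LINT t|circle_measure. g1 t) = (\<Sum>k. l ^ k * (LINT t|circle_measure. g t * cis (real k * t)))"
        unfolding g1_def by (rule integral_circle_suminf(1)[OF sl(1), of _ D]) (auto simp: norm_mult D)
      also have "(LINT t|circle_measure. g2 t) = (\<Sum>k. cnj l ^ Suc k * (LINT t|circle_measure. g t * cis (- (real (Suc k) * t))))"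
        unfolding g2_def by (rule integral_circle_suminf(1)[OF sl(2), of _ D]) (auto simp: norm_mult D)
      finally show ?thesis .
    qed
    have "(LINT t|circle_measure. 1 * complex_of_real (P t))
        = (\<Sum>k. l ^ k * (if k = 0 then 1 else 0)) + (\<Sum>k. cnj l ^ Suc k * 0)"
    proof (subst Pint[where D = 1])
      have "(LINT t|circle_measure. 1 * cis (real k * t)) = (if k = 0 then 1 else 0)" for k
        using integral_cis[of "int k"] by simp
      moreover have "(LINT t|circle_measure. 1 * cis (- (real (Suc k) * t))) = 0" for k
      proof -
        have *: "real_of_int (- int (Suc k)) * t = - (real (Suc k) * t)" for t by (simp add: algebra_simps)
        show ?thesis using integral_cis[of "- int (Suc k)"] unfolding * by (simp del: of_nat_Suc)
      qed
      ultimately show "(\<Sum>k. l ^ k * (LINT t|circle_measure. 1 * cis (real k * t))) +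
       (\<Sum>k. cnj l ^ Suc k * (LINT t|circle_measure. 1 * cis (- (real (Suc k) * t))))
       = (\<Sum>k. l ^ k * (if k = 0 then 1 else 0)) + (\<Sum>k. cnj l ^ Suc k * 0)" by simp
    qed auto
    also have "\<dots> = 1" by (subst suminf_finite[of "{0}"]) auto
    finally have P1: "(LINT t|circle_measure. P t) = 1"
      by (simp only: mult_1 integral_complex_of_real of_real_eq_1_iff)
    define Q where "Q = (LINT t|circle_measure. f (cis t) * complex_of_real (P t))"
    have "Q = (\<Sum>k. l ^ k * fourier_coeff f (- int k)) + (\<Sum>k. cnj l ^ Suc k * fourier_coeff f (int (Suc k)))"
      unfolding Q_def by (subst Pint[where D = B]) (use B in \<open>auto simp: fourier_coeff_eq[OF f]\<close>)
    also have "(\<Sum>k. cnj l ^ Suc k * fourier_coeff f (int (Suc k))) = cnj l * fourier_coeff f 1"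
      by (subst suminf_finite[of "{0}"]) (auto intro!: anal)
    also have "(\<Sum>k. l ^ k * fourier_coeff f (- int k)) = symbol_extension f z - fourier_coeff f 1 * z"
      by (simp add: symbol_extension_def l_def power_divide)
    finally have F: "symbol_extension f z = Q + fourier_coeff f 1 * (z - cnj l)"
      by (simp add: algebra_simps)
    have "z - cnj l = z * (1 - 1 / (cmod z)\<^sup>2)"
    proof -
      have "z * cnj z = (cmod z)\<^sup>2" by (rule complex_norm_square[symmetric])
      then have "z / (cmod z)\<^sup>2 = 1 / cnj z" using z0
        by (metis complex_cnj_zero_iff mult.right_neutral nonzero_mult_divide_mult_cancel_left times_divide_eq_right)
      then show ?thesis by (simp add: l_def right_diff_distrib)
    qed
    then have "cmod (z - cnj l) = cmod z * cmod (complex_of_real (1 - 1 / (cmod z)\<^sup>2))"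
      by (simp add: norm_mult)
    also have "\<dots> = cmod z * (1 - 1 / (cmod z)\<^sup>2)"
      unfolding norm_of_real using z one_le_power[of "cmod z" 2]
      by (subst abs_of_nonneg) (auto simp: divide_le_eq_1)
    also have "\<dots> = cmod z - 1 / cmod z" using z0 by (simp add: field_simps power2_eq_square)
    finally have zl: "cmod (z - cnj l) = cmod z - 1 / cmod z" .
    have iP: "integrable circle_measure P" by (rule integrable_circle_bounded[OF _ PB]) simp
    have ifP: "integrable circle_measure (\<lambda>t. f (cis t) * complex_of_real (P t))"
    proof (rule integrable_circle_bounded)
      show "cmod (f (cis t) * complex_of_real (P t)) \<le> B * ((1 - (cmod l)\<^sup>2) / (1 - cmod l)\<^sup>2)" for t
        unfolding norm_mult using B(2)[of "cis t"] PB[of t] B(1) by (intro mult_mono) auto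
    qed measurable
    have icP: "integrable circle_measure (\<lambda>t. f \<zeta> * complex_of_real (P t))"
      by (intro integrable_mult_right) (use iP in simp)
    have "Q - f \<zeta> = (LINT t|circle_measure. (f (cis t) - f \<zeta>) * complex_of_real (P t))"
      using ifP icP P1 by (simp add: left_diff_distrib Q_def)
    also have "cmod \<dots> \<le> (LINT t|circle_measure. e / 4 * P t + 4 * C * ((cmod z)\<^sup>2 - 1))"
    proof (rule Bochner_Integration.integral_norm_bound_integral)
      show "integrable circle_measure (\<lambda>t. (f (cis t) - f \<zeta>) * complex_of_real (P t))"
        using ifP icP by (simp add: left_diff_distrib)
      show "integrable circle_measure (\<lambda>t. e / 4 * P t + 4 * C * ((cmod z)\<^sup>2 - 1))"
        using iP by simp
      fix t
      \<comment> \<open>The distance from \<open>cis t\<close> to the radial projection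
        \<open>\<zeta>\<close> is at most twice the distance to \<open>z\<close>, and the latter is
        \<open>cmod z * cmod (1 - l * cis t)\<close>. The square therefore cancels the denominator
        of the Poisson kernel and leaves a bound independent of \<open>t\<close>.\<close>
      have 1: "(cmod (cis t - \<zeta>))\<^sup>2 * P t \<le> 4 * ((cmod z)\<^sup>2 - 1)"
      proof -
        have "cmod (\<zeta> - z) = cmod z - 1"
        proof -
          have "\<zeta> - z = complex_of_real (1 - cmod z) * \<zeta>" using z0
            by (simp add: \<zeta>_def field_simps)
          then have "cmod (\<zeta> - z) = \<bar>1 - cmod z\<bar>" by (simp only: norm_mult \<zeta>1 norm_of_real mult_1_right)
          then show ?thesis using z by simp
        qed
        moreover have "cmod z - 1 \<le> cmod (cis t - z)"
          using norm_triangle_ineq3[of "cis t" z] by simp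
        moreover have "cmod (cis t - \<zeta>) \<le> cmod (cis t - z) + cmod (\<zeta> - z)"
          using norm_triangle_ineq4[of "cis t - z" "\<zeta> - z"] by simp
        ultimately have "cmod (cis t - \<zeta>) \<le> 2 * cmod (cis t - z)" by simp
        also have "cis t - z = - z * (1 - l * cis t)" using z0 by (simp add: l_def algebra_simps)
        finally have "cmod (cis t - \<zeta>) \<le> 2 * cmod z * cmod (1 - l * cis t)" by (simp add: norm_mult)
        then have "(cmod (cis t - \<zeta>))\<^sup>2 \<le> (2 * cmod z * cmod (1 - l * cis t))\<^sup>2" by (intro power_mono) auto
        then have "(cmod (cis t - \<zeta>))\<^sup>2 * P t \<le> (2 * cmod z * cmod (1 - l * cis t))\<^sup>2 * P t"
          using P0 by (rule mult_right_mono)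
        also have "\<dots> = 4 * (cmod z)\<^sup>2 * (1 - (cmod l)\<^sup>2)"
          using ne[of t] by (simp add: P_def power_mult_distrib)
        also have "\<dots> = 4 * ((cmod z)\<^sup>2 - 1)"
          using z0 by (simp add: l_def norm_divide power_divide right_diff_distrib)
        finally show ?thesis .
      qed
      have "cmod ((f (cis t) - f \<zeta>) * complex_of_real (P t)) = cmod (f (cis t) - f \<zeta>) * P t"
        using P0[of t] by (simp add: norm_mult)
      also have "\<dots> \<le> (e / 4 + C * (cmod (cis t - \<zeta>))\<^sup>2) * P t"
        by (intro mult_right_mono C(2) P0) (auto simp: \<zeta>1)
      also have "\<dots> = e / 4 * P t + C * ((cmod (cis t - \<zeta>))\<^sup>2 * P t)" by (simp add: algebra_simps)
      also have "\<dots> \<le> e / 4 * P t + C * (4 * ((cmod z)\<^sup>2 - 1))"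
        by (intro add_left_mono mult_left_mono 1 C(1))
      finally show "cmod ((f (cis t) - f \<zeta>) * complex_of_real (P t)) \<le> e / 4 * P t + 4 * C * ((cmod z)\<^sup>2 - 1)"
        by (simp add: algebra_simps)
    qed
    also have "\<dots> = e / 4 + 4 * C * ((cmod z)\<^sup>2 - 1)"
      using iP by (subst Bochner_Integration.integral_add) (auto simp: P1)
    finally have 2: "cmod (Q - f \<zeta>) \<le> e / 4 + 4 * C * ((cmod z)\<^sup>2 - 1)" .
    have "cmod (symbol_extension f z - f \<zeta>) \<le> cmod (Q - f \<zeta>) + cmod (fourier_coeff f 1 * (z - cnj l))"
      unfolding F using norm_triangle_ineq[of "Q - f \<zeta>" "fourier_coeff f 1 * (z - cnj l)"]
      by (simp add: algebra_simps)
    also have "cmod (fourier_coeff f 1 * (z - cnj l)) \<le> B * (cmod z - 1 / cmod z)"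
      unfolding norm_mult zl using cmod_fourier_coeff_le[OF f B(2)] zl
      by (intro mult_right_mono) (auto simp flip: zl)
    finally show ?thesis using 2 by (simp add: \<zeta>_def)
  qed
  have "((\<lambda>r. B * (r - 1 / r) + e / 4 + 4 * C * (r\<^sup>2 - 1)) \<longlongrightarrow> B * (1 - 1 / 1) + e / 4 + 4 * C * (1\<^sup>2 - 1)) (at_right (1::real))"
    by (intro tendsto_intros) auto
  then have "\<forall>\<^sub>F r in at_right (1::real). B * (r - 1 / r) + e / 4 + 4 * C * (r\<^sup>2 - 1) < e"
    by (rule order_tendstoD) (use e in auto)
  then obtain b where b: "b > 1" "\<And>r. 1 < r \<Longrightarrow> r < b \<Longrightarrow> B * (r - 1 / r) + e / 4 + 4 * C * (r\<^sup>2 - 1) < e"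
    by (auto simp: eventually_at_right_field)
  show ?thesis
  proof (rule that[OF b(1)])
    fix z :: complex assume "1 < cmod z" "cmod z < b"
    then show "cmod (symbol_extension f z - f (z / cmod z)) < e"
      using main[of z] b(2)[of "cmod z"] by simp
  qed
qed

section \<open>Exterior conformal maps\<close>

text \<open>Convergence at a radius strictly between 1 and \<open>r\<close> upgrades to absolute
  convergence at \<open>r\<close>.\<close>

lemma summable_laurent_tail:
  fixes c :: "nat \<Rightarrow> complex"
  assumes "\<And>z. 1 < cmod z \<Longrightarrow> summable (\<lambda>k. c k / z ^ k)" and "1 < r"
  shows "summable (\<lambda>k. cmod (c k) / r ^ k)"
proof -
  obtain s where s: "1 < s" "s < r" using dense \<open>1 < r\<close> by blast
  have "summable (\<lambda>k. c k * (1 / complex_of_real s) ^ k)"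
    using assms(1)[of "complex_of_real s"] s by (simp add: power_divide)
  then have "summable (\<lambda>k. norm (c k * (1 / complex_of_real r) ^ k))"
    by (rule powser_insidea) (use s in \<open>auto simp: norm_divide field_simps\<close>)
  then show ?thesis
    using s by (simp add: norm_mult norm_divide norm_power power_divide)
qed

locale exterior_map =
  fixes \<phi> :: "complex \<Rightarrow> complex" and \<Gamma> :: "complex set" and c1 :: real and c :: "nat \<Rightarrow> complex"
  assumes hol: "\<phi> holomorphic_on {z. 1 < cmod z}"
    and bij: "bij_betw \<phi> {z. 1 < cmod z} (- \<Gamma>)"
    and c1_pos: "0 < c1"
    and expansion: "\<And>z. 1 < cmod z \<Longrightarrow> (\<lambda>k. c k / z ^ k) sums (\<phi> z - of_real c1 * z)"
begin

lemma open_exterior: "open {z. 1 < cmod z}"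
  by (intro open_Collect_less continuous_intros)

lemma inj: "inj_on \<phi> {z. 1 < cmod z}" and image: "\<phi> ` {z. 1 < cmod z} = - \<Gamma>"
  using bij by (auto simp: bij_betw_def)

lemma not_in: "1 < cmod z \<Longrightarrow> \<phi> z \<notin> \<Gamma>"
  using image by auto

lemma eq_iff: "1 < cmod z \<Longrightarrow> 1 < cmod w \<Longrightarrow> \<phi> z = \<phi> w \<longleftrightarrow> z = w"
  using inj by (auto simp: inj_on_def)

lemma cont: "continuous_on {z. 1 < cmod z} \<phi>"
  by (rule holomorphic_on_imp_continuous_on[OF hol])

lemma open_image: "open U \<Longrightarrow> U \<subseteq> {z. 1 < cmod z} \<Longrightarrow> open (\<phi> ` U)"
  using open_mapping_thm3[of \<phi> U] holomorphic_on_subset[OF hol] inj_on_subset[OF inj] by blast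

lemma summable_tail: "1 < r \<Longrightarrow> summable (\<lambda>k. cmod (c k) / r ^ k)"
  by (rule summable_laurent_tail) (use expansion sums_summable in blast)

lemma tail_bounded:
  assumes "1 < r" obtains M where "0 \<le> M" "\<And>z. r \<le> cmod z \<Longrightarrow> cmod (\<phi> z - of_real c1 * z) \<le> M"
proof
  show "0 \<le> (\<Sum>k. cmod (c k) / r ^ k)"
    using assms by (intro suminf_nonneg summable_tail) auto
  fix z assume z: "r \<le> cmod z"
  have pos: "0 < cmod z" "0 < r" using z assms by linarith+
  have le: "norm (c k / z ^ k) \<le> cmod (c k) / r ^ k" for k
    unfolding norm_divide norm_power using z pos
    by (intro divide_left_mono power_mono mult_pos_pos zero_less_power) auto
  have "cmod (\<phi> z - of_real c1 * z) = norm (\<Sum>k. c k / z ^ k)"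
    using expansion[of z] z assms by (simp add: sums_iff)
  also have "\<dots> \<le> (\<Sum>k. cmod (c k) / r ^ k)"
    by (rule order_trans[OF summable_norm suminf_le])
       (use le summable_tail[OF assms] in \<open>auto intro: summable_comparison_test'[OF summable_tail[OF assms], of 0]\<close>)
  finally show "cmod (\<phi> z - of_real c1 * z) \<le> (\<Sum>k. cmod (c k) / r ^ k)" .
qed

text \<open>A large \<open>w\<close> is attained far out, because \<open>z \<mapsto> (w - (\<phi> z - c1 z)) / c1\<close> maps a
  disk around \<open>w / c1\<close> into itself. By injectivity, \<open>\<phi>\<close> is bounded near the unit circle.\<close>
lemma large_values_attained:
  assumes r: "1 < r"
  obtains R where "\<And>w. R < cmod w \<Longrightarrow> \<exists>z. r \<le> cmod z \<and> \<phi> z = w"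
proof -
  obtain M where M: "0 \<le> M" "\<And>z. r \<le> cmod z \<Longrightarrow> cmod (\<phi> z - of_real c1 * z) \<le> M"
    using tail_bounded[OF r] by blast
  \<comment> \<open>Radius \<open>M / c1\<close> is what the self-map of the disk requires; the
    added 1 keeps the radius positive. The threshold \<open>c1 * (r + e)\<close> for
    \<open>w\<close> keeps the whole disk outside radius \<open>r\<close>, where the bound
    \<open>M\<close> holds.\<close>
  define e where "e = M / c1 + 1"
  have e: "0 < e" using M c1_pos by (simp add: e_def add_nonneg_pos)
  show ?thesis
  proof
    fix w assume w: "c1 * (r + e) < cmod w"
    have far: "r \<le> cmod z" if "z \<in> cball (w / c1) e" for z
    proof -
      have "cmod (w / c1) = cmod w / c1" using c1_pos by (simp add: norm_divide)
      moreover have "r + e < cmod w / c1" using w c1_pos by (simp add: field_simps)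
      moreover have "cmod (w / c1) - cmod z \<le> e"
        using norm_triangle_ineq2[of "w / c1" z] that by (simp add: dist_norm)
      ultimately show ?thesis by linarith
    qed
    have "cball (w / c1) e \<subseteq> {z. 1 < cmod z}" using far r by force
    then have "continuous_on (cball (w / c1) e) (\<lambda>z. (w - (\<phi> z - of_real c1 * z)) / c1)"
      using c1_pos by (intro continuous_intros continuous_on_subset[OF cont]) auto
    moreover have "(\<lambda>z. (w - (\<phi> z - of_real c1 * z)) / c1) \<in> cball (w / c1) e \<rightarrow> cball (w / c1) e"
    proof
      fix z assume "z \<in> cball (w / c1) e"
      then have "cmod (\<phi> z - of_real c1 * z) \<le> M" using far M by blast
      then have "cmod (\<phi> z - of_real c1 * z) / c1 \<le> M / c1" using c1_pos by (simp add: divide_right_mono)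
      moreover have "dist (w / c1) ((w - (\<phi> z - of_real c1 * z)) / c1) = cmod ((\<phi> z - of_real c1 * z) / c1)"
        by (simp add: dist_norm diff_divide_distrib)
      ultimately show "(w - (\<phi> z - of_real c1 * z)) / c1 \<in> cball (w / c1) e"
        using c1_pos by (simp add: norm_divide e_def)
    qed
    ultimately obtain z where z: "z \<in> cball (w / c1) e" "(w - (\<phi> z - of_real c1 * z)) / c1 = z"
      using brouwer_ball[OF e] by blast
    have "w - (\<phi> z - of_real c1 * z) = z * c1"
      using z(2) c1_pos by (metis nonzero_divide_eq_eq of_real_eq_0_iff less_irrefl)
    then have "\<phi> z = w" by (simp add: algebra_simps)
    then show "\<exists>z. r \<le> cmod z \<and> \<phi> z = w" using far z by blast
  qed
qed

lemma bounded_annulus: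
  assumes r: "1 < r" obtains R where "\<And>z. 1 < cmod z \<Longrightarrow> cmod z < r \<Longrightarrow> cmod (\<phi> z) \<le> R"
proof -
  obtain R where R: "\<And>w. R < cmod w \<Longrightarrow> \<exists>z. r \<le> cmod z \<and> \<phi> z = w"
    using large_values_attained[OF r] by blast
  show ?thesis
  proof
    fix z assume z: "1 < cmod z" "cmod z < r"
    show "cmod (\<phi> z) \<le> R"
    proof (rule ccontr)
      assume "\<not> cmod (\<phi> z) \<le> R"
      then obtain z' where "r \<le> cmod z'" "\<phi> z' = \<phi> z" using R[of "\<phi> z"] by auto
      then have "z' = z" using eq_iff[of z' z] z r by auto
      then show False using \<open>r \<le> cmod z'\<close> z by simp
    qed
  qed
qed

lemma remainder_bounded:
  obtains M where "0 \<le> M" "\<And>z. 1 < cmod z \<Longrightarrow> cmod (\<phi> z - of_real c1 * z) \<le> M"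
proof -
  obtain M where M: "0 \<le> M" "\<And>z. 2 \<le> cmod z \<Longrightarrow> cmod (\<phi> z - of_real c1 * z) \<le> M"
    using tail_bounded[of 2] by auto
  obtain R where R: "\<And>z. 1 < cmod z \<Longrightarrow> cmod z < 2 \<Longrightarrow> cmod (\<phi> z) \<le> R"
    using bounded_annulus[of 2] by auto
  show ?thesis
  proof (rule that[of "max M (R + c1 * 2)"])
    show "0 \<le> max M (R + c1 * 2)" using M by simp
    fix z assume z: "1 < cmod z"
    show "cmod (\<phi> z - of_real c1 * z) \<le> max M (R + c1 * 2)"
    proof (cases "2 \<le> cmod z")
      case True
      then show ?thesis using M(2)[of z] by simp
    next
      case False
      then have "cmod (\<phi> z) \<le> R" "c1 * cmod z \<le> c1 * 2" using R[of z] z c1_pos by auto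
      moreover have "cmod (\<phi> z - of_real c1 * z) \<le> cmod (\<phi> z) + c1 * cmod z"
        using norm_triangle_ineq4[of "\<phi> z" "of_real c1 * z"] c1_pos by (simp add: norm_mult)
      ultimately show ?thesis by linarith
    qed
  qed
qed

section \<open>Boundary values of the Riemann map\<close>

definition remainder :: "complex \<Rightarrow> complex" where "remainder z = \<phi> z - of_real c1 * z"

lemma remainder_circle:
  fixes r t :: real
  assumes "1 < r"
  shows "remainder (of_real r * cis t) = (\<Sum>k. c k / r ^ k * cis (- (real k * t)))"
proof -
  have "c k / (of_real r * cis t) ^ k = c k / r ^ k * cis (- (real k * t))" for k
    by (simp add: power_mult_distrib Complex.DeMoivre cis_divide divide_inverse cis_inverse)
  moreover have "1 < cmod (of_real r * cis t)" using assms by (simp add: norm_mult)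
  ultimately show ?thesis
    using expansion[of "of_real r * cis t"] by (simp add: remainder_def sums_iff)
qed

lemma measurable_circle:
  fixes r :: real
  assumes "1 < r" shows "(\<lambda>t. \<phi> (of_real r * cis t)) \<in> borel_measurable borel"
  by (rule borel_measurable_continuous_onI, rule continuous_on_compose2[OF cont])
     (use assms in \<open>auto intro!: continuous_intros simp: norm_mult\<close>)

text \<open>Parseval's identity on the circle of radius \<open>r\<close> bounds each partial sum by
  \<open>M\<^sup>2\<close> uniformly in \<open>r\<close>; in a finite sum \<open>r\<close> may then
  tend to 1. The bound \<open>M\<close> rests on the boundedness of \<open>\<phi>\<close> near the
  unit circle.\<close>

lemma summable_coeff_sq: "summable (\<lambda>k. (cmod (c k))\<^sup>2)"
proof -
  obtain M where M: "0 \<le> M" "\<And>z. 1 < cmod z \<Longrightarrow> cmod (\<phi> z - of_real c1 * z) \<le> M"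
    using remainder_bounded by blast
  have le: "(\<Sum>k<n. (cmod (c k))\<^sup>2 / (r ^ k)\<^sup>2) \<le> M\<^sup>2" if r: "1 < r" for n and r :: real
  proof -
    have s: "summable (\<lambda>k. cmod (c k / complex_of_real r ^ k))"
      using summable_tail[OF r] r by (simp add: norm_divide norm_power)
    note p = parseval_circle[OF s]
    have "(\<Sum>k<n. (cmod (c k / complex_of_real r ^ k))\<^sup>2) \<le> (\<Sum>k. (cmod (c k / complex_of_real r ^ k))\<^sup>2)"
      by (rule sum_le_suminf[OF p(2)]) auto
    also have "\<dots> = (LINT t|circle_measure. (cmod (remainder (of_real r * cis t)))\<^sup>2)"
      using p(1) r by (simp add: remainder_circle[OF r])
    also have "\<dots> \<le> (LINT t|circle_measure. M\<^sup>2)"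
    proof (rule Bochner_Integration.integral_mono)
      have b: "(cmod (remainder (of_real r * cis t)))\<^sup>2 \<le> M\<^sup>2" for t
        using M(2)[of "of_real r * cis t"] r by (intro power_mono) (auto simp: remainder_def norm_mult)
      then show "(cmod (remainder (of_real r * cis t)))\<^sup>2 \<le> M\<^sup>2" for t .
      have [measurable]: "(\<lambda>t. \<phi> (of_real r * cis t)) \<in> borel_measurable borel" by (rule measurable_circle[OF r])
      show "integrable circle_measure (\<lambda>t. (cmod (remainder (of_real r * cis t)))\<^sup>2)"
        by (rule integrable_circle_bounded[of _ "M\<^sup>2"]) (use b in \<open>auto simp: remainder_def\<close>)
    qed simp
    finally show ?thesis using r by (simp add: norm_divide norm_power power_divide)
  qed
  have "(\<Sum>k<n. (cmod (c k))\<^sup>2) \<le> M\<^sup>2" for n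
  proof (rule tendsto_upperbound)
    show "((\<lambda>r. \<Sum>k<n. (cmod (c k))\<^sup>2 / (r ^ k)\<^sup>2) \<longlongrightarrow> (\<Sum>k<n. (cmod (c k))\<^sup>2)) (at_right (1::real))"
      by (rule tendsto_eq_intros refl | simp)+
    show "\<forall>\<^sub>F r in at_right (1::real). (\<Sum>k<n. (cmod (c k))\<^sup>2 / (r ^ k)\<^sup>2) \<le> M\<^sup>2"
      using le by (auto simp: eventually_at_right_field intro!: exI[of _ 2])
  qed simp
  then show ?thesis by (intro summableI_nonneg_bounded) auto
qed

text \<open>The squared L2 distance between the remainder on the circle of radius \<open>r\<close>
  and its formal boundary series with coefficients \<open>c k\<close>.\<close>

definition defect :: "real \<Rightarrow> real" where
  "defect r = (\<Sum>k. (cmod (c k))\<^sup>2 * (1 - 1 / r ^ k)\<^sup>2)"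

lemma defect_term_le:
  assumes "1 \<le> r" shows "(cmod (c k))\<^sup>2 * (1 - 1 / r ^ k)\<^sup>2 \<le> (cmod (c k))\<^sup>2"
proof -
  have "0 \<le> 1 - 1 / r ^ k" "1 - 1 / r ^ k \<le> 1" using assms by auto
  then have "(1 - 1 / r ^ k)\<^sup>2 \<le> 1" by (rule power_le_one)
  then show ?thesis by (simp add: mult_left_le)
qed

lemma summable_defect: "1 \<le> r \<Longrightarrow> summable (\<lambda>k. (cmod (c k))\<^sup>2 * (1 - 1 / r ^ k)\<^sup>2)"
  by (rule summable_comparison_test'[OF summable_coeff_sq, of 0]) (use defect_term_le in auto)

lemma defect_tendsto_0: "(defect \<longlongrightarrow> 0) (at_right 1)"
proof -
  have "((\<lambda>r. (\<Sum>k. (cmod (c k))\<^sup>2 * (1 - 1 / r ^ k)\<^sup>2)) \<longlongrightarrow> (\<Sum>k::nat. 0)) (at_right (1::real))"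
  proof (rule tannerys_theorem[THEN conjunct2, THEN conjunct2, OF _ _ summable_coeff_sq])
    show "((\<lambda>r. (cmod (c k))\<^sup>2 * (1 - 1 / r ^ k)\<^sup>2) \<longlongrightarrow> 0) (at_right 1)" for k
      by (rule tendsto_eq_intros refl | simp)+
    have "\<forall>\<^sub>F r in at_right (1::real). 1 \<le> r"
      by (auto simp: eventually_at_right_field intro!: exI[of _ 2])
    then show "\<forall>\<^sub>F (k, r) in sequentially \<times>\<^sub>F at_right 1.
        norm ((cmod (c k))\<^sup>2 * (1 - 1 / r ^ k)\<^sup>2) \<le> (cmod (c k))\<^sup>2"
      unfolding eventually_prod_filter
      by (intro exI[of _ "\<lambda>_. True"] exI[of _ "\<lambda>r. 1 \<le> r"]) (auto simp: defect_term_le)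
  qed simp
  then show ?thesis by (simp add: defect_def[abs_def])
qed

text \<open>Coefficientwise \<open>1 / s ^ k - 1 / r ^ k \<le> 1 - 1 / r ^ k\<close>, so the bound
  is uniform over all smaller radii \<open>s > 1\<close>.\<close>

lemma remainder_L2_diff:
  fixes r s :: real
  assumes "1 < s" "s \<le> r"
  shows "(LINT t|circle_measure. (cmod (remainder (of_real r * cis t) - remainder (of_real s * cis t)))\<^sup>2) \<le> defect r"
proof -
  have r: "1 < r" using assms by simp
  define a where "a k = c k / r ^ k - c k / s ^ k" for k
  have s1: "summable (\<lambda>k. cmod (c k / complex_of_real r ^ k))" "summable (\<lambda>k. cmod (c k / complex_of_real s ^ k))"
    using summable_tail[OF r] summable_tail[OF assms(1)] r assms by (simp_all add: norm_divide norm_power)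
  have sc: "summable (\<lambda>k. c k / r ^ k * cis (- (real k * t)))" "summable (\<lambda>k. c k / s ^ k * cis (- (real k * t)))" for t
    by (rule summable_norm_cancel, simp only: norm_mult norm_cis mult_1_right of_real_power s1)+
  have sa: "summable (\<lambda>k. cmod (a k))"
    by (rule summable_comparison_test'[OF summable_add[OF s1], of 0]) (simp add: a_def norm_triangle_ineq4)
  have "remainder (of_real r * cis t) - remainder (of_real s * cis t) = (\<Sum>k. a k * cis (- (real k * t)))" for t
    using suminf_diff[OF sc, of t] by (simp add: remainder_circle r assms a_def left_diff_distrib)
  then have "(LINT t|circle_measure. (cmod (remainder (of_real r * cis t) - remainder (of_real s * cis t)))\<^sup>2) = (\<Sum>k. (cmod (a k))\<^sup>2)"
    using parseval_circle(1)[OF sa] by simp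
  also have "\<dots> \<le> defect r"
    unfolding defect_def
  proof (rule suminf_le[OF _ parseval_circle(2)[OF sa]])
    fix k
    have "1 / r ^ k \<le> 1 / s ^ k" using assms r by (intro divide_left_mono power_mono) auto
    moreover have "1 / s ^ k \<le> 1" using assms by auto
    ultimately have "(1 / s ^ k - 1 / r ^ k)\<^sup>2 \<le> (1 - 1 / r ^ k)\<^sup>2" by (intro power_mono) auto
    then have "(cmod (c k))\<^sup>2 * (1 / s ^ k - 1 / r ^ k)\<^sup>2 \<le> (cmod (c k))\<^sup>2 * (1 - 1 / r ^ k)\<^sup>2"
      by (rule mult_left_mono) simp
    moreover have "a k = - (c k * complex_of_real (1 / s ^ k - 1 / r ^ k))"
      by (simp add: a_def algebra_simps divide_inverse)
    then have "cmod (a k) = cmod (c k) * \<bar>1 / s ^ k - 1 / r ^ k\<bar>"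
      by (simp only: norm_minus_cancel norm_mult norm_of_real)
    then have "(cmod (a k))\<^sup>2 = (cmod (c k))\<^sup>2 * (1 / s ^ k - 1 / r ^ k)\<^sup>2"
      by (simp add: power_mult_distrib)
    ultimately show "(cmod (a k))\<^sup>2 \<le> (cmod (c k))\<^sup>2 * (1 - 1 / r ^ k)\<^sup>2" by simp
  qed (use summable_defect r in auto)
  finally show ?thesis .
qed

text \<open>The Cauchy estimate in \<open>L\<^sup>2\<close> is made summable along the radii, which turns it into
  almost sure convergence.\<close>
lemma AE_boundary_values:
  obtains r :: "nat \<Rightarrow> real" where "\<And>j. 1 < r j" "\<And>j. r (Suc j) < r j" "\<And>j. r j < 2" "r \<longlonglongrightarrow> 1"
    "AE t in circle_measure. convergent (\<lambda>j. \<phi> (of_real (r j) * cis t))"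
proof -
  \<comment> \<open>The defect measures squares: \<open>(1 / 4) ^ j\<close> corresponds to an L1
    bound \<open>(1 / 2) ^ j\<close> for the increments, which is summable.\<close>
  define good where "good j x \<longleftrightarrow> 1 < x \<and> x < 1 + 1 / real (Suc j) \<and> defect x < (1 / 4) ^ j" for j and x :: real
  have ev: "\<exists>x. good j x \<and> x < y" if "1 < y" for j y
  proof -
    have "\<forall>\<^sub>F x in at_right 1. defect x < (1 / 4) ^ j"
      by (rule order_tendstoD(2)[OF defect_tendsto_0]) simp
    moreover have "\<forall>\<^sub>F x in at_right (1::real). x < 1 + 1 / real (Suc j)"
      by (rule eventually_at_right_real[THEN eventually_mono]) auto
    moreover have "\<forall>\<^sub>F x in at_right (1::real). x \<in> {1<..<y}"
      using that by (rule eventually_at_right_real)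
    ultimately have "\<forall>\<^sub>F x in at_right 1. good j x \<and> x < y"
      by eventually_elim (auto simp: good_def)
    then show ?thesis by (rule eventually_happens'[rotated]) simp
  qed
  \<comment> \<open>The strict decrease is used again in the capacity estimate, where two
    consecutive circles have to be disjoint and nested.\<close>
  obtain r where r: "\<And>j. good j (r j)" "\<And>j. r (Suc j) < r j"
    using dependent_nat_choice[of good "\<lambda>_ x y. y < x"] ev ev[of 2 0]
    by (metis good_def less_numeral_extra(1) one_less_numeral_iff semiring_norm(76))
  have r1: "1 < r j" "r j < 1 + 1 / real (Suc j)" "defect (r j) < (1 / 4) ^ j" for j
    using r(1)[of j] by (auto simp: good_def)
  have r2: "r j < 2" for j
  proof -
    have "1 / real (Suc j) \<le> 1" by simp
    then show ?thesis using r1(2)[of j] by linarith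
  qed
  have lim: "r \<longlonglongrightarrow> 1"
  proof (rule tendsto_sandwich[of "\<lambda>_. 1" _ _ "\<lambda>j. 1 + 1 / real (Suc j)"])
    have "(\<lambda>j. 1 + inverse (real (Suc j))) \<longlonglongrightarrow> 1 + 0"
      by (intro tendsto_intros LIMSEQ_inverse_real_of_nat)
    then show "(\<lambda>j. 1 + 1 / real (Suc j)) \<longlonglongrightarrow> 1" by (simp add: inverse_eq_divide)
  qed (use r1(1,2) in \<open>auto intro!: always_eventually less_imp_le simp del: of_nat_Suc\<close>)
  define \<Delta> where "\<Delta> j t = cmod (remainder (of_real (r (Suc j)) * cis t) - remainder (of_real (r j) * cis t))" for j t
  have [measurable]: "(\<lambda>t. \<phi> (of_real (r j) * cis t)) \<in> borel_measurable borel" for j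
    by (rule measurable_circle[OF r1(1)])
  have [measurable]: "\<Delta> j \<in> borel_measurable borel" for j
    unfolding \<Delta>_def remainder_def by measurable
  have "(\<integral>\<^sup>+t. ennreal (\<Delta> j t) \<partial>circle_measure) \<le> ennreal ((1 / 2) ^ j)" for j
  proof -
    obtain M where M: "0 \<le> M" "\<And>z. 1 < cmod z \<Longrightarrow> cmod (\<phi> z - of_real c1 * z) \<le> M"
      using remainder_bounded by blast
    have D: "0 \<le> \<Delta> j t" "\<Delta> j t \<le> 2 * M" for t
    proof -
      have "cmod (remainder (of_real (r j) * cis t)) \<le> M" "cmod (remainder (of_real (r (Suc j)) * cis t)) \<le> M"
        using M(2)[of "of_real (r j) * cis t"] M(2)[of "of_real (r (Suc j)) * cis t"] r1(1)[of j] r1(1)[of "Suc j"]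
        by (auto simp: remainder_def norm_mult)
      then show "\<Delta> j t \<le> 2 * M"
        unfolding \<Delta>_def by (intro order_trans[OF norm_triangle_ineq4]) linarith
    qed (simp add: \<Delta>_def)
    have i1: "integrable circle_measure (\<Delta> j)"
      by (rule integrable_circle_bounded[of _ "2 * M"]) (use D in auto)
    have i2: "integrable circle_measure (\<lambda>t. (\<Delta> j t)\<^sup>2)"
      by (rule integrable_circle_bounded[of _ "(2 * M)\<^sup>2"], measurable)
         (simp only: real_norm_def abs_power2, rule power_mono[OF D(2) D(1)])
    have sq: "(LINT t|circle_measure. (\<Delta> j t)\<^sup>2) \<le> (1 / 4) ^ j"
    proof -
      have "(LINT t|circle_measure. (\<Delta> j t)\<^sup>2) \<le> defect (r j)"
        using remainder_L2_diff[OF r1(1)[of "Suc j"], of "r j"] less_imp_le[OF r(2)[of j]]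
        by (simp add: \<Delta>_def norm_minus_commute)
      then show ?thesis using r1(3)[of j] by simp
    qed
    \<comment> \<open>The inequality of arithmetic and geometric means with weight
      \<open>2 ^ j\<close> passes from L2 to L1 and balances both summands at
      \<open>(1 / 2) ^ j\<close>.\<close>
    have pt: "\<Delta> j t \<le> (2 ^ j * (\<Delta> j t)\<^sup>2 + (1 / 2) ^ j) / 2" for t
    proof -
      have "0 \<le> 2 ^ j * (\<Delta> j t - (1 / 2) ^ j)\<^sup>2" by simp
      also have "\<dots> = 2 ^ j * (\<Delta> j t)\<^sup>2 - 2 * (2 ^ j * (1 / 2) ^ j) * \<Delta> j t + (2 ^ j * (1 / 2) ^ j) * (1 / 2) ^ j"
        by (simp add: power2_diff algebra_simps power2_eq_square)
      also have "(2::real) ^ j * (1 / 2) ^ j = 1" by (simp flip: power_mult_distrib)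
      finally show ?thesis by simp
    qed
    have "(\<integral>\<^sup>+t. ennreal (\<Delta> j t) \<partial>circle_measure) = ennreal (LINT t|circle_measure. \<Delta> j t)"
      by (rule nn_integral_eq_integral[OF i1]) (use D in auto)
    also have "(LINT t|circle_measure. \<Delta> j t) \<le> (LINT t|circle_measure. (2 ^ j * (\<Delta> j t)\<^sup>2 + (1 / 2) ^ j) / 2)"
      by (rule Bochner_Integration.integral_mono[OF i1 _ pt]) (use i2 in simp)
    also have "\<dots> = (2 ^ j * (LINT t|circle_measure. (\<Delta> j t)\<^sup>2) + (1 / 2) ^ j) / 2"
      using i2 by simp
    also have "\<dots> \<le> (2 ^ j * (1 / 4) ^ j + (1 / 2) ^ j) / 2"
      using sq by simp
    also have "(2::real) ^ j * (1 / 4) ^ j = (1 / 2) ^ j" by (simp flip: power_mult_distrib)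
    finally show ?thesis by (simp add: ennreal_leI)
  qed
  then have "(\<Sum>j. \<integral>\<^sup>+t. ennreal (\<Delta> j t) \<partial>circle_measure) \<le> (\<Sum>j. ennreal ((1 / 2) ^ j))"
    by (intro suminf_le) auto
  also have "\<dots> < \<infinity>"
    by (subst suminf_ennreal_eq[OF _ geometric_sums]) auto
  finally have "(\<integral>\<^sup>+t. (\<Sum>j. ennreal (\<Delta> j t)) \<partial>circle_measure) \<noteq> \<infinity>"
    by (subst nn_integral_suminf) auto
  then have "AE t in circle_measure. (\<Sum>j. ennreal (\<Delta> j t)) \<noteq> \<infinity>"
    by (rule nn_integral_PInf_AE[rotated]) measurable
  then have "AE t in circle_measure. convergent (\<lambda>j. \<phi> (of_real (r j) * cis t))"
  proof eventually_elim
    fix t assume "(\<Sum>j. ennreal (\<Delta> j t)) \<noteq> \<infinity>"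
    then have "summable (\<lambda>j. \<Delta> j t)"
      by (intro summable_suminf_not_top) (auto simp: \<Delta>_def)
    then have "summable (\<lambda>j. remainder (of_real (r (Suc j)) * cis t) - remainder (of_real (r j) * cis t))"
      unfolding \<Delta>_def by (rule summable_norm_cancel)
    then have "convergent (\<lambda>n. \<Sum>j<n. remainder (of_real (r (Suc j)) * cis t) - remainder (of_real (r j) * cis t))"
      by (simp add: summable_iff_convergent)
    then obtain L where "(\<lambda>n. remainder (of_real (r n) * cis t) - remainder (of_real (r 0) * cis t)) \<longlonglongrightarrow> L"
      by (auto simp: sum_lessThan_telescope[where f = "\<lambda>j. remainder (of_real (r j) * cis t)"] convergent_def)
    then have "(\<lambda>n. (remainder (of_real (r n) * cis t) - remainder (of_real (r 0) * cis t)) + remainder (of_real (r 0) * cis t) + c1 * (of_real (r n) * cis t))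
        \<longlonglongrightarrow> L + remainder (of_real (r 0) * cis t) + c1 * (complex_of_real 1 * cis t)"
      by (intro tendsto_intros lim)
    then show "convergent (\<lambda>j. \<phi> (of_real (r j) * cis t))"
      by (auto simp: remainder_def convergent_def)
  qed
  then show ?thesis using that r1(1) r(2) r2 lim by blast
qed

text \<open>If \<open>w\<close> were a value \<open>\<phi> z\<close>, the open image of the region
  beyond some \<open>\<rho> < cmod z\<close> would be a neighbourhood of \<open>w\<close>. It would
  contain \<open>\<phi>\<close> of points of modulus below \<open>\<rho>\<close>, against
  injectivity.\<close>

lemma boundary_limit_in:
  fixes r :: "nat \<Rightarrow> real"
  assumes r: "\<And>j. 1 < r j" "r \<longlonglongrightarrow> 1" and lim: "(\<lambda>j. \<phi> (of_real (r j) * cis t)) \<longlonglongrightarrow> w"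
  shows "w \<in> \<Gamma>"
proof (rule ccontr)
  assume "w \<notin> \<Gamma>"
  then have "w \<in> \<phi> ` {z. 1 < cmod z}" by (simp add: image)
  then obtain z where z: "1 < cmod z" "\<phi> z = w" by auto
  obtain \<rho> where \<rho>: "1 < \<rho>" "\<rho> < cmod z" using dense z by blast
  have "open {x. \<rho> < cmod x}" by (intro open_Collect_less continuous_intros)
  then have "open (\<phi> ` {x. \<rho> < cmod x})" by (rule open_image) (use \<rho> in auto)
  then have "\<forall>\<^sub>F j in sequentially. \<phi> (of_real (r j) * cis t) \<in> \<phi> ` {x. \<rho> < cmod x}"
    using z \<rho> by (intro topological_tendstoD[OF lim]) auto
  moreover have "\<forall>\<^sub>F j in sequentially. r j < \<rho>" by (rule order_tendstoD(2)[OF r(2) \<rho>(1)])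
  ultimately have "\<forall>\<^sub>F j in sequentially. False"
  proof eventually_elim
    fix j assume "\<phi> (of_real (r j) * cis t) \<in> \<phi> ` {x. \<rho> < cmod x}" and *: "r j < \<rho>"
    then obtain x where x: "\<rho> < cmod x" "\<phi> (of_real (r j) * cis t) = \<phi> x" by blast
    have "cmod (of_real (r j) * cis t) = r j" using r(1)[of j] by (simp add: norm_mult)
    then have "of_real (r j) * cis t = x" using eq_iff[of "of_real (r j) * cis t" x] x \<rho> r(1)[of j] by simp
    with x * \<open>cmod (of_real (r j) * cis t) = r j\<close> show False by simp
  qed
  then show False by simp
qed

text \<open>In the coordinate \<open>x = 1 / z\<close> the function
  \<open>K x = x * (\<phi> (1 / x) - \<phi> w)\<close> has a removable singularity with
  \<open>K 0 = c1\<close>. By injectivity it has no zero for \<open>cmod x < 1 / cmod w\<close>, so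
  it has a holomorphic logarithm there, to which the mean value property at 0 applies. The factor
  \<open>x\<close> accounts for \<open>ln r\<close>.\<close>

lemma mean_log_circle:
  fixes r :: real
  assumes w: "1 < cmod w" and r: "cmod w < r"
  shows "(LINT t|circle_measure. ln (cmod (\<phi> (of_real r * cis t) - \<phi> w))) = ln c1 + ln r"
proof -
  define R where "R = cmod w"
  define S where "S x = (\<Sum>k. c k * x ^ k)" for x :: complex
  have sumsS: "(\<lambda>k. c k * x ^ k) sums S x" if "cmod x < 1" for x :: complex
  proof (cases "x = 0")
    case True
    then show ?thesis by (simp add: S_def)
  next
    case False
    then have "1 < cmod (1 / x)" using that by (simp add: norm_divide)
    from sums_summable[OF expansion[OF this]] show ?thesis
      unfolding S_def by (intro summable_sums) (simp add: power_divide)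
  qed
  have phi: "\<phi> (1 / x) = of_real c1 / x + S x" if "cmod x < 1" "x \<noteq> 0" for x :: complex
  proof -
    have "1 < cmod (1 / x)" using that by (simp add: norm_divide)
    from expansion[OF this] have "(\<lambda>k. c k * x ^ k) sums (\<phi> (1 / x) - of_real c1 / x)" by (simp add: power_divide)
    with sumsS[OF that(1)] show ?thesis by (metis sums_unique2 add_diff_cancel_left' add.commute diff_add_cancel)
  qed
  define K where "K x = of_real c1 + x * (S x - \<phi> w)" for x :: complex
  have R1: "1 / R < 1" "R > 0" using w by (auto simp: R_def divide_less_eq)
  have "S holomorphic_on ball 0 1"
    by (rule power_series_holomorphic[of 0 1 c]) (use sumsS in simp)
  then have "S holomorphic_on ball 0 (1 / R)"
    by (rule holomorphic_on_subset[OF _ subset_ball[OF less_imp_le[OF R1(1)]]])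
  then have holK: "K holomorphic_on ball 0 (1 / R)"
    unfolding K_def by (intro holomorphic_intros)
  have K: "K x = x * (\<phi> (1 / x) - \<phi> w)" if "cmod x < 1" "x \<noteq> 0" for x :: complex
    using that by (simp add: K_def phi field_simps)
  have K0: "K x \<noteq> 0" if "x \<in> ball 0 (1 / R)" for x
  proof (cases "x = 0")
    case True
    then show ?thesis using c1_pos by (simp add: K_def)
  next
    case False
    have "cmod x < 1 / R" using that by simp
    then have "cmod x < 1" using R1(1) by linarith
    have "R < cmod (1 / x)" using \<open>cmod x < 1 / R\<close> False R1 by (simp add: norm_divide field_simps)
    then have "\<phi> (1 / x) \<noteq> \<phi> w" using eq_iff[of "1 / x" w] w by (auto simp: R_def)
    then show ?thesis using K False \<open>cmod x < 1\<close> by simp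
  qed
  obtain \<kappa> where \<kappa>: "\<kappa> holomorphic_on ball 0 (1 / R)" "\<And>x. x \<in> ball 0 (1 / R) \<Longrightarrow> K x = exp (\<kappa> x)"
    using contractible_imp_holomorphic_log[OF holK convex_imp_contractible[OF convex_ball] K0] by blast
  define b where "b k = (deriv ^^ k) \<kappa> 0 / fact k" for k
  have bs: "(\<lambda>k. b k * x ^ k) sums \<kappa> x" if "cmod x < 1 / R" for x
    using holomorphic_power_series[OF \<kappa>(1), of x] that by (simp add: b_def)
  have r0: "0 < r" using r w by linarith
  obtain s where s: "R < s" "s < r" using dense r R_def by blast
  have s0: "0 < s" using s R1 by linarith
  have sR: "1 / s < 1 / R" "1 / r < 1 / s"
    using s R1(2) s0 r0 by (auto intro!: divide_strict_left_mono)
  have "summable (\<lambda>k. b k * (1 / complex_of_real s) ^ k)"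
    by (rule sums_summable[OF bs]) (use sR s0 in \<open>simp add: norm_divide\<close>)
  then have sb: "summable (\<lambda>k. norm (b k * (1 / complex_of_real r) ^ k))"
    by (rule powser_insidea) (use sR s0 r0 in \<open>simp add: norm_divide\<close>)
  have rR: "1 / r < 1 / R" using sR by linarith
  define x where "x t = cis (- t) / r" for t
  have x: "cmod (x t) = 1 / r" "x t \<noteq> 0" "1 / x t = of_real r * cis t" for t
    using r0 by (simp_all add: x_def norm_divide) (simp add: divide_inverse cis_inverse mult.commute)
  have kx: "\<kappa> (x t) = (\<Sum>k. (b k * (1 / complex_of_real r) ^ k) * cis (- (real k * t)))" for t
  proof -
    have "b k * x t ^ k = (b k * (1 / complex_of_real r) ^ k) * cis (- (real k * t))" for k
      by (simp add: x_def power_divide Complex.DeMoivre)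
    then show ?thesis using sums_unique[OF bs[of "x t"]] x(1) rR by (simp only:)
  qed
  have "(LINT t|circle_measure. \<kappa> (x t)) = (\<Sum>k. (b k * (1 / complex_of_real r) ^ k) * (LINT t|circle_measure. cis (- (real k * t))))"
    unfolding kx by (rule integral_circle_suminf(1)[OF sb, of _ 1]) auto
  also have "\<dots> = (\<Sum>k. if k = 0 then b 0 else 0)"
  proof (rule suminf_cong)
    fix k
    have *: "real_of_int (- int k) * t = - (real k * t)" for t by simp
    show "(b k * (1 / complex_of_real r) ^ k) * (LINT t|circle_measure. cis (- (real k * t))) = (if k = 0 then b 0 else 0)"
      using integral_cis[of "- int k"] unfolding * by simp
  qed
  also have "\<dots> = \<kappa> 0" by (subst suminf_finite[of "{0}"]) (auto simp: b_def)
  finally have int: "(LINT t|circle_measure. \<kappa> (x t)) = \<kappa> 0" .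
  have kb: "cmod (\<kappa> (x t)) \<le> (\<Sum>k. norm (b k * (1 / complex_of_real r) ^ k))" for t
    unfolding kx using summable_norm[of "\<lambda>k. (b k * (1 / complex_of_real r) ^ k) * cis (- (real k * t))"] sb
    by (simp add: norm_mult)
  have "continuous_on UNIV (\<lambda>t. \<kappa> (x t))"
    by (rule continuous_on_compose2[OF holomorphic_on_imp_continuous_on[OF \<kappa>(1)]])
       (use x rR r0 in \<open>auto intro!: continuous_intros simp: x_def\<close>)
  then have "integrable circle_measure (\<lambda>t. \<kappa> (x t))"
    by (intro integrable_circle_bounded[OF _ kb] borel_measurable_continuous_onI)
  then have int2: "integrable circle_measure (\<lambda>t. Re (\<kappa> (x t)))" and
    int3: "(LINT t|circle_measure. Re (\<kappa> (x t))) = Re (\<kappa> 0)"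
    using int by auto
  have log: "ln (cmod (\<phi> (of_real r * cis t) - \<phi> w)) = Re (\<kappa> (x t)) + ln r" for t
  proof -
    have xr: "cmod (x t) < 1" using x(1)[of t] rR R1 by linarith
    have "exp (Re (\<kappa> (x t))) = cmod (K (x t))"
      using \<kappa>(2)[of "x t"] x(1)[of t] rR by simp
    also have "\<dots> = cmod (\<phi> (of_real r * cis t) - \<phi> w) / r"
      using K[OF xr x(2)] x(1,3)[of t] by (simp add: norm_mult)
    finally have "cmod (\<phi> (of_real r * cis t) - \<phi> w) = exp (Re (\<kappa> (x t))) * r" using r0 by simp
    then show ?thesis using r0 by (simp add: ln_mult)
  qed
  have "exp (Re (\<kappa> 0)) = cmod (K 0)" using \<kappa>(2)[of 0] R1 by simp
  then have "exp (Re (\<kappa> 0)) = c1" using c1_pos by (simp add: K_def)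
  then have "Re (\<kappa> 0) = ln c1" by (metis ln_exp)
  then show ?thesis unfolding log using int2 int3 by simp
qed

end

section \<open>Logarithmic capacity\<close>

lemma measurable_log_kernel [measurable]:
  "(\<lambda>p. log_kernel (fst p) (snd p)) \<in> borel_measurable (borel \<Otimes>\<^sub>M borel)"
  unfolding log_kernel_def by measurable

text \<open>With the value \<open>\<infinity>\<close> on the diagonal the kernel is jointly
  continuous into the extended reals, so Fatou's lemma can also be applied where the two limits
  coincide.\<close>

lemma log_kernel_tendsto:
  assumes "a \<longlonglongrightarrow> x" "b \<longlonglongrightarrow> y"
  shows "(\<lambda>j. log_kernel (a j) (b j)) \<longlonglongrightarrow> log_kernel x y"
proof -
  have d: "(\<lambda>j. dist (a j) (b j)) \<longlonglongrightarrow> dist x y" by (intro tendsto_dist assms)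
  show ?thesis
  proof (cases "x = y")
    case True
    have "(\<lambda>j. log_kernel (a j) (b j)) \<longlonglongrightarrow> \<infinity>"
      unfolding tendsto_PInfty
    proof
      fix r :: real
      have "\<forall>\<^sub>F j in sequentially. dist (a j) (b j) < exp (- r)"
        by (rule order_tendstoD(2)[OF d]) (simp add: True)
      then show "\<forall>\<^sub>F j in sequentially. ereal r < log_kernel (a j) (b j)"
      proof eventually_elim
        fix j assume *: "dist (a j) (b j) < exp (- r)"
        show "ereal r < log_kernel (a j) (b j)"
        proof (cases "a j = b j")
          case False
          then have "ln (dist (a j) (b j)) < ln (exp (- r))" using * by (subst ln_less_cancel_iff) auto
          then show ?thesis using False by (simp add: log_kernel_def ln_div)
        qed (simp add: log_kernel_def)
      qed
    qed
    then show ?thesis using True by (simp add: log_kernel_def)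
  next
    case False
    then have "0 < dist x y" by simp
    from order_tendstoD(1)[OF d this]
    have "\<forall>\<^sub>F j in sequentially. ereal (ln (1 / dist (a j) (b j))) = log_kernel (a j) (b j)"
      by eventually_elim (auto simp: log_kernel_def)
    moreover have "(\<lambda>j. ereal (ln (1 / dist (a j) (b j)))) \<longlonglongrightarrow> ereal (ln (1 / dist x y))"
      using False by (intro tendsto_intros d) auto
    ultimately have "(\<lambda>j. log_kernel (a j) (b j)) \<longlonglongrightarrow> ereal (ln (1 / dist x y))"
      by (rule Lim_transform_eventually[rotated])
    then show ?thesis using False by (simp add: log_kernel_def)
  qed
qed

lemma log_kernel_ge:
  assumes "cmod z \<le> R" "cmod w \<le> R"
  shows "ereal (- ln (2 * R)) \<le> log_kernel z w"
proof (cases "z = w")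
  case False
  then have "0 < dist z w" by simp
  moreover have "dist z w \<le> 2 * R"
    using norm_triangle_ineq4[of z w] assms by (simp add: dist_norm)
  ultimately have "ln (dist z w) \<le> ln (2 * R)" by (subst ln_le_cancel_iff) linarith+
  then show ?thesis using False by (simp add: log_kernel_def ln_div)
qed (simp add: log_kernel_def)

text \<open>Adding \<open>ln (2 R)\<close> makes the kernel nonnegative on the disk of radius \<open>R\<close>, so that the
  energy becomes a single nonnegative integral.\<close>
lemma log_energy_shift:
  assumes \<nu>: "prob_space \<nu>" "sets \<nu> = sets borel" and R: "AE z in \<nu>. cmod z \<le> R" "1 \<le> R"
  shows "log_energy \<nu> = enn2ereal (\<integral>\<^sup>+p. e2ennreal (log_kernel (fst p) (snd p) + ereal (ln (2 * R))) \<partial>(\<nu> \<Otimes>\<^sub>M \<nu>))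
      - ereal (ln (2 * R))"
proof -
  interpret prob_space \<nu> by fact
  interpret pair_prob_space \<nu> \<nu> by unfold_locales
  define L where "L = ln (2 * R)"
  have L: "0 \<le> L" using R(2) by (simp add: L_def)
  have sets[measurable_cong]: "sets (\<nu> \<Otimes>\<^sub>M \<nu>) = sets (borel \<Otimes>\<^sub>M borel)"
    by (rule sets_pair_measure_cong) (simp_all add: \<nu>)
  have [measurable]: "(\<lambda>p. log_kernel (fst p) (snd p)) \<in> borel_measurable (\<nu> \<Otimes>\<^sub>M \<nu>)"
    using measurable_log_kernel by (simp only: measurable_cong_sets[OF sets refl])
  have "AE p in \<nu> \<Otimes>\<^sub>M \<nu>. cmod (fst p) \<le> R \<and> cmod (snd p) \<le> R"
  proof (rule AE_pair_measure)
    show "{p \<in> space (\<nu> \<Otimes>\<^sub>M \<nu>). cmod (fst p) \<le> R \<and> cmod (snd p) \<le> R} \<in> sets (\<nu> \<Otimes>\<^sub>M \<nu>)"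
      by measurable
    show "AE x in \<nu>. AE y in \<nu>. cmod (fst (x, y)) \<le> R \<and> cmod (snd (x, y)) \<le> R"
      using R(1) by (auto elim!: eventually_mono)
  qed
  then have ge: "AE p in \<nu> \<Otimes>\<^sub>M \<nu>. ereal (- L) \<le> log_kernel (fst p) (snd p)"
    by eventually_elim (auto simp: L_def intro!: log_kernel_ge)
  let ?P = "\<integral>\<^sup>+p. e2ennreal (log_kernel (fst p) (snd p)) \<partial>(\<nu> \<Otimes>\<^sub>M \<nu>)"
  let ?N = "\<integral>\<^sup>+p. e2ennreal (- log_kernel (fst p) (snd p)) \<partial>(\<nu> \<Otimes>\<^sub>M \<nu>)"
  let ?I = "\<integral>\<^sup>+p. e2ennreal (log_kernel (fst p) (snd p) + ereal L) \<partial>(\<nu> \<Otimes>\<^sub>M \<nu>)"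
  \<comment> \<open>Positive and negative parts are compared by an identity of sums, which stays
    meaningful when \<open>k\<close> is infinite. Subtraction happens only after the negative part
    is known to have finite integral.\<close>
  have pt: "e2ennreal (k + ereal L) + e2ennreal (- k) = e2ennreal k + ennreal L" if k: "ereal (- L) \<le> k" for k
  proof (cases k)
    case (real x)
    show ?thesis
    proof (cases "0 \<le> x")
      case True
      then show ?thesis using real L by (simp add: ennreal_neg ennreal_plus)
    next
      case False
      then have "ennreal (x + L) + ennreal (- x) = ennreal L"
        using k real by (subst ennreal_plus[symmetric]) auto
      then show ?thesis using real False by (simp add: ennreal_neg)
    qed
  qed (use k in auto)
  have one: "emeasure (\<nu> \<Otimes>\<^sub>M \<nu>) (space (\<nu> \<Otimes>\<^sub>M \<nu>)) = 1" by (rule P.emeasure_space_1)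
  have "?I + ?N = (\<integral>\<^sup>+p. e2ennreal (log_kernel (fst p) (snd p) + ereal L) + e2ennreal (- log_kernel (fst p) (snd p)) \<partial>(\<nu> \<Otimes>\<^sub>M \<nu>))"
    by (rule nn_integral_add[symmetric]) measurable
  also have "\<dots> = (\<integral>\<^sup>+p. e2ennreal (log_kernel (fst p) (snd p)) + ennreal L \<partial>(\<nu> \<Otimes>\<^sub>M \<nu>))"
    by (rule nn_integral_cong_AE) (use ge in eventually_elim, rule pt)
  also have "\<dots> = ?P + (\<integral>\<^sup>+p. ennreal L \<partial>(\<nu> \<Otimes>\<^sub>M \<nu>))"
    by (rule nn_integral_add) measurable
  also have "(\<integral>\<^sup>+p. ennreal L \<partial>(\<nu> \<Otimes>\<^sub>M \<nu>)) = ennreal L" by (simp add: one)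
  finally have sum: "?I + ?N = ?P + ennreal L" .
  have "?N \<le> (\<integral>\<^sup>+p. ennreal L \<partial>(\<nu> \<Otimes>\<^sub>M \<nu>))"
  proof (rule nn_integral_mono_AE)
    show "AE p in \<nu> \<Otimes>\<^sub>M \<nu>. e2ennreal (- log_kernel (fst p) (snd p)) \<le> ennreal L"
      using ge
    proof eventually_elim
      fix p :: "complex \<times> complex" assume "ereal (- L) \<le> log_kernel (fst p) (snd p)"
      then have "- log_kernel (fst p) (snd p) \<le> ereal L" by (metis ereal_uminus_le_reorder uminus_ereal.simps(1))
      then show "e2ennreal (- log_kernel (fst p) (snd p)) \<le> ennreal L" by (metis e2ennreal_mono e2ennreal_ereal)
    qed
  qed
  then have N: "?N \<le> ennreal L" by (simp add: one)
  obtain n where n: "?N = ennreal n" "0 \<le> n" using N by (cases ?N) (auto simp: top_unique)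
  have "enn2ereal ?P - enn2ereal ?N = enn2ereal ?I - ereal L"
  proof (cases ?P)
    case (real p)
    then have "?I \<noteq> top" using sum n L by (auto simp: ennreal_plus[symmetric] simp del: ennreal_plus)
    then obtain i where i: "?I = ennreal i" "0 \<le> i" by (cases ?I) auto
    have "i + n = p + L"
      using sum real i n L by (simp add: ennreal_plus[symmetric] del: ennreal_plus)
    then show ?thesis using real i n by (simp add: enn2ereal_ennreal)
  next
    case top
    then have "?I = top" using sum n by (auto simp: ennreal_add_eq_top)
    then show ?thesis using top n by (simp add: enn2ereal_ennreal)
  qed
  then show ?thesis by (simp add: log_energy_def L_def)
qed

text \<open>This excludes the value \<open>-\<infinity>\<close>, which \<open>real_of_ereal\<close>
  would turn into 0 in \<open>log_capacity\<close>.\<close>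

lemma robin_constant_ge:
  assumes "compact K" obtains L :: real where "ereal L \<le> robin_constant K"
proof -
  obtain R0 where "\<And>z. z \<in> K \<Longrightarrow> cmod z \<le> R0"
    using compact_imp_bounded[OF assms] by (auto simp: bounded_iff)
  then have R0: "\<And>z. z \<in> K \<Longrightarrow> cmod z \<le> max 1 R0" by (auto simp: le_max_iff_disj)
  have "ereal (- ln (2 * max 1 R0)) \<le> robin_constant K"
    unfolding robin_constant_def
  proof (rule INF_greatest)
    fix \<nu> :: "complex measure"
    assume \<nu>: "\<nu> \<in> {\<nu>. prob_space \<nu> \<and> sets \<nu> = sets borel \<and> (AE z in \<nu>. z \<in> K)}"
    then have "AE z in \<nu>. cmod z \<le> max 1 R0" using R0 by (auto elim!: eventually_mono)
    then have "log_energy \<nu> = enn2ereal (\<integral>\<^sup>+p. e2ennreal (log_kernel (fst p) (snd p) + ereal (ln (2 * max 1 R0))) \<partial>(\<nu> \<Otimes>\<^sub>M \<nu>))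
        - ereal (ln (2 * max 1 R0))"
      using \<nu> by (intro log_energy_shift) auto
    also have "\<dots> \<ge> 0 - ereal (ln (2 * max 1 R0))"
      by (rule ereal_minus_mono) auto
    finally show "ereal (- ln (2 * max 1 R0)) \<le> log_energy \<nu>" by simp
  qed
  then show ?thesis by (rule that)
qed

context exterior_map
begin

text \<open>The energy of \<open>\<nu>\<close> is approximated with two different radii,
  \<open>r j\<close> in the first variable and \<open>r (Suc j)\<close> in the second. The kernel
  then stays off its singularity, and \<open>mean_log_circle\<close> evaluates the inner integral
  exactly. Fatou's lemma along almost sure convergence bounds the energy by the limit.\<close>

lemma log_capacity_ge:
  assumes \<Gamma>: "compact \<Gamma>"
  shows "c1 \<le> log_capacity \<Gamma>"
proof -
  obtain r where r: "\<And>j. 1 < r j" "\<And>j. r (Suc j) < r j" "\<And>j. r j < 2" "r \<longlonglongrightarrow> (1::real)"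
    "AE t in circle_measure. convergent (\<lambda>j. \<phi> (of_real (r j) * cis t))"
    using AE_boundary_values by blast
  define a where "a j t = \<phi> (of_real (r j) * cis t)" for j t
  define \<Phi> where "\<Phi> t = lim (\<lambda>j. a j t)" for t
  have [measurable]: "a j \<in> borel_measurable borel" for j
    unfolding a_def by (rule measurable_circle[OF r(1)])
  have [measurable]: "\<Phi> \<in> borel_measurable borel" unfolding \<Phi>_def by measurable
  have lim: "AE t in circle_measure. (\<lambda>j. a j t) \<longlonglongrightarrow> \<Phi> t"
    using r(5) by eventually_elim (simp add: a_def \<Phi>_def convergent_LIMSEQ_iff)
  have \<Phi>: "AE t in circle_measure. \<Phi> t \<in> \<Gamma>"
    using lim by eventually_elim (unfold a_def, rule boundary_limit_in[OF r(1,4)])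
  obtain R1 where R1: "\<And>z. 1 < cmod z \<Longrightarrow> cmod z < 2 \<Longrightarrow> cmod (\<phi> z) \<le> R1"
    using bounded_annulus[of 2] by auto
  obtain R2 where R2: "\<And>z. z \<in> \<Gamma> \<Longrightarrow> cmod z \<le> R2"
    using compact_imp_bounded[OF \<Gamma>] by (auto simp: bounded_iff)
  define R where "R = max 1 (max R1 R2)"
  define L where "L = ln (2 * R)"
  have R: "1 \<le> R" by (simp add: R_def)
  have aR: "cmod (a j t) \<le> R" for j t
    using R1[of "of_real (r j) * cis t"] r(1)[of j] r(3)[of j] by (simp add: a_def R_def norm_mult le_max_iff_disj)
  define K where "K p = e2ennreal (log_kernel (fst p) (snd p) + ereal L)" for p
  have K_meas [measurable]: "K \<in> borel_measurable (borel \<Otimes>\<^sub>M borel)" unfolding K_def by measurable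
  have [measurable]: "(\<lambda>p. K (a i (fst p), a j (snd p))) \<in> borel_measurable (circle_measure \<Otimes>\<^sub>M circle_measure)" for i j
    by (rule measurable_compose[OF _ K_meas]) measurable
  define \<nu> where "\<nu> = distr circle_measure borel \<Phi>"
  have \<nu>: "prob_space \<nu>" "sets \<nu> = sets borel"
    unfolding \<nu>_def by (auto intro!: circ.prob_space_distr)
  interpret \<nu>: prob_space \<nu> by fact
  interpret cc: pair_prob_space circle_measure circle_measure by unfold_locales
  have \<nu>\<Gamma>: "AE z in \<nu>. z \<in> \<Gamma>"
    unfolding \<nu>_def using \<Phi> compact_imp_closed[OF \<Gamma>] by (subst AE_distr_iff) auto
  have \<nu>R: "AE z in \<nu>. cmod z \<le> R"
    using \<nu>\<Gamma> by eventually_elim (use R2 in \<open>auto simp: R_def le_max_iff_disj\<close>)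
  \<comment> \<open>The point \<open>w\<close> is on the smaller circle, so the integrand is
    continuous on the larger one. Nonnegativity of the value is recorded because
    \<open>ennreal\<close> truncates negative numbers to 0.\<close>
  have inner: "(\<integral>\<^sup>+x. K (a j x, a (Suc j) y) \<partial>circle_measure) = ennreal (L - ln c1 - ln (r j)) \<and> 0 \<le> L - ln c1 - ln (r j)" for j y
  proof -
    define w where "w = of_real (r (Suc j)) * cis y"
    have w: "1 < cmod w" "cmod w < r j" using r(1)[of "Suc j"] r(2)[of j] by (simp_all add: w_def norm_mult)
    have ne: "\<phi> z \<noteq> \<phi> w" if "cmod z = r j" for z
      using eq_iff[of z w] that w by auto
    define l where "l z = L - ln (cmod (\<phi> z - \<phi> w))" for z
    have cl: "continuous_on (sphere 0 (r j)) l"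
      unfolding l_def using w ne
      by (intro continuous_intros continuous_on_subset[OF cont]) auto
    then have "compact (l ` sphere 0 (r j))" by (intro compact_continuous_image) auto
    then obtain B where B: "\<And>z. cmod z = r j \<Longrightarrow> norm (l z) \<le> B"
      by (force dest!: compact_imp_bounded simp: bounded_iff)
    have s: "cmod (of_real (r j) * cis x) = r j" for x using r(1)[of j] by (simp add: norm_mult)
    have l0: "0 \<le> l (of_real (r j) * cis x)" for x
    proof -
      have "ereal (- ln (2 * R)) \<le> log_kernel (a j x) (a (Suc j) y)"
        by (rule log_kernel_ge[OF aR aR])
      then show ?thesis using ne[OF s] by (simp add: log_kernel_def a_def w_def[symmetric] l_def L_def dist_norm ln_div)
    qed
    have Kl: "K (a j x, a (Suc j) y) = ennreal (l (of_real (r j) * cis x))" for x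
      using ne[OF s, of x] by (simp add: K_def log_kernel_def a_def w_def[symmetric] l_def dist_norm ln_div)
    have i: "integrable circle_measure (\<lambda>x. l (of_real (r j) * cis x))"
    proof (rule integrable_circle_bounded)
      show "norm (l (of_real (r j) * cis x)) \<le> B" for x by (rule B[OF s])
      show "(\<lambda>x. l (of_real (r j) * cis x)) \<in> borel_measurable borel"
        by (intro borel_measurable_continuous_onI continuous_on_compose2[OF cl] continuous_intros) (auto simp: s)
    qed
    have "(\<integral>\<^sup>+x. K (a j x, a (Suc j) y) \<partial>circle_measure) = ennreal (LINT x|circle_measure. l (of_real (r j) * cis x))"
      unfolding Kl by (rule nn_integral_eq_integral[OF i]) (simp add: l0)
    moreover have "(LINT x|circle_measure. l (of_real (r j) * cis x)) = L - ln c1 - ln (r j)"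
    proof -
      have "integrable circle_measure (\<lambda>x. L - l (of_real (r j) * cis x))" using i by simp
      then have i2: "integrable circle_measure (\<lambda>x. ln (cmod (\<phi> (of_real (r j) * cis x) - \<phi> w)))"
        by (simp add: l_def)
      show ?thesis unfolding l_def
        by (subst Bochner_Integration.integral_diff[OF _ i2]) (simp_all add: mean_log_circle[OF w])
    qed
    moreover have "0 \<le> (LINT x|circle_measure. l (of_real (r j) * cis x))"
      by (rule Bochner_Integration.integral_nonneg) (rule l0)
    ultimately show ?thesis by simp
  qed
  have step: "(\<integral>\<^sup>+p. K (a j (fst p), a (Suc j) (snd p)) \<partial>(circle_measure \<Otimes>\<^sub>M circle_measure)) = ennreal (L - ln c1 - ln (r j))" for j
  proof -
    have "(\<integral>\<^sup>+p. K (a j (fst p), a (Suc j) (snd p)) \<partial>(circle_measure \<Otimes>\<^sub>M circle_measure))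
        = (\<integral>\<^sup>+y. (\<integral>\<^sup>+x. K (a j x, a (Suc j) y) \<partial>circle_measure) \<partial>circle_measure)"
      by (subst cc.nn_integral_snd[symmetric]) simp_all
    also have "\<dots> = (\<integral>\<^sup>+y. ennreal (L - ln c1 - ln (r j)) \<partial>circle_measure)"
      by (rule nn_integral_cong) (use inner in blast)
    also have "\<dots> = ennreal (L - ln c1 - ln (r j))"
      using circ.emeasure_space_1 by simp
    finally show ?thesis .
  qed
  have "(\<integral>\<^sup>+p. K p \<partial>(\<nu> \<Otimes>\<^sub>M \<nu>)) = (\<integral>\<^sup>+p. K (\<Phi> (fst p), \<Phi> (snd p)) \<partial>(circle_measure \<Otimes>\<^sub>M circle_measure))"
  proof -
    have "\<nu> \<Otimes>\<^sub>M \<nu> = distr (circle_measure \<Otimes>\<^sub>M circle_measure) (borel \<Otimes>\<^sub>M borel) (\<lambda>(x, y). (\<Phi> x, \<Phi> y))"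
      unfolding \<nu>_def
      by (rule pair_measure_distr) (auto simp: \<nu>_def[symmetric] intro: \<nu>.sigma_finite_measure_axioms)
    then show ?thesis
      by (simp only:, subst nn_integral_distr) (auto simp: case_prod_beta')
  qed
  also have "\<dots> \<le> (\<integral>\<^sup>+p. liminf (\<lambda>j. K (a j (fst p), a (Suc j) (snd p))) \<partial>(circle_measure \<Otimes>\<^sub>M circle_measure))"
  proof (rule nn_integral_mono_AE)
    have "AE p in circle_measure \<Otimes>\<^sub>M circle_measure. (\<lambda>j. a j (fst p)) \<longlonglongrightarrow> \<Phi> (fst p) \<and> (\<lambda>j. a j (snd p)) \<longlonglongrightarrow> \<Phi> (snd p)"
    proof (rule cc.AE_pair_measure)
      show "AE x in circle_measure. AE y in circle_measure. (\<lambda>j. a j (fst (x, y))) \<longlonglongrightarrow> \<Phi> (fst (x, y)) \<and> (\<lambda>j. a j (snd (x, y))) \<longlonglongrightarrow> \<Phi> (snd (x, y))"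
        using lim by (auto elim!: eventually_mono)
      \<comment> \<open>Since \<open>\<Phi>\<close> is defined by \<open>lim\<close>, convergence to
        it is the Cauchy property, and this form makes the set visibly measurable.\<close>
      have conv: "(\<lambda>j. a j t) \<longlonglongrightarrow> \<Phi> t \<longleftrightarrow> Cauchy (\<lambda>j. a j t)" for t
        by (simp add: \<Phi>_def Cauchy_convergent_iff convergent_LIMSEQ_iff)
      show "{p \<in> space (circle_measure \<Otimes>\<^sub>M circle_measure). (\<lambda>j. a j (fst p)) \<longlonglongrightarrow> \<Phi> (fst p) \<and> (\<lambda>j. a j (snd p)) \<longlonglongrightarrow> \<Phi> (snd p)}
          \<in> sets (circle_measure \<Otimes>\<^sub>M circle_measure)"
        unfolding conv by (intro sets.sets_Collect_conj sets_Collect_Cauchy) measurable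
    qed
    then show "AE p in circle_measure \<Otimes>\<^sub>M circle_measure. K (\<Phi> (fst p), \<Phi> (snd p)) \<le> liminf (\<lambda>j. K (a j (fst p), a (Suc j) (snd p)))"
    proof eventually_elim
      fix p assume "(\<lambda>j. a j (fst p)) \<longlonglongrightarrow> \<Phi> (fst p) \<and> (\<lambda>j. a j (snd p)) \<longlonglongrightarrow> \<Phi> (snd p)"
      then have "(\<lambda>j. log_kernel (a j (fst p)) (a (Suc j) (snd p))) \<longlonglongrightarrow> log_kernel (\<Phi> (fst p)) (\<Phi> (snd p))"
        by (intro log_kernel_tendsto LIMSEQ_Suc) auto
      then have "(\<lambda>j. K (a j (fst p), a (Suc j) (snd p))) \<longlonglongrightarrow> K (\<Phi> (fst p), \<Phi> (snd p))"
        unfolding K_def fst_conv snd_conv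
        by (intro tendsto_e2ennrealI tendsto_cadd_ereal) (simp_all add: log_kernel_def)
      from lim_imp_Liminf[OF _ this]
      show "K (\<Phi> (fst p), \<Phi> (snd p)) \<le> liminf (\<lambda>j. K (a j (fst p), a (Suc j) (snd p)))" by simp
    qed
  qed
  also have "\<dots> \<le> liminf (\<lambda>j. \<integral>\<^sup>+p. K (a j (fst p), a (Suc j) (snd p)) \<partial>(circle_measure \<Otimes>\<^sub>M circle_measure))"
    by (rule nn_integral_liminf) measurable
  also have "\<dots> = liminf (\<lambda>j. ennreal (L - ln c1 - ln (r j)))" by (simp only: step)
  also have "\<dots> = ennreal (L - ln c1 - ln 1)"
    by (rule lim_imp_Liminf[OF sequentially_bot tendsto_ennrealI[OF tendsto_diff[OF tendsto_const tendsto_ln[OF r(4)]]]]) simp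
  finally have I: "(\<integral>\<^sup>+p. K p \<partial>(\<nu> \<Otimes>\<^sub>M \<nu>)) \<le> ennreal (L - ln c1)" by simp
  have "0 \<le> L - ln c1"
    using inner[of 0 0] ln_ge_zero[of "r 0"] r(1)[of 0] by linarith
  with I have I2: "enn2ereal (\<integral>\<^sup>+p. K p \<partial>(\<nu> \<Otimes>\<^sub>M \<nu>)) \<le> ereal (L - ln c1)"
    by (metis enn2ereal_ennreal less_eq_ennreal.rep_eq)
  have "robin_constant \<Gamma> \<le> log_energy \<nu>"
    unfolding robin_constant_def by (rule INF_lower) (use \<nu> \<nu>\<Gamma> in simp)
  also have "\<dots> = enn2ereal (\<integral>\<^sup>+p. K p \<partial>(\<nu> \<Otimes>\<^sub>M \<nu>)) - ereal L"
    unfolding L_def K_def by (rule log_energy_shift[OF \<nu> \<nu>R R])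
  also have "\<dots> \<le> ereal (L - ln c1) - ereal L" by (rule ereal_minus_mono[OF I2 order_refl])
  finally have le: "robin_constant \<Gamma> \<le> ereal (- ln c1)" by simp
  obtain m :: real where m: "ereal m \<le> robin_constant \<Gamma>" using robin_constant_ge[OF \<Gamma>] by blast
  obtain x where x: "robin_constant \<Gamma> = ereal x" using le m by (cases "robin_constant \<Gamma>") auto
  then have "ln c1 \<le> - x" using le by simp
  then have "exp (ln c1) \<le> exp (- x)" by simp
  then show ?thesis using x c1_pos by (simp add: log_capacity_def)
qed

end

section \<open>Boundary values and coefficients\<close>

lemma connected_exterior: "connected {z::complex. 1 < cmod z}"
proof -
  have "{z::complex. 1 < cmod z} = - cball 0 1" by auto
  then show ?thesis using connected_complement_bounded_convex[of "cball 0 1 :: complex set"] by simp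
qed

context exterior_map
begin

text \<open>Read contrapositively: if \<open>\<phi> z\<close> is within \<open>e\<close> of
  \<open>\<Gamma>\<close>, then \<open>cmod z < \<rho>\<close>. So the inverse of
  \<open>\<phi>\<close> has modulus near 1 close to \<open>\<Gamma>\<close>. A compact annulus has
  positive distance from \<open>\<Gamma>\<close>; beyond \<open>R'\<close> the linear term alone
  keeps \<open>\<phi> z\<close> at distance at least 1.\<close>

lemma image_far_from_boundary:
  assumes \<Gamma>: "compact \<Gamma>" and \<rho>: "1 < \<rho>"
  obtains e where "0 < e" "\<And>z y. \<rho> \<le> cmod z \<Longrightarrow> y \<in> \<Gamma> \<Longrightarrow> e \<le> dist (\<phi> z) y"
proof -
  obtain M where M: "0 \<le> M" "\<And>z. 1 < cmod z \<Longrightarrow> cmod (\<phi> z - of_real c1 * z) \<le> M"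
    using remainder_bounded by blast
  obtain R where R: "\<And>y. y \<in> \<Gamma> \<Longrightarrow> cmod y \<le> R"
    using compact_imp_bounded[OF \<Gamma>] by (auto simp: bounded_iff)
  define R' where "R' = (R + M + 1) / c1"
  have "compact (cball 0 R' - ball 0 \<rho> :: complex set)" by (intro compact_diff) auto
  then have "compact (\<phi> ` (cball 0 R' - ball 0 \<rho>))"
    using \<rho> by (intro compact_continuous_image continuous_on_subset[OF cont]) auto
  moreover have "\<phi> ` (cball 0 R' - ball 0 \<rho>) \<inter> \<Gamma> = {}" using not_in \<rho> by auto
  ultimately obtain e where e: "e > 0" "\<And>x y. x \<in> \<phi> ` (cball 0 R' - ball 0 \<rho>) \<Longrightarrow> y \<in> \<Gamma> \<Longrightarrow> e \<le> dist x y"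
    using separate_compact_closed compact_imp_closed[OF \<Gamma>] by metis
  show ?thesis
  proof (rule that[of "min e 1"])
    fix z y assume z: "\<rho> \<le> cmod z" and y: "y \<in> \<Gamma>"
    show "min e 1 \<le> dist (\<phi> z) y"
    proof (cases "cmod z \<le> R'")
      case True
      then have "e \<le> dist (\<phi> z) y" using z by (intro e(2) y) auto
      then show ?thesis by simp
    next
      case False
      then have "R + M + 1 < c1 * cmod z" using c1_pos by (simp add: R'_def field_simps)
      moreover have "cmod (of_real c1 * z) \<le> cmod (\<phi> z) + cmod (\<phi> z - of_real c1 * z)"
        using norm_triangle_ineq4[of "\<phi> z" "\<phi> z - of_real c1 * z"] by simp
      moreover have "cmod (of_real c1 * z) = c1 * cmod z" using c1_pos by (simp add: norm_mult)
      moreover have "cmod (\<phi> z - of_real c1 * z) \<le> M" using M(2)[of z] z \<rho> by simp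
      moreover have "cmod (\<phi> z) - cmod y \<le> dist (\<phi> z) y" using norm_triangle_ineq2[of "\<phi> z" y] by (simp add: dist_norm)
      ultimately have "1 \<le> dist (\<phi> z) y" using R[OF y] by linarith
      then show ?thesis by simp
    qed
  qed (use e in simp)
qed

text \<open>A Schwarz lemma at infinity: \<open>H x = x \<psi>(F(1/x))\<close>, with \<open>\<psi>\<close> the inverse of \<open>\<phi>\<close>, is holomorphic
  where \<open>F(1/x)\<close> avoids \<open>\<Gamma>\<close> and has boundary values of modulus at most 1, while \<open>H 0 = D / c1 \<ge> 1\<close>.
  Hence \<open>H\<close> is the constant 1 near 0.\<close>
lemma eq_of_boundary_values:
  fixes F :: "complex \<Rightarrow> complex" and b :: "nat \<Rightarrow> complex"
  assumes \<Gamma>: "compact \<Gamma>" and D: "c1 \<le> D"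
    and F: "\<And>z. 1 < cmod z \<Longrightarrow> (\<lambda>k. b k / z ^ k) sums (F z - of_real D * z)"
    and bd: "\<And>e. 0 < e \<Longrightarrow> \<exists>r>1. \<forall>z. 1 < cmod z \<and> cmod z < r \<longrightarrow> (\<exists>y\<in>\<Gamma>. dist (F z) y < e)"
    and z: "1 < cmod z"
  shows "F z = \<phi> z"
proof -
  obtain \<psi> where hol\<psi>: "\<psi> holomorphic_on - \<Gamma>" and inv: "\<And>z. 1 < cmod z \<Longrightarrow> \<psi> (\<phi> z) = z"
    using holomorphic_has_inverse[OF hol open_exterior inj] unfolding image by (metis mem_Collect_eq)
  have \<psi>: "1 < cmod (\<psi> w)" "\<phi> (\<psi> w) = w" if "w \<notin> \<Gamma>" for w
  proof -
    have "w \<in> \<phi> ` {z. 1 < cmod z}" using that by (simp add: image)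
    then obtain z where "1 < cmod z" "w = \<phi> z" by auto
    then show "1 < cmod (\<psi> w)" "\<phi> (\<psi> w) = w" using inv by auto
  qed
  define S where "S x = (\<Sum>k. b k * x ^ k)" for x :: complex
  define G where "G x = of_real D / x + S x" for x :: complex
  have sumsS: "(\<lambda>k. b k * x ^ k) sums S x" if "cmod x < 1" for x :: complex
  proof (cases "x = 0")
    case True
    then show ?thesis by (simp add: S_def)
  next
    case False
    then have "1 < cmod (1 / x)" using that by (simp add: norm_divide)
    from sums_summable[OF F[OF this]] show ?thesis
      unfolding S_def by (intro summable_sums) (simp add: power_divide)
  qed
  have FG: "F (1 / x) = G x" if "cmod x < 1" "x \<noteq> 0" for x :: complex
  proof -
    have "1 < cmod (1 / x)" using that by (simp add: norm_divide)
    from F[OF this] have "(\<lambda>k. b k * x ^ k) sums (F (1 / x) - of_real D / x)" by (simp add: power_divide)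
    with sumsS[OF that(1)] have "S x = F (1 / x) - of_real D / x" by (rule sums_unique2)
    then show ?thesis by (simp add: G_def)
  qed
  have holS: "S holomorphic_on ball 0 1"
    by (rule power_series_holomorphic[of 0 1 b]) (use sumsS in simp)
  have holG: "G holomorphic_on ball 0 1 - {0}"
    unfolding G_def by (intro holomorphic_intros holomorphic_on_subset[OF holS]) auto
  have opB: "open (ball (0::complex) 1 - {0})" by (intro open_Diff) auto
  have contG: "continuous_on (ball 0 1 - {0}) G" by (rule holomorphic_on_imp_continuous_on[OF holG])
  have limS: "(S \<longlongrightarrow> S 0) (at 0)"
    using holomorphic_on_imp_continuous_on[OF holS]
    by (simp add: continuous_on_eq_continuous_at isCont_def)
  have xG: "((\<lambda>x. of_real D + x * S x) \<longlongrightarrow> of_real D) (at 0)"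
    by (rule tendsto_eq_intros limS refl | simp)+
  have D0: "0 < D" using D c1_pos by simp
  obtain R where R: "0 < R" "\<And>y. y \<in> \<Gamma> \<Longrightarrow> cmod y \<le> R"
    using compact_imp_bounded[OF \<Gamma>] by (meson bounded_pos)
  \<comment> \<open>\<open>x * G x\<close> tends to \<open>D > 0\<close> while
    \<open>R * cmod x\<close> tends to 0, so near 0 the values of \<open>G\<close> leave the disk
    containing \<open>\<Gamma>\<close>.\<close>
  obtain \<rho> where \<rho>: "0 < \<rho>" "\<rho> \<le> 1" "\<And>x. x \<noteq> 0 \<Longrightarrow> cmod x < \<rho> \<Longrightarrow> G x \<notin> \<Gamma>"
  proof -
    have "((\<lambda>x. cmod (of_real D + x * S x) - R * cmod x) \<longlongrightarrow> cmod (of_real D) - R * cmod 0) (at (0::complex))"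
      by (intro tendsto_intros xG)
    then have "\<forall>\<^sub>F x in at (0::complex). 0 < cmod (of_real D + x * S x) - R * cmod x"
      by (rule order_tendstoD(1)) (use D0 in simp)
    then obtain d where d: "d > 0" "\<And>x. x \<noteq> 0 \<Longrightarrow> cmod x < d \<Longrightarrow> R * cmod x < cmod (of_real D + x * S x)"
      by (auto simp: eventually_at dist_norm)
    show ?thesis
    proof (rule that[of "min d 1"])
      fix x :: complex assume x: "x \<noteq> 0" "cmod x < min d 1"
      have "R * cmod x < cmod (x * G x)" using d(2)[OF x(1)] x by (simp add: G_def distrib_left)
      then have "R < cmod (G x)" using x by (simp add: norm_mult mult.commute[of R])
      then show "G x \<notin> \<Gamma>" using R(2) by force
    qed (use d in auto)
  qed
  define \<Omega> where "\<Omega> = {x \<in> ball 0 1. x = 0 \<or> G x \<notin> \<Gamma>}"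
  have \<Omega>0: "\<Omega> - {0} = (ball 0 1 - {0}) \<inter> G -` (- \<Gamma>)" by (auto simp: \<Omega>_def)
  have op\<Omega>0: "open (\<Omega> - {0})"
    unfolding \<Omega>0 using compact_imp_closed[OF \<Gamma>] by (intro continuous_open_preimage contG opB) auto
  have \<rho>\<Omega>: "ball 0 \<rho> \<subseteq> \<Omega>" using \<rho> by (auto simp: \<Omega>_def)
  have "\<Omega> = (\<Omega> - {0}) \<union> ball 0 \<rho>" using \<rho>\<Omega> \<rho>(1) by auto
  then have op\<Omega>: "open \<Omega>" by (metis op\<Omega>0 open_Un open_ball)
  \<comment> \<open>The value at 0 comes from \<open>G x\<close> being asymptotic to
    \<open>D / x\<close> and \<open>\<psi> w\<close> to \<open>w / c1\<close>.\<close>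
  define H where "H x = (if x = 0 then of_real (D / c1) else x * \<psi> (G x))" for x
  have "(\<lambda>x. x * \<psi> (G x)) holomorphic_on \<Omega> - {0}"
  proof -
    have "(\<psi> \<circ> G) holomorphic_on \<Omega> - {0}"
      by (rule holomorphic_on_compose_gen[OF holomorphic_on_subset[OF holG] hol\<psi>]) (auto simp: \<Omega>_def)
    then show ?thesis unfolding o_def by (intro holomorphic_intros)
  qed
  then have holH0: "H holomorphic_on \<Omega> - {0}"
    by (rule holomorphic_transform) (auto simp: H_def)
  obtain M where M: "0 \<le> M" "\<And>z. 1 < cmod z \<Longrightarrow> cmod (\<phi> z - of_real c1 * z) \<le> M"
    using remainder_bounded by blast
  have "(H \<longlongrightarrow> H 0) (at 0)"
  proof -
    \<comment> \<open>The bound \<open>M\<close> for \<open>\<phi> z - c1 z\<close>, taken at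
      \<open>z = \<psi> (G x)\<close>, takes the place of an expansion of \<open>\<psi>\<close> at
      infinity.\<close>
    have "((\<lambda>x. of_real c1 * H x - (of_real D + x * S x)) \<longlongrightarrow> 0) (at 0)"
    proof (rule Lim_null_comparison)
      have "\<forall>\<^sub>F x in at (0::complex). x \<noteq> 0 \<and> cmod x < \<rho>"
        using \<rho>(1) by (auto simp: eventually_at dist_norm)
      then show "\<forall>\<^sub>F x in at 0. cmod (of_real c1 * H x - (of_real D + x * S x)) \<le> M * cmod x"
      proof eventually_elim
        fix x :: complex assume x: "x \<noteq> 0 \<and> cmod x < \<rho>"
        then have w: "G x \<notin> \<Gamma>" using \<rho> by blast
        have "of_real D + x * S x = x * G x" using x by (simp add: G_def distrib_left)
        then have "of_real c1 * H x - (of_real D + x * S x) = - x * (\<phi> (\<psi> (G x)) - of_real c1 * \<psi> (G x))"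
          using x by (simp add: H_def \<psi>(2)[OF w] algebra_simps)
        then have "cmod (of_real c1 * H x - (of_real D + x * S x)) = cmod x * cmod (\<phi> (\<psi> (G x)) - of_real c1 * \<psi> (G x))"
          by (simp only: norm_mult norm_minus_cancel)
        also have "\<dots> \<le> cmod x * M" by (intro mult_left_mono M(2) \<psi>(1)[OF w]) simp
        finally show "cmod (of_real c1 * H x - (of_real D + x * S x)) \<le> M * cmod x" by (simp add: mult.commute)
      qed
      show "((\<lambda>x. M * cmod x) \<longlongrightarrow> 0) (at (0::complex))"
        by (rule tendsto_eq_intros refl | simp)+
    qed
    then have "((\<lambda>x. ((of_real c1 * H x - (of_real D + x * S x)) + (of_real D + x * S x)) / of_real c1) \<longlongrightarrow> (0 + of_real D) / of_real c1) (at 0)"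
      using c1_pos by (intro tendsto_divide tendsto_add xG tendsto_const) auto
    then have "(H \<longlongrightarrow> of_real D / of_real c1) (at 0)" using c1_pos by simp
    moreover have "H 0 = of_real D / of_real c1" by (simp add: H_def)
    ultimately show ?thesis by simp
  qed
  then have holH: "H holomorphic_on \<Omega>"
    using \<rho>\<Omega> by (intro no_isolated_singularity'[OF _ holH0 op\<Omega>]) (auto intro: tendsto_within_subset)
  have contH: "continuous_on \<Omega> H" by (rule holomorphic_on_imp_continuous_on[OF holH])
  have H1: "cmod (H x1) \<le> 1" if x1: "x1 \<in> \<Omega>" for x1
  proof (rule ccontr)
    assume "\<not> cmod (H x1) \<le> 1"
    then obtain B where B: "1 < B" "B < cmod (H x1)" using dense[of 1 "cmod (H x1)"] by auto
    obtain e where e: "0 < e" "\<And>z y. B \<le> cmod z \<Longrightarrow> y \<in> \<Gamma> \<Longrightarrow> e \<le> dist (\<phi> z) y"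
      using image_far_from_boundary[OF \<Gamma> B(1)] by blast
    obtain r where r: "1 < r" "\<And>z. 1 < cmod z \<Longrightarrow> cmod z < r \<Longrightarrow> \<exists>y\<in>\<Gamma>. dist (F z) y < e"
      using bd[OF e(1)] by blast
    \<comment> \<open>Removed are the points where \<open>G\<close> comes within \<open>e\<close> of
      \<open>\<Gamma>\<close>; this happens throughout the annulus between \<open>1 / r\<close> and
      1. Where \<open>cmod (H x) \<ge> B\<close> and \<open>x \<noteq> 0\<close>, also
      \<open>cmod (\<psi> (G x)) \<ge> B\<close>, so \<open>G x\<close> keeps distance
      \<open>e\<close>. Thus \<open>Q\<close> lies in the closed set
      \<open>T \<subseteq> \<Omega>\<close> and is itself closed.\<close>
    define T where "T = cball 0 (1 / r) - ((ball 0 1 - {0}) \<inter> G -` (\<Union>y\<in>\<Gamma>. ball y e))"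
    have "closed T"
      unfolding T_def by (intro closed_Diff continuous_open_preimage contG opB) auto
    have r1: "1 / r < 1" using r by (simp add: divide_less_eq)
    have T\<Omega>: "T \<subseteq> \<Omega>"
    proof
      fix x assume x: "x \<in> T"
      then have "cmod x < 1" using r1 by (simp add: T_def)
      moreover have "G x \<notin> \<Gamma>" if "x \<noteq> 0"
        using x that \<open>cmod x < 1\<close> e(1) by (fastforce simp: T_def)
      ultimately show "x \<in> \<Omega>" by (auto simp: \<Omega>_def)
    qed
    define Q where "Q = {x \<in> \<Omega>. B \<le> cmod (H x)}"
    have QT: "Q \<subseteq> T"
    proof
      fix x assume x: "x \<in> Q"
      show "x \<in> T"
      proof (cases "x = 0")
        case True
        then show ?thesis using r by (simp add: T_def)
      next
        case False
        have w: "G x \<notin> \<Gamma>" "cmod x < 1" using x False by (auto simp: Q_def \<Omega>_def)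
        have "B \<le> cmod x * cmod (\<psi> (G x))" using x False by (simp add: Q_def H_def norm_mult)
        also have "\<dots> \<le> 1 * cmod (\<psi> (G x))" using w by (intro mult_right_mono) auto
        finally have far: "e \<le> dist (G x) y" if "y \<in> \<Gamma>" for y
          using e(2)[of "\<psi> (G x)" y] that \<psi>(2)[OF w(1)] by simp
        have "1 < cmod (1 / x)" using w False by (simp add: norm_divide)
        then have "\<not> cmod (1 / x) < r" using r(2)[of "1 / x"] far FG[OF w(2) False] by force
        then have "r * cmod x \<le> 1" using False by (simp add: norm_divide field_simps)
        then have "cmod x \<le> 1 / r" using r by (simp add: field_simps)
        then show ?thesis using far by (auto simp: T_def dist_commute not_less)
      qed
    qed
    have "Q = T \<inter> (\<lambda>x. cmod (H x)) -` {B..}" using QT T\<Omega> by (auto simp: Q_def)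
    moreover have "continuous_on T (\<lambda>x. cmod (H x))"
      by (intro continuous_intros continuous_on_subset[OF contH T\<Omega>])
    ultimately have clQ: "closed Q" using \<open>closed T\<close> by (simp add: continuous_closed_preimage)
    have "cmod (H x1) \<le> B"
    \<comment> \<open>The maximum principle is applied on \<open>Q\<close>, because nothing is known
      about continuity of \<open>H\<close> up to the frontier of \<open>\<Omega>\<close>.
      \<open>Q\<close> is a compact subset of \<open>\<Omega>\<close>, and a frontier point with
      \<open>cmod (H x) > B\<close> would be interior by continuity.\<close>
    proof (rule maximum_modulus_frontier[where f = H and S = Q and \<xi> = x1])
      show "H holomorphic_on interior Q"
        by (rule holomorphic_on_subset[OF holH]) (use interior_subset[of Q] in \<open>auto simp: Q_def\<close>)
      show "continuous_on (closure Q) H"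
        by (rule continuous_on_subset[OF contH]) (use clQ in \<open>auto simp: Q_def\<close>)
      show "bounded Q" by (rule bounded_subset[OF bounded_ball[of 0 1]]) (auto simp: Q_def \<Omega>_def)
      show "x1 \<in> Q" using x1 B by (simp add: Q_def)
      fix x assume x: "x \<in> frontier Q"
      show "cmod (H x) \<le> B"
      proof (rule ccontr)
        assume "\<not> cmod (H x) \<le> B"
        moreover have xQ: "x \<in> Q" using x clQ by (simp add: frontier_def)
        ultimately have "x \<in> \<Omega> \<inter> (\<lambda>x. cmod (H x)) -` {B<..}" by (auto simp: Q_def)
        moreover have "open (\<Omega> \<inter> (\<lambda>x. cmod (H x)) -` {B<..})"
          by (intro continuous_open_preimage op\<Omega> continuous_intros contH open_greaterThan)
        moreover have "\<Omega> \<inter> (\<lambda>x. cmod (H x)) -` {B<..} \<subseteq> Q" by (auto simp: Q_def)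
        ultimately have "x \<in> interior Q" by (meson interiorI)
        then show False using x by (simp add: frontier_def)
      qed
    qed
    then show False using B by simp
  qed
  have H0: "cmod (H 0) = D / c1" using D0 c1_pos by (simp add: H_def norm_divide)
  moreover have "0 \<in> \<Omega>" by (simp add: \<Omega>_def)
  ultimately have "D / c1 \<le> 1" using H1[of 0] by simp
  moreover have "1 \<le> D / c1" using D c1_pos by simp
  ultimately have Dc: "D / c1 = 1" by simp
  have "H constant_on ball 0 \<rho>"
  proof (rule maximum_modulus_principle[where U = "ball 0 \<rho>" and \<xi> = 0])
    show "H holomorphic_on ball 0 \<rho>" by (rule holomorphic_on_subset[OF holH \<rho>\<Omega>])
    show "cmod (H x) \<le> cmod (H 0)" if "x \<in> ball 0 \<rho>" for x
      using H1[of x] \<rho>\<Omega> that H0 Dc by auto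
  qed (use \<rho> in auto)
  then have Hc: "H x = 1" if "cmod x < \<rho>" for x
    using that \<rho>(1) Dc unfolding constant_on_def H_def by (metis mem_ball_0 norm_zero of_real_1)
  have near: "F z = \<phi> z" if "1 / \<rho> < cmod z" for z
  proof -
    have z0: "z \<noteq> 0" using that \<rho>(1) by auto
    have "1 \<le> 1 / \<rho>" using \<rho> by simp
    then have "1 < cmod z" using that by linarith
    then have x: "cmod (1 / z) < \<rho>" "cmod (1 / z) < 1" "1 / z \<noteq> 0"
      using that z0 \<rho>(1) by (auto simp: norm_divide field_simps)
    have w: "G (1 / z) \<notin> \<Gamma>" using \<rho>(3) x by blast
    have "1 / z * \<psi> (G (1 / z)) = 1" using Hc[OF x(1)] x(3) by (simp add: H_def)
    then have "\<psi> (G (1 / z)) = z" using z0 by (simp add: field_simps)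
    then have "G (1 / z) = \<phi> z" using \<psi>(2)[OF w] by simp
    then show ?thesis using FG[OF x(2,3)] by simp
  qed
  show ?thesis
  proof (rule analytic_continuation_open[of "{z. 1 / \<rho> < cmod z}" "{z. 1 < cmod z}" F \<phi>])
    show "open {z::complex. 1 / \<rho> < cmod z}" by (intro open_Collect_less continuous_intros)
    have "cmod (of_real (1 / \<rho> + 1)) > 1 / \<rho>" unfolding norm_of_real using \<rho> by simp
    then show "{z::complex. 1 / \<rho> < cmod z} \<noteq> {}" by blast
    show "{z::complex. 1 / \<rho> < cmod z} \<subseteq> {z. 1 < cmod z}"
    proof
      fix z :: complex assume "z \<in> {z. 1 / \<rho> < cmod z}"
      moreover have "1 \<le> 1 / \<rho>" using \<rho> by simp
      ultimately show "z \<in> {z. 1 < cmod z}" by (metis mem_Collect_eq order.strict_trans1)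
    qed
    have "(G \<circ> (\<lambda>z. 1 / z)) holomorphic_on {z. 1 < cmod z}"
      by (rule holomorphic_on_compose_gen[OF _ holG])
         (auto intro!: holomorphic_intros simp: norm_divide divide_less_eq)
    then show "F holomorphic_on {z. 1 < cmod z}"
    proof (rule holomorphic_transform)
      fix z :: complex assume "z \<in> {z. 1 < cmod z}"
      then have "cmod (1 / z) < 1" "1 / z \<noteq> 0" by (auto simp: norm_divide divide_less_eq)
      then show "(G \<circ> (\<lambda>z. 1 / z)) z = F z" using FG[of "1 / z"] by simp
    qed
  qed (use hol open_exterior connected_exterior z near in auto)
qed

end

section \<open>Leading coefficients and convergence of the column functions\<close>

text \<open>Comparison of the coefficients of \<open>z ^ (n + 1)\<close> in the recurrence: on the
  right only \<open>P (n + 1)\<close> has this degree.\<close>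

lemma hessenberg_subdiagonal:
  assumes P: "orthonormal_polys \<mu> P" and d: "hessenberg_matrix P d"
  shows "d (n + 2) (n + 1) = of_real (Re (lead_coeff (P n)) / Re (lead_coeff (P (n + 1))))"
proof -
  have P': "degree (P k) = k" "lead_coeff (P k) \<in> \<real>" "0 < Re (lead_coeff (P k))" for k
    using P unfolding orthonormal_polys_def by blast+
  have c: "coeff (P k) k = of_real (Re (lead_coeff (P k)))" for k
    using P'(1)[of k] of_real_Re[OF P'(2)[of k]] by metis
  have "coeff ([:0, 1:] * P n) (n + 1) = coeff (\<Sum>k=0..n + 1. smult (d (k + 1) (n + 1)) (P k)) (n + 1)"
    using d by (simp only: hessenberg_matrix_def)
  also have "\<dots> = (\<Sum>k=0..n + 1. d (k + 1) (n + 1) * coeff (P k) (n + 1))"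
    by (simp add: coeff_sum)
  also have "\<dots> = (\<Sum>k\<in>{n + 1}. d (k + 1) (n + 1) * coeff (P k) (n + 1))"
    by (rule sum.mono_neutral_right) (auto intro!: coeff_eq_0 simp: P')
  finally have "coeff (P n) n = d (n + 2) (n + 1) * coeff (P (n + 1)) (n + 1)" by simp
  then have "of_real (Re (lead_coeff (P n))) = d (n + 2) (n + 1) * of_real (Re (lead_coeff (P (n + 1))))"
    by (simp only: c)
  then show ?thesis using P'(3)[of "n + 1"] by (simp add: field_simps)
qed

text \<open>Once the ratios stay below \<open>q\<close>, induction gives
  \<open>1 / g n \<le> C * q ^ n\<close>, and the constant \<open>C\<close> disappears in the
  \<open>n\<close>-th root. The slack \<open>e\<close> also keeps \<open>q\<close> positive when
  \<open>D = 0\<close>.\<close>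

lemma root_limit_le_ratio_limit:
  fixes g :: "nat \<Rightarrow> real"
  assumes g: "\<And>n. 0 < g n" and ratio: "(\<lambda>n. g n / g (n + 1)) \<longlonglongrightarrow> D"
    and root: "(\<lambda>n. g n powr (- 1 / real n)) \<longlonglongrightarrow> c"
  shows "c \<le> D"
proof (rule field_le_epsilon)
  fix e :: real assume e: "0 < e"
  have D0: "0 \<le> D" by (rule tendsto_lowerbound[OF ratio]) (auto intro!: always_eventually less_imp_le g divide_pos_pos)
  define q where "q = D + e"
  have q: "0 < q" using D0 e by (simp add: q_def)
  have "\<forall>\<^sub>F n in sequentially. g n / g (n + 1) < q"
    by (rule order_tendstoD(2)[OF ratio]) (use e in \<open>simp add: q_def\<close>)
  then obtain N where N: "\<And>n. n \<ge> N \<Longrightarrow> g n / g (n + 1) < q" by (auto simp: eventually_sequentially)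
  \<comment> \<open>Chosen to give equality at the start \<open>n = N\<close> of the
    induction.\<close>
  define C where "C = 1 / (g N * q ^ N)"
  have C: "0 < C" using g q by (simp add: C_def)
  have le: "1 / g n \<le> C * q ^ n" if "n \<ge> N" for n
    using that
  proof (induction n rule: dec_induct)
    case base
    then show ?case using g[of N] q by (simp add: C_def)
  next
    case (step n)
    have "1 / g (Suc n) = (1 / g n) * (g n / g (n + 1))" using g[of n] by simp
    also have "\<dots> \<le> (C * q ^ n) * q"
      using step N[of n] g[of n] g[of "Suc n"] C q by (intro mult_mono) auto
    finally show ?case by (simp add: mult_ac)
  qed
  have "\<forall>\<^sub>F n in sequentially. g n powr (- 1 / real n) \<le> C powr (1 / real n) * q"
  proof (rule eventually_sequentiallyI[of "max 1 N"])
    fix n assume n: "max 1 N \<le> n"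
    have "g n powr (- 1 / real n) = (1 / g n) powr (1 / real n)"
      using g[of n] by (simp add: powr_minus_divide powr_divide)
    also have "\<dots> \<le> (C * q ^ n) powr (1 / real n)"
      using le[of n] n g[of n] by (intro powr_mono2) auto
    also have "\<dots> = C powr (1 / real n) * (q powr real n) powr (1 / real n)"
      using C q by (simp add: powr_mult powr_realpow)
    also have "\<dots> = C powr (1 / real n) * q" using n q by (simp add: powr_powr)
    finally show "g n powr (- 1 / real n) \<le> C powr (1 / real n) * q" .
  qed
  moreover have "(\<lambda>n. C powr (1 / real n) * q) \<longlonglongrightarrow> C powr 0 * q"
    using C by (intro tendsto_mult tendsto_powr tendsto_const lim_1_over_n) auto
  ultimately have "c \<le> C powr 0 * q"
    by (intro tendsto_le[OF sequentially_bot _ root]) auto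
  then show "c \<le> D + e" using C by (simp add: q_def)
qed

text \<open>With \<open>r\<close> the smallest modulus on \<open>K\<close>, the error is dominated
  by the series of \<open>cmod (a n k - b k) / r ^ k\<close>, which is free of \<open>z\<close>.
  Tannery's theorem with majorant \<open>2 * M / r ^ k\<close> sends it to 0.\<close>

lemma hessenberg_fun_uniform_limit:
  fixes d :: "nat \<Rightarrow> nat \<Rightarrow> complex" and b :: "nat \<Rightarrow> complex"
  assumes K: "compact K" "K \<subseteq> {z. 1 < cmod z}"
    and M: "\<And>i j. 1 \<le> i \<Longrightarrow> 1 \<le> j \<Longrightarrow> cmod (d i j) \<le> M"
    and lim1: "(\<lambda>n. d (n + 1) n) \<longlonglongrightarrow> b1" and lim: "\<And>k. (\<lambda>n. d (n - k) n) \<longlonglongrightarrow> b k"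
  shows "uniform_limit K (hessenberg_fun d) (\<lambda>z. b1 * z + (\<Sum>k. b k / z ^ k)) sequentially"
proof (cases "K = {}")
  case False
  have "continuous_on K cmod" by (intro continuous_intros)
  then obtain z0 z1 where z0: "z0 \<in> K" "\<And>z. z \<in> K \<Longrightarrow> cmod z0 \<le> cmod z" and z1: "\<And>z. z \<in> K \<Longrightarrow> cmod z \<le> cmod z1"
    using continuous_attains_inf[OF K(1) False] continuous_attains_sup[OF K(1) False] by metis
  define r where "r = cmod z0"
  have r: "1 < r" "\<And>z. z \<in> K \<Longrightarrow> r \<le> cmod z" using z0 K(2) by (auto simp: r_def)
  have bM: "cmod (b k) \<le> M" for k
  proof (rule tendsto_upperbound[OF tendsto_norm[OF lim]])
    show "\<forall>\<^sub>F n in sequentially. cmod (d (n - k) n) \<le> M"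
      by (rule eventually_sequentiallyI[of "k + 1"]) (auto intro: M)
  qed simp
  have M0: "0 \<le> M" using order_trans[OF norm_ge_zero bM] .
  have geo: "summable (\<lambda>k. x / r ^ k)" for x :: real
    using summable_mult[OF summable_geometric[of "1 / r"], of x] r by (simp add: power_divide)
  \<comment> \<open>Padding with 0 turns the finite sum into a series. For \<open>k \<ge> n\<close>
    the truncated subtraction would give row index 0, an entry without meaning and outside the bound
    \<open>M\<close>.\<close>
  define a where "a n k = (if k < n then d (n - k) n else 0)" for n k
  have aM: "cmod (a n k) \<le> M" for n k using M M0 by (simp add: a_def)
  have sa: "summable (\<lambda>k. x k / z ^ k)" if "z \<in> K" "\<And>k. cmod (x k) \<le> B" for x z B
  proof (rule summable_norm_cancel, rule summable_comparison_test'[OF geo[of B], of 0])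
    fix k
    have "cmod (x k / z ^ k) = cmod (x k) / cmod z ^ k" by (simp add: norm_divide norm_power)
    also have "\<dots> \<le> B / r ^ k"
      using that(2)[of k] r order_trans[OF norm_ge_zero that(2)] r(2)[OF that(1)]
      by (intro frac_le power_mono) auto
    finally show "norm (norm (x k / z ^ k)) \<le> B / r ^ k" by simp
  qed
  have abM: "cmod (a n k - b k) \<le> 2 * M" for n k
    using norm_triangle_ineq4[of "a n k" "b k"] aM[of n k] bM[of k] by linarith
  define \<delta> where "\<delta> n = cmod (d (n + 1) n - b1) * cmod z1 + (\<Sum>k. cmod (a n k - b k) / r ^ k)" for n
  have sd: "summable (\<lambda>k. cmod (a n k - b k) / r ^ k)" for n
    by (rule summable_comparison_test'[OF geo[of "2 * M"], of 0])
       (use abM r in \<open>auto intro!: divide_right_mono\<close>)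
  have "((\<lambda>n. (\<Sum>k. cmod (a n k - b k) / r ^ k)) \<longlongrightarrow> (\<Sum>k::nat. 0)) sequentially"
  proof (rule tannerys_theorem[THEN conjunct2, THEN conjunct2, OF _ _ geo[of "2 * M"]])
    fix k
    have "\<forall>\<^sub>F n in sequentially. d (n - k) n = a n k"
      by (rule eventually_sequentiallyI[of "k + 1"]) (auto simp: a_def)
    then have "(\<lambda>n. a n k) \<longlonglongrightarrow> b k" by (rule Lim_transform_eventually[OF lim])
    then have "(\<lambda>n. cmod (a n k - b k) / r ^ k) \<longlonglongrightarrow> cmod (b k - b k) / r ^ k"
      using r by (intro tendsto_intros) auto
    then show "(\<lambda>n. cmod (a n k - b k) / r ^ k) \<longlonglongrightarrow> 0" by simp
  next
    show "\<forall>\<^sub>F (k, n) in sequentially \<times>\<^sub>F sequentially. norm (cmod (a n k - b k) / r ^ k) \<le> 2 * M / r ^ k"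
      by (rule always_eventually) (use abM r in \<open>auto intro!: divide_right_mono\<close>)
  qed simp
  then have "\<delta> \<longlonglongrightarrow> cmod (b1 - b1) * cmod z1 + 0"
    unfolding \<delta>_def by (intro tendsto_intros lim1) simp
  then have \<delta>0: "\<delta> \<longlonglongrightarrow> 0" by simp
  have est: "cmod (hessenberg_fun d n z - (b1 * z + (\<Sum>k. b k / z ^ k))) \<le> \<delta> n" if z: "z \<in> K" for n z
  proof -
    have "(\<Sum>k<n. d (n - k) n / z ^ k) = (\<Sum>k. a n k / z ^ k)"
      by (subst suminf_finite[of "{..<n}"]) (auto simp: a_def)
    then have "hessenberg_fun d n z - (b1 * z + (\<Sum>k. b k / z ^ k))
        = (d (n + 1) n - b1) * z + ((\<Sum>k. a n k / z ^ k) - (\<Sum>k. b k / z ^ k))"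
      by (simp add: hessenberg_fun_def algebra_simps)
    also have "(\<Sum>k. a n k / z ^ k) - (\<Sum>k. b k / z ^ k) = (\<Sum>k. (a n k - b k) / z ^ k)"
      using suminf_diff[OF sa[OF z aM[of n]] sa[OF z bM]] by (simp add: diff_divide_distrib)
    also have "cmod ((d (n + 1) n - b1) * z + (\<Sum>k. (a n k - b k) / z ^ k))
        \<le> cmod ((d (n + 1) n - b1) * z) + cmod (\<Sum>k. (a n k - b k) / z ^ k)" by (rule norm_triangle_ineq)
    also have "\<dots> \<le> \<delta> n"
      unfolding \<delta>_def
    proof (rule add_mono)
      show "cmod ((d (n + 1) n - b1) * z) \<le> cmod (d (n + 1) n - b1) * cmod z1"
        unfolding norm_mult by (intro mult_left_mono z1 z) simp
      have le: "norm ((a n k - b k) / z ^ k) \<le> cmod (a n k - b k) / r ^ k" for k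
        unfolding norm_divide norm_power using r r(2)[OF z] by (intro frac_le power_mono) auto
      have sn: "summable (\<lambda>k. norm ((a n k - b k) / z ^ k))"
        by (rule summable_comparison_test'[OF sd[of n], of 0]) (use le in simp)
      show "cmod (\<Sum>k. (a n k - b k) / z ^ k) \<le> (\<Sum>k. cmod (a n k - b k) / r ^ k)"
        by (rule order_trans[OF summable_norm[OF sn] suminf_le[OF le sn sd]])
    qed
    finally show ?thesis .
  qed
  show ?thesis
  proof (rule uniform_limitI)
    fix e :: real assume "0 < e"
    then have "\<forall>\<^sub>F n in sequentially. \<delta> n < e" by (rule order_tendstoD(2)[OF \<delta>0])
    then show "\<forall>\<^sub>F n in sequentially. \<forall>z\<in>K. dist (hessenberg_fun d n z) (b1 * z + (\<Sum>k. b k / z ^ k)) < e"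
      by eventually_elim (auto simp: dist_norm intro: le_less_trans[OF est])
  qed
qed simp

theorem theorem2:
  fixes \<mu> :: "complex measure"
    and P :: "nat \<Rightarrow> complex poly"
    and d :: "nat \<Rightarrow> nat \<Rightarrow> complex"
    and A T :: "ell2 \<Rightarrow> ell2"
    and \<phi> :: "complex \<Rightarrow> complex"
  assumes "prob_space \<mu>" and "sets \<mu> = sets borel"
    and "compact (measure_support \<mu>)" and "infinite (measure_support \<mu>)"
    and "orthonormal_polys \<mu> P"
    and "hessenberg_matrix P d"
    and "regular_measure \<mu> P"
    and "\<exists>\<J>. finite \<J> \<and> (\<forall>J\<in>\<J>. jordan_arc J) \<and> measure_support \<mu> = \<Union>\<J>"
    and "simply_connected_space (sphere_complement (measure_support \<mu>))"
    and "operator_of_matrix d A"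
    and "uniform_toeplitz_limit A T"
    and "\<exists>f. is_symbol T f \<and> continuous_on (sphere 0 1) f"
    and "riemann_mapping \<phi> (measure_support \<mu>)"
  shows "\<forall>K. compact K \<and> K \<subseteq> {z. 1 < cmod z} \<longrightarrow>
           uniform_limit K (hessenberg_fun d) \<phi> sequentially"
proof -
  let ?\<Gamma> = "measure_support \<mu>"
  note \<mu> = assms(1-3) and P = assms(5) and d = assms(6) and A = assms(10) and T = assms(11)
  obtain f where sym: "is_symbol T f" and f: "continuous_on (sphere 0 1) f" using assms(12) by blast
  obtain c1 c where "exterior_map \<phi> ?\<Gamma> c1 c"
    using assms(13) unfolding riemann_mapping_def exterior_map_def by (auto simp: less_complex_def)
  then interpret exterior_map \<phi> ?\<Gamma> c1 c .
  have bA: "bounded_operator A" and entry: "\<And>i j. matrix_entry A i j = d (i + 1) (j + 1)"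
    using A by (auto simp: operator_of_matrix_def)
  have ent: "(\<lambda>n. d (i + n + 1) (j + n + 1)) \<longlonglongrightarrow> fourier_coeff f (int i - int j)" for i j
    using toeplitz_limit_entry[OF T, of i j] sym by (simp add: is_symbol_def entry)
  have lim1: "(\<lambda>n. d (n + 1) n) \<longlonglongrightarrow> fourier_coeff f 1"
    by (rule LIMSEQ_offset[of _ 1]) (use ent[of 1 0] in simp)
  \<comment> \<open>After the offset \<open>k + 1\<close> the entry is
    \<open>d (n + 1) (n + k + 1)\<close>, so the truncated indices are skipped and row 0, column
    \<open>k\<close> of the zero-based limit matrix is reached.\<close>
  have lim: "(\<lambda>n. d (n - k) n) \<longlonglongrightarrow> fourier_coeff f (- int k)" for k
    by (rule LIMSEQ_offset[of _ "k + 1"]) (use ent[of 0 k] in \<open>simp add: add.commute\<close>)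
  have anal: "fourier_coeff f k = 0" if "2 \<le> k" for k
  proof -
    have "d (nat k + n + 1) (0 + n + 1) = 0" for n
      using d that unfolding hessenberg_matrix_def by auto
    then have "(\<lambda>n. 0) \<longlonglongrightarrow> fourier_coeff f (int (nat k) - int 0)"
      using ent[of "nat k" 0] by simp
    then show ?thesis using that by (simp add: LIMSEQ_const_iff)
  qed
  define D where "D = Re (fourier_coeff f 1)"
  define g where "g n = Re (lead_coeff (P n))" for n
  have "(\<lambda>n. d (n + 2) (n + 1)) \<longlonglongrightarrow> fourier_coeff f 1" using ent[of 1 0] by simp
  then have ratioC: "(\<lambda>n. complex_of_real (g n / g (n + 1))) \<longlonglongrightarrow> fourier_coeff f 1"
    unfolding hessenberg_subdiagonal[OF P d] g_def .
  then have ratio: "(\<lambda>n. g n / g (n + 1)) \<longlonglongrightarrow> D"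
    using tendsto_Re[OF ratioC] by (simp add: D_def)
  \<comment> \<open>The subdiagonal entries are real, hence so is their limit: \<open>F\<close>
    starts with a real coefficient \<open>D\<close> that can be compared with
    \<open>c1\<close>.\<close>
  then have "(\<lambda>n. complex_of_real (g n / g (n + 1))) \<longlonglongrightarrow> of_real D" by (rule tendsto_of_real)
  then have fD: "fourier_coeff f 1 = of_real D" using ratioC LIMSEQ_unique by blast
  have "log_capacity ?\<Gamma> \<le> D"
  proof (rule root_limit_le_ratio_limit[OF _ ratio])
    show "0 < g n" for n using P unfolding g_def orthonormal_polys_def by blast
    show "(\<lambda>n. g n powr (- 1 / real n)) \<longlonglongrightarrow> log_capacity ?\<Gamma>"
      using assms(7) by (simp add: regular_measure_def g_def)
  qed
  then have c1D: "c1 \<le> D" using log_capacity_ge[OF \<mu>(3)] by simp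
  define F where "F = symbol_extension f"
  obtain B where B: "0 < B" "\<And>\<zeta>. cmod \<zeta> = 1 \<Longrightarrow> cmod (f \<zeta>) \<le> B" using circle_bound[OF f] by blast
  have series: "(\<lambda>k. fourier_coeff f (- int k) / z ^ k) sums (F z - of_real D * z)" if "1 < cmod z" for z
  proof -
    have "summable (\<lambda>k. fourier_coeff f (- int k) / z ^ k)"
    proof (rule summable_norm_cancel, rule summable_comparison_test'[of _ 0])
      show "summable (\<lambda>k. B * (1 / cmod z) ^ k)"
        using that by (intro summable_mult summable_geometric) (simp add: divide_less_eq)
      show "norm (norm (fourier_coeff f (- int k) / z ^ k)) \<le> B * (1 / cmod z) ^ k" for k
        using cmod_fourier_coeff_le[OF f B(2), of "- int k"]
        by (simp add: norm_divide norm_power power_divide divide_right_mono)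
    qed
    then show ?thesis using fD by (simp add: F_def symbol_extension_def summable_sums)
  qed
  have near: "\<exists>r>1. \<forall>z. 1 < cmod z \<and> cmod z < r \<longrightarrow> (\<exists>y\<in>?\<Gamma>. dist (F z) y < e)" if "0 < e" for e
  proof -
    obtain r where r: "1 < r" "\<And>z. 1 < cmod z \<Longrightarrow> cmod z < r \<Longrightarrow> cmod (symbol_extension f z - f (z / cmod z)) < e"
      using symbol_extension_boundary[OF f anal \<open>0 < e\<close>] by blast
    have "f (z / cmod z) \<in> ?\<Gamma>" if "1 < cmod z" for z
    proof (rule symbol_in_support[OF \<mu> _ P d A T sym f])
      show "?\<Gamma> \<noteq> {}" using assms(4) by auto
      have "z \<noteq> 0" using that by auto
      then show "cmod (z / cmod z) = 1" by (simp add: norm_divide)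
    qed
    then show ?thesis using r by (auto simp: F_def dist_norm)
  qed
  have F\<phi>: "F z = \<phi> z" if "1 < cmod z" for z
    by (rule eq_of_boundary_values[OF \<mu>(3) c1D series near that])
  show ?thesis
  proof (intro allI impI)
    fix K :: "complex set" assume K: "compact K \<and> K \<subseteq> {z. 1 < cmod z}"
    have dM: "cmod (d i j) \<le> onorm A" if "1 \<le> i" "1 \<le> j" for i j
      using cmod_matrix_entry_le[OF bA, of "i - 1" "j - 1"] that by (simp add: entry)
    have "uniform_limit K (hessenberg_fun d) (\<lambda>z. fourier_coeff f 1 * z + (\<Sum>k. fourier_coeff f (- int k) / z ^ k)) sequentially"
      using K by (intro hessenberg_fun_uniform_limit[OF _ _ dM lim1 lim]) auto
    moreover have "fourier_coeff f 1 * z + (\<Sum>k. fourier_coeff f (- int k) / z ^ k) = \<phi> z" if "z \<in> K" for z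
      using F\<phi>[of z] K that by (auto simp: F_def symbol_extension_def)
    ultimately show "uniform_limit K (hessenberg_fun d) \<phi> sequentially"
      by (subst uniform_limit_cong'[of K "hessenberg_fun d" "hessenberg_fun d" \<phi>]) auto
  qed
qed

end
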